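(* Let $\Lambda$ be the limit set of a CIFS $\{S_i\}_{i\in\mathcal{I}}$ on $\mathbb{R}^d$, and let $F$ be the set of fixed points of the maps $S_i$, $i\in\mathcal{I}$. For $0<r<1$ put $s(r)=\frac{\log N_r(F)}{\log(1/r)}$, for $0<\theta\leq1$ put $$\Psi(r,\theta)=(1-\theta)\dim_{\mathrm H}\Lambda+\theta s(r^\theta),$$ put $\Psi(r,0)=\lim_{\theta\to0}\Psi(r,\theta)$, and let $\psi(r)=\sup_{\theta\in[0,1]}\Psi(r,\theta)$. Then $$\lim_{r\to0}\left(\frac{\log N_r(\Lambda)}{\log(1/r)}-\psi(r)\right)=0.$$ In particular, $\underline{\dim}_{\mathrm B}\Lambda=\liminf_{r\to0}\psi(r)$.
   Context: For a non-empty bounded set $E\subset\mathbb{R}^d$, $N_r(E)$ is the least number of open balls of radius $r$ required to cover $E$; $\underline{\dim}_{\mathrm B}E=\liminf_{r\to0}\frac{\log N_r(E)}{\log(1/r)}$ is the lower box dimension; $\dim_{\mathrm H}$ is Hausdorff dimension. CIFS. Let $d\in\mathbb{N}$, let $X\subset\mathbb{R}^d$ (Euclidean norm) be compact and connected, and let $\mathcal{I}$ be a non-empty countable index set. Let $S_i\colon X\to X$ ($i\in\mathcal{I}$) be injective and uniformly contracting: there is $0<c<1$ with $0<\|S_i(x)-S_i(y)\|\leq c\|x-y\|$ for all $i\in\mathcal{I}$ and all distinct $x,y\in X$. Let $\mathcal{I}^*=\bigcup_{n\geq0}\mathcal{I}^n$ be the set of finite words; for $\mathtt{i}=(i_1,\dots,i_n)$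 write $S_{\mathtt{i}}=S_{i_1}\circ\cdots\circ S_{i_n}$ (the identity for the empty word). For $\gamma\in\mathcal{I}^{\mathbb{N}}$, $\gamma|_n\in\mathcal{I}^n$ is its prefix of length $n$. The limit set (attractor) is $\Lambda=\bigcup_{\gamma\in\mathcal{I}^{\mathbb{N}}}\bigcap_{n=1}^\infty S_{\gamma|_n}(X)$. The family $\{S_i\}_{i\in\mathcal{I}}$ is called a CIFS if: (i) Conformality: there is an open, bounded, connected $V\subset\mathbb{R}^d$ with $X\subset V$ such that each $S_i$ extends to a conformal $C^{1+\varepsilon}$ diffeomorphism on $V$ (of $V$ onto its image in $V$). (ii) Bounded distortion: there is $K\geq1$ with $\|S_{\mathtt{i}}'(x)\|\leq K\|S_{\mathtt{i}}'(y)\|$ for all $x,y\in V$, $\mathtt{i}\in\mathcal{I}^*$, where $S_{\mathtt{i}}'(x)$ is the Jacobian matrix and $\|\cdot\|$ the spectral norm. (iii) Open set condition: $X$ has non-empty interior $U$, $S_i(U)\subset U$ for all $i$, and $S_i(U)\cap S_j(U)=\varnothing$ for $i\neq j$. (iv) Cone condition: $\inf_{x\in X}\inf_{r\in(0,1)}r^{-d}\mathcal{L}^d(B(x,r)\cap U)>0$, where $\mathcal{L}^d$ is Lebesgue measure and $B(x,r)$ the open ball. *)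

theory Defs
  imports "HOL-Analysis.Analysis"
begin

section \<open>Covering numbers and dimensions\<close>

text \<open>The centres of the covering balls are arbitrary points of the space.\<close>

definition covering_number :: "real \<Rightarrow> 'a::metric_space set \<Rightarrow> nat" where
  "covering_number r E = (LEAST n. \<exists>A. finite A \<and> card A = n \<and> E \<subseteq> (\<Union>a\<in>A. ball a r))"

definition box_quotient :: "'a::metric_space set \<Rightarrow> real \<Rightarrow> real" where
  "box_quotient E r = ln (real (covering_number r E)) / ln (1 / r)"

definition lower_box_dim :: "'a::metric_space set \<Rightarrow> ereal" where
  "lower_box_dim E = Liminf (at_right 0) (\<lambda>r. ereal (box_quotient E r))"

text \<open>
  Boundedness of the covering sets is required separately because \<^const>\<open>diameter\<close> is
  unspecified on unbounded sets. The exponent is only used for \<open>s > 0\<close>, so that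
  \<open>0 powr s = 0\<close> is the intended value on empty sets and singletons.
\<close>

definition hausdorff_premeasure :: "real \<Rightarrow> real \<Rightarrow> 'a::metric_space set \<Rightarrow> ennreal" where
  "hausdorff_premeasure s \<delta> E =
     (INF C\<in>{C :: nat \<Rightarrow> 'a set. E \<subseteq> (\<Union>k. C k) \<and> (\<forall>k. bounded (C k) \<and> diameter (C k) \<le> \<delta>)}.
        \<Sum>k. ennreal (diameter (C k) powr s))"

definition hausdorff_measure :: "real \<Rightarrow> 'a::metric_space set \<Rightarrow> ennreal" where
  "hausdorff_measure s E = (SUP \<delta>\<in>{0<..}. hausdorff_premeasure s \<delta> E)"

text \<open>
  Leaving out \<open>s = 0\<close> does not change the infimum. In a Euclidean space the set below is
  non-empty, since it contains every \<open>s\<close> larger than the dimension of the space.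
\<close>

definition hausdorff_dim :: "'a::metric_space set \<Rightarrow> real" where
  "hausdorff_dim E = Inf {s. 0 < s \<and> hausdorff_measure s E = 0}"


section \<open>Conformal diffeomorphisms\<close>

definition spectral_norm :: "real ^ 'n ^ 'm \<Rightarrow> real" where
  "spectral_norm A = onorm (\<lambda>v. A *v v)"

text \<open>
  The Hoelder condition on the derivative is local, as is usual for differentiability
  classes on an open set; it is implied by a global Hoelder condition.
\<close>

definition C1_holder_on :: "real \<Rightarrow> (real ^ 'n \<Rightarrow> real ^ 'n) \<Rightarrow> (real ^ 'n) set \<Rightarrow> bool" where
  "C1_holder_on \<epsilon> f V \<longleftrightarrow>
     (\<forall>x\<in>V. f differentiable (at x)) \<and>
     (\<forall>x\<in>V. \<exists>\<delta>>0. \<exists>C. ball x \<delta> \<subseteq> V \<and>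
        (\<forall>y\<in>ball x \<delta>. \<forall>z\<in>ball x \<delta>.
           spectral_norm (jacobian f (at y) - jacobian f (at z)) \<le> C * dist y z powr \<epsilon>))"

definition C1_holder_diffeo_on :: "real \<Rightarrow> (real ^ 'n \<Rightarrow> real ^ 'n) \<Rightarrow> (real ^ 'n) set \<Rightarrow> bool" where
  "C1_holder_diffeo_on \<epsilon> f V \<longleftrightarrow>
     inj_on f V \<and> open (f ` V) \<and>
     C1_holder_on \<epsilon> f V \<and> C1_holder_on \<epsilon> (the_inv_into V f) (f ` V)"

text \<open>Orientation-reversing maps are allowed.\<close>

definition conformal_on :: "(real ^ 'n \<Rightarrow> real ^ 'n) \<Rightarrow> (real ^ 'n) set \<Rightarrow> bool" where
  "conformal_on f V \<longleftrightarrow>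
     (\<forall>x\<in>V. f differentiable (at x) \<and>
        (\<exists>a>0. \<exists>Q. orthogonal_matrix Q \<and> jacobian f (at x) = a *\<^sub>R Q))"


section \<open>Conformal iterated function systems\<close>

definition word_map :: "('i \<Rightarrow> 'a \<Rightarrow> 'a) \<Rightarrow> 'i list \<Rightarrow> 'a \<Rightarrow> 'a" where
  "word_map S w = foldr (\<lambda>i f. S i \<circ> f) w id"

definition limit_set :: "'i set \<Rightarrow> ('i \<Rightarrow> 'a \<Rightarrow> 'a) \<Rightarrow> 'a set \<Rightarrow> 'a set" where
  "limit_set I S X =
     (\<Union>\<gamma>\<in>{\<gamma> :: nat \<Rightarrow> 'i. range \<gamma> \<subseteq> I}. \<Inter>n\<in>{1..}. word_map S (map \<gamma> [0..<n]) ` X)"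

definition fixed_points :: "'i set \<Rightarrow> ('i \<Rightarrow> 'a \<Rightarrow> 'a) \<Rightarrow> 'a set \<Rightarrow> 'a set" where
  "fixed_points I S X = {x \<in> X. \<exists>i\<in>I. S i x = x}"

text \<open>
  Only the values of \<open>S i\<close> on \<open>X\<close> matter. The extensions to \<open>V\<close> are the maps \<open>T i\<close>; they
  need not be determined by the maps \<open>S i\<close>, so bounded distortion refers to the same
  \<open>V\<close> and \<open>T\<close> as conformality.
\<close>

definition CIFS ::
  "'i set \<Rightarrow> ('i \<Rightarrow> real ^ 'n \<Rightarrow> real ^ 'n) \<Rightarrow> (real ^ 'n) set \<Rightarrow> bool" where
  "CIFS I S X \<longleftrightarrow>
     I \<noteq> {} \<and> countable I \<and> compact X \<and> connected X \<and>
     (\<forall>i\<in>I. S i ` X \<subseteq> X) \<and>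
     (\<exists>c. 0 < c \<and> c < 1 \<and>
        (\<forall>i\<in>I. \<forall>x\<in>X. \<forall>y\<in>X. x \<noteq> y \<longrightarrow>
           0 < norm (S i x - S i y) \<and> norm (S i x - S i y) \<le> c * norm (x - y))) \<and>
     (\<exists>V T.
        (open V \<and> bounded V \<and> connected V \<and> X \<subseteq> V \<and>
         (\<exists>\<epsilon>>0. \<forall>i\<in>I. (\<forall>x\<in>X. T i x = S i x) \<and> T i ` V \<subseteq> V \<and>
            C1_holder_diffeo_on \<epsilon> (T i) V \<and> conformal_on (T i) V)) \<and>
        (\<exists>K\<ge>1. \<forall>w\<in>lists I. \<forall>x\<in>V. \<forall>y\<in>V.
            spectral_norm (jacobian (word_map T w) (at x)) \<le>
              K * spectral_norm (jacobian (word_map T w) (at y)))) \<and>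
     interior X \<noteq> {} \<and>
     (\<forall>i\<in>I. S i ` interior X \<subseteq> interior X) \<and>
     (\<forall>i\<in>I. \<forall>j\<in>I. i \<noteq> j \<longrightarrow> S i ` interior X \<inter> S j ` interior X = {}) \<and>
     0 < (INF x\<in>X. INF r\<in>{0<..<1::real}.
            measure lebesgue (ball x r \<inter> interior X) / r ^ CARD('n))"


section \<open>The interpolating function\<close>

text \<open>
  The arguments are \<open>h\<close>, the Hausdorff dimension of the limit set, and \<open>F\<close>, the set of
  fixed points. For \<open>0 < r < 1\<close> and bounded non-empty \<open>F\<close>, the limit at \<open>\<theta> = 0\<close>
  exists: \<open>\<theta> * box_quotient F (r powr \<theta>)\<close> equals
  \<open>ln (covering_number (r powr \<theta>) F) / ln (1 / r)\<close>, which is monotone in \<open>\<theta>\<close> and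
  constant for small \<open>\<theta> > 0\<close>.
\<close>

definition Psi_pos :: "real \<Rightarrow> 'a::metric_space set \<Rightarrow> real \<Rightarrow> real \<Rightarrow> real" where
  "Psi_pos h F r \<theta> = (1 - \<theta>) * h + \<theta> * box_quotient F (r powr \<theta>)"

definition Psi :: "real \<Rightarrow> 'a::metric_space set \<Rightarrow> real \<Rightarrow> real \<Rightarrow> real" where
  "Psi h F r \<theta> = (if \<theta> = 0 then Lim (at_right 0) (Psi_pos h F r) else Psi_pos h F r \<theta>)"

definition psi :: "real \<Rightarrow> 'a::metric_space set \<Rightarrow> real \<Rightarrow> real" where
  "psi h F r = (SUP \<theta>\<in>{0..1}. Psi h F r \<theta>)"

end

theory Submission
  imports Defs "HOL-Library.Sublist"
begin

text \<open>
  Write \<open>size w\<close> for the conformal factor of \<open>S\<^bsub>w\<^esub>\<close> at a fixed interior point of \<open>X\<close> and \<open>h\<close> for the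
  Hausdorff dimension of \<open>\<Lambda>\<close>. For \<open>t > h\<close> the sum of \<open>size w powr t\<close> over all words is finite, so
  there are \<open>O(2 ^ k powr t)\<close> words of size about \<open>2 ^ (- k)\<close>; a point of \<open>\<Lambda>\<close> whose last prefix of size
  above \<open>r\<close> has size about \<open>2 ^ (- k)\<close> lies in the image under that prefix of an \<open>O(r * 2 ^ k)\<close>-neighbourhood of
  \<open>F\<close>, and \<open>r * 2 ^ k = r powr \<theta>\<close> ranges over \<open>O(ln (1 / r))\<close> scales. For \<open>t < h\<close> there are at least
  \<open>(r powr \<theta> / r) powr t\<close> essentially disjoint cylinders of size about \<open>r / r powr \<theta>\<close>, each containing
  a copy of an \<open>r powr \<theta>\<close>-separated subset of \<open>F\<close>, and by the open set and cone conditions an \<open>r\<close>-ball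
  contains boundedly many of the resulting points.
\<close>

section \<open>Covering numbers and the interpolating function\<close>

text \<open>Two points shape the argument. The alphabet may be infinite, so \<open>h\<close> is
  reached through finite sets of words of one common length: such a set, used as an alphabet,
  generates a subset of the limit set, and non-zero Hausdorff measure there bounds \<open>h\<close>
  from below. This requires the new alphabet to satisfy the same hypotheses with the same constants.
  Hence everything after the analysis of conformal maps rests on axioms about words alone (size,
  Lipschitz bound, volume bound), and conformality serves only to verify them. The second point is
  why \<open>F\<close> suffices. If \<open>w\<close> has size above \<open>r\<close> and the next
  letter \<open>i\<close> brings the size down to \<open>r\<close>, then \<open>size [i]\<close> is
  at most \<open>K * (r / size w)\<close>, so the image of \<open>X\<close> under \<open>S i\<close>
  is small and contains its own fixed point; any of its points may be replaced by that fixed point.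
  All losses are factors independent of \<open>r\<close>, except the number of dyadic scales.
  Dividing logarithms by \<open>ln (1 / r)\<close> removes both.\<close>

lemma covering_number_le:
  assumes "finite A" "E \<subseteq> (\<Union>a\<in>A. ball a r)"
  shows "covering_number r E \<le> card A"
  unfolding covering_number_def by (rule Least_le) (use assms in blast)

lemma bounded_finite_ball_cover:
  fixes E :: "'a::heine_borel set"
  assumes "bounded E" "0 < r"
  obtains A where "finite A" "E \<subseteq> (\<Union>a\<in>A. ball a r)"
proof -
  have "compact (closure E)"
    using assms(1) by (simp add: compact_closure)
  moreover have "closure E \<subseteq> (\<Union>a\<in>closure E. ball a r)"
    using assms(2) by auto
  ultimately obtain A where "finite A" "closure E \<subseteq> (\<Union>a\<in>A. ball a r)"
    using compactE_image[of "closure E" "closure E" "\<lambda>a. ball a r"] by (metis open_ball)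
  with closure_subset[of E] show ?thesis
    using that by blast
qed

lemma covering_number_cover:
  fixes E :: "'a::heine_borel set"
  assumes "bounded E" "0 < r"
  obtains A where "finite A" "card A = covering_number r E" "E \<subseteq> (\<Union>a\<in>A. ball a r)"
proof -
  obtain A where "finite A" "E \<subseteq> (\<Union>a\<in>A. ball a r)"
    using bounded_finite_ball_cover[OF assms] .
  then have "\<exists>A. finite A \<and> card A = covering_number r E \<and> E \<subseteq> (\<Union>a\<in>A. ball a r)"
    unfolding covering_number_def
    by (intro LeastI_ex[of "\<lambda>n. \<exists>A. finite A \<and> card A = n \<and> E \<subseteq> (\<Union>a\<in>A. ball a r)"]) auto
  then show ?thesis
    using that by auto
qed

lemma covering_number_pos:
  fixes E :: "'a::heine_borel set"
  assumes "bounded E" "0 < r" "E \<noteq> {}"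
  shows "0 < covering_number r E"
proof -
  obtain A where "finite A" "card A = covering_number r E" "E \<subseteq> (\<Union>a\<in>A. ball a r)"
    using covering_number_cover assms by blast
  with assms(3) have "A \<noteq> {}"
    by blast
  with \<open>finite A\<close> \<open>card A = _\<close> show ?thesis
    by (simp add: card_gt_0_iff flip: \<open>card A = _\<close>)
qed

lemma covering_number_mono:
  fixes E :: "'a::heine_borel set"
  assumes "bounded E" "0 < r" "r \<le> r'" "E' \<subseteq> E"
  shows "covering_number r' E' \<le> covering_number r E"
proof -
  obtain A where A: "finite A" "card A = covering_number r E" "E \<subseteq> (\<Union>a\<in>A. ball a r)"
    using covering_number_cover assms by blast
  have "(\<Union>a\<in>A. ball a r) \<subseteq> (\<Union>a\<in>A. ball a r')"
    using assms(3) by (intro UN_mono subset_ball) auto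
  then have "E' \<subseteq> (\<Union>a\<in>A. ball a r')"
    using A(3) assms(4) by (meson order_trans)
  with A show ?thesis
    using covering_number_le by metis
qed

text \<open>A separated set of largest cardinality works: by maximality its \<open>r\<close>-balls
  cover \<open>E\<close>. Cardinalities are bounded because each ball of radius \<open>r/2\<close>
  contains at most one point of a separated set.\<close>

lemma separated_subset_covering_number:
  fixes E :: "'a::heine_borel set"
  assumes "bounded E" "0 < r"
  obtains Y where "finite Y" "Y \<subseteq> E" "\<And>x y. \<lbrakk>x \<in> Y; y \<in> Y; x \<noteq> y\<rbrakk> \<Longrightarrow> r \<le> dist x y"
    "covering_number r E \<le> card Y"
proof -
  define sep where "sep Y \<longleftrightarrow> finite Y \<and> Y \<subseteq> E \<and> (\<forall>x\<in>Y. \<forall>y\<in>Y. x \<noteq> y \<longrightarrow> r \<le> dist x y)" for Y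
  obtain A where A: "finite A" "E \<subseteq> (\<Union>a\<in>A. ball a (r/2))"
    using bounded_finite_ball_cover[OF assms(1), of "r/2"] assms(2) by auto
  have bound: "card Y \<le> card A" if "sep Y" for Y
  proof -
    have "Y \<subseteq> E"
      using that unfolding sep_def by simp
    then have "\<forall>y\<in>Y. \<exists>a\<in>A. y \<in> ball a (r/2)"
      using A(2) by blast
    then obtain f where f: "\<And>y. y \<in> Y \<Longrightarrow> f y \<in> A \<and> y \<in> ball (f y) (r/2)"
      by metis
    have "inj_on f Y"
    proof (rule inj_onI, rule ccontr)
      fix x y assume xy: "x \<in> Y" "y \<in> Y" "f x = f y" "x \<noteq> y"
      have "dist x y < r"
        using f[OF xy(1)] f[OF xy(2)] xy(3) dist_triangle_half_r[of "f x" x r y] by simp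
      with that xy show False
        unfolding sep_def by force
    qed
    then show ?thesis
      using f A(1) by (auto intro: card_inj_on_le)
  qed
  have "sep {}"
    unfolding sep_def by simp
  then have "\<exists>Y. sep Y \<and> (\<forall>Z. sep Z \<longrightarrow> card Z \<le> card Y)"
    using ex_has_greatest_nat[of sep "{}" card "Suc (card A)"] bound by (simp add: less_Suc_eq_le)
  then obtain Y where Y: "sep Y" "\<And>Z. sep Z \<Longrightarrow> card Z \<le> card Y"
    by blast
  have "E \<subseteq> (\<Union>a\<in>Y. ball a r)"
  proof
    fix x assume x: "x \<in> E"
    show "x \<in> (\<Union>a\<in>Y. ball a r)"
    proof (rule ccontr)
      assume n: "x \<notin> (\<Union>a\<in>Y. ball a r)"
      then have "x \<notin> Y"
        using assms(2) by auto
      moreover have "sep (insert x Y)"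
        using Y(1) n x unfolding sep_def by (auto simp: dist_commute not_less)
      ultimately show False
        using Y(2)[of "insert x Y"] Y(1) unfolding sep_def by simp
    qed
  qed
  then show ?thesis
    using Y(1) covering_number_le[of Y E r] that[of Y] unfolding sep_def by simp
qed

text \<open>One cover of \<open>cball 0 C\<close> by unit balls, translated and scaled, serves every
  centre and every radius.\<close>

lemma cball_covered_by_small_balls:
  fixes C :: real
  shows "\<exists>M. \<forall>r>0. \<forall>z::'a::euclidean_space.
           \<exists>A. finite A \<and> card A \<le> M \<and> cball z (C * r) \<subseteq> (\<Union>a\<in>A. ball a r)"
proof -
  obtain A where A: "finite A" "cball (0::'a) C \<subseteq> (\<Union>a\<in>A. ball a 1)"
    using bounded_finite_ball_cover[of "cball (0::'a) C" 1] by auto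
  show ?thesis
  proof (intro exI[of _ "card A"] allI impI)
    fix r :: real and z :: 'a assume r: "0 < r"
    let ?g = "\<lambda>a. z + r *\<^sub>R a"
    have "cball z (C * r) \<subseteq> (\<Union>a\<in>?g ` A. ball a r)"
    proof
      fix x assume x: "x \<in> cball z (C * r)"
      define y where "y = (1/r) *\<^sub>R (x - z)"
      have xy: "x = z + r *\<^sub>R y"
        using r by (simp add: y_def)
      have "norm y \<le> C"
        using x r by (simp add: y_def dist_norm norm_minus_commute divide_le_eq)
      then obtain a where a: "a \<in> A" "dist a y < 1"
        using A(2) by (force simp: subset_eq)
      have "dist (?g a) x = r * dist a y"
        using r by (simp add: xy dist_norm flip: scaleR_diff_right)
      then have "dist (?g a) x < r"
        using a(2) r by simp
      with a(1) show "x \<in> (\<Union>a\<in>?g ` A. ball a r)"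
        by auto
    qed
    then show "\<exists>B. finite B \<and> card B \<le> card A \<and> cball z (C * r) \<subseteq> (\<Union>a\<in>B. ball a r)"
      using A(1) card_image_le[OF A(1), of ?g] by blast
  qed
qed

section \<open>Logarithmic form and supremum of the interpolating function\<close>

lemma Psi_pos_eq:
  assumes "0 < r" "r < 1" "0 < \<theta>"
  shows "Psi_pos h F r \<theta> = (1 - \<theta>) * h + ln (real (covering_number (r powr \<theta>) F)) / ln (1 / r)"
proof -
  have "ln (1 / r powr \<theta>) = \<theta> * ln (1 / r)"
    using assms by (simp add: ln_div ln_powr)
  then show ?thesis
    using assms unfolding Psi_pos_def box_quotient_def by simp
qed

lemma Psi_pos_tendsto_at_right_0:
  fixes F :: "'a::heine_borel set"
  assumes "0 < r" "r < 1" "bounded F"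
  shows "\<exists>m. (Psi_pos h F r \<longlongrightarrow> m) (at_right 0)"
proof -
  let ?N = "\<lambda>\<theta>. covering_number (r powr \<theta>) F"
  \<comment> \<open>A function with natural values attains its minimum. As \<open>\<theta>\<close>
    decreases, \<open>r powr \<theta>\<close> grows and the covering number cannot increase, so it
    keeps the minimal value below \<open>\<theta>0\<close>.\<close>
  obtain \<theta>0 where \<theta>0: "0 < \<theta>0" "\<And>\<theta>. 0 < \<theta> \<Longrightarrow> ?N \<theta>0 \<le> ?N \<theta>"
    using ex_has_least_nat[of "\<lambda>\<theta>::real. 0 < \<theta>" 1 ?N] by auto
  have "?N \<theta> = ?N \<theta>0" if "0 < \<theta>" "\<theta> < \<theta>0" for \<theta>
  proof (rule antisym)
    show "?N \<theta> \<le> ?N \<theta>0"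
      using that assms by (intro covering_number_mono) (auto intro: powr_mono')
  qed (use \<theta>0 that in auto)
  then have "eventually (\<lambda>\<theta>. (1 - \<theta>) * h + ln (real (?N \<theta>0)) / ln (1 / r) = Psi_pos h F r \<theta>) (at_right 0)"
    unfolding eventually_at_right_field
    using \<theta>0(1) Psi_pos_eq[OF assms(1,2), of _ h F] by (intro exI[of _ \<theta>0]) auto
  moreover have "((\<lambda>\<theta>::real. (1 - \<theta>) * h + ln (real (?N \<theta>0)) / ln (1 / r)) \<longlongrightarrow>
                 (1 - 0) * h + ln (real (?N \<theta>0)) / ln (1 / r)) (at_right 0)"
    by (intro tendsto_intros)
  ultimately show ?thesis
    using Lim_transform_eventually by blast
qed

lemma Psi_0_le:
  fixes F :: "'a::heine_borel set"
  assumes "0 < r" "r < 1" "bounded F" "\<And>\<theta>. \<lbrakk>0 < \<theta>; \<theta> \<le> 1\<rbrakk> \<Longrightarrow> Psi_pos h F r \<theta> \<le> B"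
  shows "Psi h F r 0 \<le> B"
proof -
  obtain m where m: "(Psi_pos h F r \<longlongrightarrow> m) (at_right 0)"
    using Psi_pos_tendsto_at_right_0 assms by blast
  then have "Psi h F r 0 = m"
    unfolding Psi_def by (simp add: tendsto_Lim)
  moreover have "m \<le> B"
  proof (rule tendsto_upperbound[OF m])
    show "\<forall>\<^sub>F \<theta> in at_right 0. Psi_pos h F r \<theta> \<le> B"
      using assms(4) by (auto simp: eventually_at_right_field intro!: exI[of _ 1])
  qed simp
  ultimately show ?thesis
    by simp
qed

lemma psi_le:
  fixes F :: "'a::heine_borel set"
  assumes "0 < r" "r < 1" "bounded F" "\<And>\<theta>. \<lbrakk>0 < \<theta>; \<theta> \<le> 1\<rbrakk> \<Longrightarrow> Psi_pos h F r \<theta> \<le> B"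
  shows "psi h F r \<le> B"
  unfolding psi_def
proof (rule cSUP_least)
  fix \<theta> :: real assume "\<theta> \<in> {0..1}"
  then show "Psi h F r \<theta> \<le> B"
    using Psi_0_le[OF assms] assms(4) by (cases "\<theta> = 0") (auto simp: Psi_def)
qed simp

text \<open>A supremum of reals says something only for a set bounded above. The bound, uniform in
  the parameter, comes from \<open>r \<le> r powr t\<close> and \<open>0 \<le> h\<close>.\<close>

lemma Psi_pos_le_psi:
  fixes F :: "'a::heine_borel set"
  assumes "0 < r" "r < 1" "bounded F" "F \<noteq> {}" "0 \<le> h" "0 < \<theta>" "\<theta> \<le> 1"
  shows "Psi_pos h F r \<theta> \<le> psi h F r"
proof -
  have bound: "Psi_pos h F r t \<le> h + ln (real (covering_number r F)) / ln (1 / r)"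
    if "0 < t" "t \<le> 1" for t
  proof -
    have "r \<le> r powr t"
      using that assms powr_mono'[of t 1 r] by simp
    then have "covering_number (r powr t) F \<le> covering_number r F"
      using assms by (intro covering_number_mono) auto
    moreover have "0 < covering_number (r powr t) F"
      using assms by (intro covering_number_pos) auto
    ultimately have "ln (real (covering_number (r powr t) F)) \<le> ln (real (covering_number r F))"
      by simp
    moreover have "(1 - t) * h \<le> h"
      using that assms(5) by (simp add: mult_left_le_one_le)
    ultimately show ?thesis
      using assms that by (simp add: Psi_pos_eq divide_right_mono add_mono)
  qed
  have "bdd_above (Psi h F r ` {0..1})"
  proof (rule bdd_aboveI2)
    fix t :: real assume "t \<in> {0..1}"
    then show "Psi h F r t \<le> h + ln (real (covering_number r F)) / ln (1 / r)"
      using Psi_0_le[OF assms(1-3) bound] bound by (cases "t = 0") (auto simp: Psi_def)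
  qed
  then have "Psi h F r \<theta> \<le> psi h F r"
    unfolding psi_def using assms by (intro cSUP_upper) auto
  then show ?thesis
    using assms by (simp add: Psi_def)
qed

section \<open>Equality of lower limits for asymptotically equal functions\<close>

lemma Liminf_ereal_le_of_tendsto_diff:
  fixes f g :: "'a \<Rightarrow> real"
  assumes "((\<lambda>x. f x - g x) \<longlongrightarrow> 0) L" "L \<noteq> bot"
  shows "Liminf L (\<lambda>x. ereal (f x)) \<le> Liminf L (\<lambda>x. ereal (g x))"
proof (rule ereal_le_epsilon2)
  fix e :: real assume "0 < e"
  have "Liminf L (\<lambda>x. ereal (f x)) \<le> Liminf L (\<lambda>x. ereal (g x) + ereal e)"
  proof (rule Liminf_mono)
    show "\<forall>\<^sub>F x in L. ereal (f x) \<le> ereal (g x) + ereal e"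
      using order_tendstoD(2)[OF assms(1) \<open>0 < e\<close>] by eventually_elim simp
  qed
  also have "\<dots> = Liminf L (\<lambda>x. ereal (g x)) + ereal e"
    using assms(2) by (intro Liminf_add_ereal_right) auto
  finally show "Liminf L (\<lambda>x. ereal (f x)) \<le> Liminf L (\<lambda>x. ereal (g x)) + ereal e" .
qed

lemma Liminf_ereal_eq_of_tendsto_diff:
  fixes f g :: "'a \<Rightarrow> real"
  assumes "((\<lambda>x. f x - g x) \<longlongrightarrow> 0) L" "L \<noteq> bot"
  shows "Liminf L (\<lambda>x. ereal (f x)) = Liminf L (\<lambda>x. ereal (g x))"
proof (rule antisym)
  have "((\<lambda>x. g x - f x) \<longlongrightarrow> 0) L"
    using tendsto_minus[OF assms(1)] by simp
  then show "Liminf L (\<lambda>x. ereal (g x)) \<le> Liminf L (\<lambda>x. ereal (f x))"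
    using Liminf_ereal_le_of_tendsto_diff assms(2) by blast
qed (rule Liminf_ereal_le_of_tendsto_diff[OF assms])

lemma hausdorff_measure_mono:
  assumes "E \<subseteq> E'"
  shows "hausdorff_measure s E \<le> hausdorff_measure s E'"
  unfolding hausdorff_measure_def hausdorff_premeasure_def
  using assms by (intro SUP_mono' INF_superset_mono) auto

section \<open>Conformal maps\<close>

text \<open>Phrasing this with \<open>has_derivative\<close> instead of \<open>jacobian\<close>
  makes composition and inversion direct. The factor \<open>a\<close> is unique by
  \<open>conformal_at_spectral_norm\<close>.\<close>

definition conformal_at :: "(real ^ 'n \<Rightarrow> real ^ 'n) \<Rightarrow> real ^ 'n \<Rightarrow> real \<Rightarrow> bool" where
  "conformal_at f x a \<longleftrightarrow>
     0 < a \<and> (\<exists>Q. orthogonal_matrix Q \<and> (f has_derivative (\<lambda>v. a *\<^sub>R (Q *v v))) (at x))"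

lemma conformal_at_pos: "conformal_at f x a \<Longrightarrow> 0 < a"
  unfolding conformal_at_def by simp

lemma conformal_at_id: "conformal_at id x 1"
  unfolding conformal_at_def
  by (intro conjI exI[of _ "mat 1"]) (auto simp: orthogonal_matrix_id id_def intro: has_derivative_ident)

lemma conformal_at_comp:
  assumes "conformal_at f x a" "conformal_at g (f x) b"
  shows "conformal_at (g \<circ> f) x (b * a)"
proof -
  obtain Q where Q: "orthogonal_matrix Q" "(f has_derivative (\<lambda>v. a *\<^sub>R (Q *v v))) (at x)"
    using assms(1) unfolding conformal_at_def by blast
  obtain R where R: "orthogonal_matrix R" "(g has_derivative (\<lambda>v. b *\<^sub>R (R *v v))) (at (f x))"
    using assms(2) unfolding conformal_at_def by blast
  have "((g \<circ> f) has_derivative ((\<lambda>v. b *\<^sub>R (R *v v)) \<circ> (\<lambda>v. a *\<^sub>R (Q *v v)))) (at x)"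
    by (rule diff_chain_at[OF Q(2) R(2)])
  moreover have "(\<lambda>v. b *\<^sub>R (R *v v)) \<circ> (\<lambda>v. a *\<^sub>R (Q *v v)) = (\<lambda>v. (b * a) *\<^sub>R ((R ** Q) *v v))"
    by (auto simp: matrix_vector_mult_scaleR matrix_vector_mul_assoc)
  ultimately show ?thesis
    using assms orthogonal_matrix_mul[OF R(1) Q(1)] unfolding conformal_at_def by auto
qed

lemma norm_orthogonal_matrix_mult:
  assumes "orthogonal_matrix Q"
  shows "norm (Q *v v) = norm (v :: real ^ 'n)"
proof -
  have "orthogonal_transformation (\<lambda>v :: real ^ 'n. Q *v v)"
    using assms by (simp add: orthogonal_transformation_matrix matrix_vector_mul_linear)
  then show ?thesis
    by (rule orthogonal_transformation_norm)
qed

lemma onorm_scaled_orthogonal: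
  fixes Q :: "real ^ 'n ^ 'n"
  assumes "orthogonal_matrix Q" "0 \<le> a"
  shows "onorm (\<lambda>v. a *\<^sub>R (Q *v v)) = a"
proof (rule antisym)
  have n: "norm (a *\<^sub>R (Q *v v)) = a * norm v" for v
    using assms by (simp add: norm_orthogonal_matrix_mult)
  show "onorm (\<lambda>v. a *\<^sub>R (Q *v v)) \<le> a"
    by (rule onorm_le) (simp only: n order_refl)
  have "bounded_linear (\<lambda>v. a *\<^sub>R (Q *v v))"
    by (intro bounded_linear_scaleR_right bounded_linear_compose[OF bounded_linear_scaleR_right] matrix_vector_mul_bounded_linear)
  from onorm[OF this, of "axis undefined 1"]
  show "a \<le> onorm (\<lambda>v. a *\<^sub>R (Q *v v))"
    by (simp only: n norm_axis_1 mult_1_right)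
qed

lemma conformal_at_spectral_norm:
  assumes "conformal_at f x a"
  shows "spectral_norm (jacobian f (at x)) = a"
proof -
  obtain Q where Q: "orthogonal_matrix Q" "(f has_derivative (\<lambda>v. a *\<^sub>R (Q *v v))) (at x)"
    using assms unfolding conformal_at_def by blast
  have "f differentiable (at x)"
    using Q(2) unfolding differentiable_def by blast
  then have "(f has_derivative (\<lambda>h. jacobian f (at x) *v h)) (at x)"
    using jacobian_works by blast
  then have "(\<lambda>h. jacobian f (at x) *v h) = (\<lambda>v. a *\<^sub>R (Q *v v))"
    using Q(2) by (rule has_derivative_unique)
  then show ?thesis
    unfolding spectral_norm_def using onorm_scaled_orthogonal[OF Q(1)] conformal_at_pos[OF assms] by simp
qed

lemma conformal_on_conformal_at:
  assumes "conformal_on f V" "x \<in> V"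
  obtains a where "conformal_at f x a"
proof -
  obtain a Q where aQ: "f differentiable (at x)" "0 < a" "orthogonal_matrix Q" "jacobian f (at x) = a *\<^sub>R Q"
    using assms unfolding conformal_on_def by blast
  then have "(f has_derivative (\<lambda>h. (a *\<^sub>R Q) *v h)) (at x)"
    using jacobian_works by metis
  moreover have "(\<lambda>h. (a *\<^sub>R Q) *v h) = (\<lambda>h. a *\<^sub>R (Q *v h))"
    by (simp add: scaleR_matrix_vector_assoc)
  ultimately show ?thesis
    using that aQ unfolding conformal_at_def by auto
qed

lemma conformal_dist_le:
  assumes "convex B" "\<And>z. z \<in> B \<Longrightarrow> \<exists>a\<le>A. conformal_at f z a" "x \<in> B" "y \<in> B"
  shows "dist (f x) (f y) \<le> A * dist x y"
proof -
  have "\<exists>f'. z \<in> B \<longrightarrow> (f has_derivative f') (at z within B) \<and> onorm f' \<le> A" for z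
  proof (cases "z \<in> B")
    case True
    then obtain a Q where "a \<le> A" "0 < a" "orthogonal_matrix Q" "(f has_derivative (\<lambda>v. a *\<^sub>R (Q *v v))) (at z)"
      using assms(2) unfolding conformal_at_def by blast
    then show ?thesis
      using onorm_scaled_orthogonal[of Q a]
      by (intro exI[of _ "\<lambda>v. a *\<^sub>R (Q *v v)"]) (auto intro: has_derivative_at_withinI)
  qed simp
  then obtain f' where f': "\<And>z. z \<in> B \<Longrightarrow> (f has_derivative f' z) (at z within B)" "\<And>z. z \<in> B \<Longrightarrow> onorm (f' z) \<le> A"
    by metis
  show ?thesis
    using differentiable_bound[OF assms(1) f' assms(3,4)] by (simp add: dist_norm)
qed

text \<open>A conformal derivative stretches all directions by the same factor, so one short vector
  \<open>v\<close> in an arbitrary direction determines \<open>a\<close>. This turns contraction of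
  a word map near a point into a bound for its conformal factor there.\<close>

lemma conformal_factor_le:
  assumes f: "conformal_at f x a" and e: "0 < e"
    and lip: "\<And>y. y \<in> ball x e \<Longrightarrow> dist (f y) (f x) \<le> C * dist y x"
  shows "a \<le> C"
proof (rule field_le_epsilon)
  fix \<epsilon> :: real assume \<epsilon>: "0 < \<epsilon>"
  obtain Q where Q: "orthogonal_matrix Q" "(f has_derivative (\<lambda>v. a *\<^sub>R (Q *v v))) (at x)"
    using f unfolding conformal_at_def by blast
  then obtain d where d: "0 < d"
    "\<And>y. norm (y - x) < d \<Longrightarrow> norm (f y - f x - a *\<^sub>R (Q *v (y - x))) \<le> \<epsilon> * norm (y - x)"
    using \<epsilon> unfolding has_derivative_at_alt by blast
  define s where "s = min d e / 2"
  have s: "0 < s" "s < d" "s < e"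
    using d e by (auto simp: s_def min_def)
  define v where "v = s *\<^sub>R axis (undefined :: 'a) (1::real)"
  have nv: "norm v = s"
    using s by (simp add: v_def norm_axis_1)
  have "norm (f (x + v) - f x - a *\<^sub>R (Q *v v)) \<le> \<epsilon> * s"
    using d(2)[of "x + v"] nv s by simp
  moreover have "norm (f (x + v) - f x) \<le> C * s"
    using lip[of "x + v"] nv s by (simp add: dist_norm)
  moreover have "norm (a *\<^sub>R (Q *v v)) = a * s"
    using nv conformal_at_pos[OF f] norm_orthogonal_matrix_mult[OF Q(1)] by simp
  ultimately have "a * s \<le> (C + \<epsilon>) * s"
    using norm_triangle_sub[of "a *\<^sub>R (Q *v v)" "f (x + v) - f x"]
    by (simp add: norm_minus_commute algebra_simps)
  then show "a \<le> C + \<epsilon>"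
    using s by simp
qed

lemma conformal_at_isCont: "conformal_at f x a \<Longrightarrow> isCont f x"
  unfolding conformal_at_def by (auto intro: has_derivative_continuous)

section \<open>Inner radius and volume of conformal images\<close>

lemma conformal_at_inverse:
  assumes "conformal_at f x a" "open B" "x \<in> B" "continuous_on B f" "\<And>z. z \<in> B \<Longrightarrow> g (f z) = z"
  shows "conformal_at g (f x) (1 / a)"
proof -
  obtain Q where Q: "orthogonal_matrix Q" "(f has_derivative (\<lambda>v. a *\<^sub>R (Q *v v))) (at x)"
    using assms(1) unfolding conformal_at_def by blast
  have a: "0 < a"
    using conformal_at_pos assms(1) .
  have "Q ** transpose Q = mat 1"
    using Q(1) by (simp add: orthogonal_matrix_def)
  then have "(\<lambda>v. a *\<^sub>R (Q *v v)) \<circ> (\<lambda>v. (1 / a) *\<^sub>R (transpose Q *v v)) = id"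
    using a by (auto simp: matrix_vector_mult_scaleR matrix_vector_mul_assoc simp del: transpose_matrix_vector)
  then have "(g has_derivative (\<lambda>v. (1 / a) *\<^sub>R (transpose Q *v v))) (at (f x))"
    by (intro has_derivative_inverse_strong[OF assms(2-5) Q(2)]) auto
  then show ?thesis
    unfolding conformal_at_def using a Q(1) by (intro conjI exI[of _ "transpose Q"]) (auto simp del: transpose_matrix_vector)
qed

text \<open>Let \<open>p\<close> be a point outside the image that is nearest to \<open>f x\<close>,
  at distance \<open>s\<close>. On the convex ball of radius \<open>s\<close> around
  \<open>f x\<close> the inverse \<open>g\<close> is defined and has Lipschitz constant
  \<open>1 / m\<close>. If \<open>s < m * r\<close>, it maps this ball into the compact
  \<open>cball x (s / m)\<close> inside the domain, so the closure of the ball, and with it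
  \<open>p\<close>, would still lie in the image.\<close>

lemma ball_subset_conformal_image:
  fixes f :: "real ^ 'n \<Rightarrow> real ^ 'n"
  assumes r: "0 < r" and m: "0 < m" and inj: "inj_on f (ball x r)"
    and conf: "\<And>y. y \<in> ball x r \<Longrightarrow> \<exists>a\<ge>m. conformal_at f y a"
  shows "ball (f x) (m * r) \<subseteq> f ` ball x r"
proof -
  define G where "G = f ` ball x r"
  have cont: "continuous_on (ball x r) f"
    using conf conformal_at_isCont by (intro continuous_at_imp_continuous_on) blast
  have "open G"
    unfolding G_def using cont inj by (intro invariance_of_domain) auto
  define g where "g = the_inv_into (ball x r) f"
  have gf: "g (f z) = z" if "z \<in> ball x r" for z
    unfolding g_def using the_inv_into_f_f inj that by metis
  have conf_g: "\<exists>b\<le>1 / m. conformal_at g u b" if u: "u \<in> G" for u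
  proof -
    obtain z where z: "z \<in> ball x r" "u = f z"
      using u unfolding G_def by blast
    obtain a where a: "m \<le> a" "conformal_at f z a"
      using conf[OF z(1)] by blast
    have "conformal_at g (f z) (1 / a)"
      by (rule conformal_at_inverse[OF a(2) open_ball z(1) cont gf])
    then show ?thesis
      unfolding z(2) using a(1) m by (intro exI[of _ "1 / a"]) (simp add: frac_le)
  qed
  show ?thesis
  proof (cases "- G = {}")
    case True
    then have "G = UNIV"
      by blast
    then show ?thesis
      unfolding G_def by simp
  next
    case False
    have "closed (- G)"
      using \<open>open G\<close> by (simp add: closed_Compl)
    from infdist_attains_inf[OF this False, of "f x"]
    obtain p where p: "p \<in> - G" "infdist (f x) (- G) = dist (f x) p" .
    define s where "s = dist (f x) p"
    have fxG: "f x \<in> G"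
      unfolding G_def using r by auto
    then have s0: "0 < s"
      using p(1) unfolding s_def by auto
    have s_sub: "ball (f x) s \<subseteq> G"
    proof
      fix u assume "u \<in> ball (f x) s"
      then have lt: "dist (f x) u < infdist (f x) (- G)"
        using p(2) by (simp add: s_def)
      show "u \<in> G"
      proof (rule ccontr)
        assume "u \<notin> G"
        then have "infdist (f x) (- G) \<le> dist (f x) u"
          by (intro infdist_le) simp
        with lt show False
          by simp
      qed
    qed
    have "m * r \<le> s"
    proof (rule ccontr)
      assume "\<not> m * r \<le> s"
      then have "s / m < r"
        using m by (simp add: field_simps)
      have sub: "ball (f x) s \<subseteq> f ` cball x (s / m)"
      proof
        fix u assume u: "u \<in> ball (f x) s"
        have "dist (g (f x)) (g u) \<le> 1 / m * dist (f x) u"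
        proof (rule conformal_dist_le[of "ball (f x) s"])
          show "\<exists>b\<le>1 / m. conformal_at g z b" if "z \<in> ball (f x) s" for z
            using conf_g s_sub that by blast
        qed (use s0 u in auto)
        also have "\<dots> \<le> 1 / m * s"
          using u m by (intro mult_left_mono) auto
        finally have "g u \<in> cball x (s / m)"
          using gf[of x] r by simp
        moreover obtain z where "z \<in> ball x r" "u = f z"
          using u s_sub unfolding G_def by blast
        then have "u = f (g u)"
          using gf by simp
        ultimately show "u \<in> f ` cball x (s / m)"
          by blast
      qed
      have cb: "cball x (s / m) \<subseteq> ball x r"
        using \<open>s / m < r\<close> by auto
      then have "compact (f ` cball x (s / m))"
        using cont by (intro compact_continuous_image) (auto intro: continuous_on_subset)
      then have "closure (ball (f x) s) \<subseteq> f ` cball x (s / m)"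
        using sub by (intro closure_minimal) (auto intro: compact_imp_closed)
      then have "cball (f x) s \<subseteq> f ` cball x (s / m)"
        using s0 by simp
      then have "p \<in> f ` cball x (s / m)"
        unfolding s_def by auto
      then have "p \<in> G"
        using cb unfolding G_def by blast
      with p(1) show False
        by simp
    qed
    then have "ball (f x) (m * r) \<subseteq> ball (f x) s"
      by (rule subset_ball)
    with s_sub show ?thesis
      unfolding G_def by (rule order_trans[rotated])
  qed
qed

text \<open>
  The change of variables formula of the library is restricted to well-ordered index types, so the
  volume bound is obtained by filling \<open>G\<close> with balls by Vitali's theorem.
\<close>

lemma conformal_image_measure_ge:
  fixes f :: "real ^ 'n \<Rightarrow> real ^ 'n"
  assumes G: "open G" "bounded G" and bdd: "bounded (f ` G)" and m: "0 < m" and inj: "inj_on f G"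
    and conf: "\<And>y. y \<in> G \<Longrightarrow> \<exists>a\<ge>m. conformal_at f y a"
  shows "f ` G \<in> lmeasurable" "m ^ CARD('n) * measure lebesgue G \<le> measure lebesgue (f ` G)"
proof -
  have cont: "continuous_on G f"
    using conf conformal_at_isCont by (intro continuous_at_imp_continuous_on) blast
  have "open (f ` G)"
    using cont inj G(1) by (intro invariance_of_domain)
  then show fG: "f ` G \<in> lmeasurable"
    using bdd by (intro lmeasurable_open)
  define KK where "KK = {(a, r) | a r. 0 < r \<and> ball a r \<subseteq> G}"
  have cov: "\<exists>i. i \<in> KK \<and> x \<in> ball (fst i) (snd i) \<and> snd i < d" if "x \<in> G" "0 < d" for x d
  proof -
    obtain e where e: "0 < e" "ball x e \<subseteq> G"
      using G(1) \<open>x \<in> G\<close> by (meson openE)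
    define r where "r = min e d / 2"
    have r: "0 < r" "r \<le> e" "r < d"
      using e(1) that(2) by (auto simp: r_def min_def)
    have "ball x r \<subseteq> G"
      using e(2) subset_ball[OF r(2), of x] by (rule order_trans[rotated])
    then show ?thesis
      using r by (intro exI[of _ "(x, r)"]) (auto simp: KK_def)
  qed
  obtain C where C: "countable C" "C \<subseteq> KK"
     "pairwise (\<lambda>i j. disjnt (ball (fst i) (snd i)) (ball (fst j) (snd j))) C"
     "negligible (G - (\<Union>i \<in> C. ball (fst i) (snd i)))"
    by (rule Vitali_covering_theorem_balls[of G KK fst snd]) (use cov in blast)
  have CK: "0 < snd i" "ball (fst i) (snd i) \<subseteq> G" if "i \<in> C" for i
    using subsetD[OF C(2) that] unfolding KK_def by force+
  define b where "b i = ball (fst i) (snd i)" for i :: "(real ^ 'n) \<times> real"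
  have "measure lebesgue (\<Union>i\<in>C. b i) \<le> measure lebesgue (f ` G) / m ^ CARD('n)"
  proof (rule measure_UN_bound[OF C(1)])
    show "b i \<in> lmeasurable" for i
      by (simp add: b_def)
    fix C' assume C': "C' \<subseteq> C" "finite C'"
    have sub: "ball (f (fst i)) (m * snd i) \<subseteq> f ` b i" if "i \<in> C" for i
      unfolding b_def
    proof (rule ball_subset_conformal_image)
      show "inj_on f (ball (fst i) (snd i))"
        using inj CK(2)[OF that] by (rule inj_on_subset)
      show "\<exists>a\<ge>m. conformal_at f y a" if "y \<in> ball (fst i) (snd i)" for y
        using conf CK(2)[OF \<open>i \<in> C\<close>] that by blast
    qed (use m CK that in auto)
    have disj: "disjnt (b i) (b j)" if "i \<in> C'" "j \<in> C'" "i \<noteq> j" for i j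
      using C(3) C'(1) that unfolding pairwise_def b_def by blast
    \<comment> \<open>The shrunken balls lie in the images of the balls of the filling, and these
      images are disjoint by injectivity on \<open>G\<close>.\<close>
    have disj': "disjnt (ball (f (fst i)) (m * snd i)) (ball (f (fst j)) (m * snd j))"
      if ij: "i \<in> C'" "j \<in> C'" "i \<noteq> j" for i j
    proof -
      have "i \<in> C" "j \<in> C"
        using C'(1) ij by auto
      then have "b i \<subseteq> G" "b j \<subseteq> G"
        using CK(2) unfolding b_def by blast+
      then have "f ` b i \<inter> f ` b j = {}"
        using disj[OF ij] inj_on_image_Int[OF inj, of "b i" "b j"] unfolding disjnt_def by simp
      then show ?thesis
        using sub[OF \<open>i \<in> C\<close>] sub[OF \<open>j \<in> C\<close>] unfolding disjnt_def by blast
    qed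
    have vol: "measure lebesgue (ball (f (fst i)) (m * snd i)) = m ^ CARD('n) * measure lebesgue (b i)" if "i \<in> C'" for i
    proof -
      have "0 < snd i"
        using CK(1) C'(1) that by blast
      then show ?thesis
        using m by (simp add: content_ball b_def power_mult_distrib)
    qed
    have "m ^ CARD('n) * measure lebesgue (\<Union>i\<in>C'. b i) = m ^ CARD('n) * (\<Sum>i\<in>C'. measure lebesgue (b i))"
      using C'(2) disj by (subst measure_UNION') (auto simp: pairwise_def b_def)
    also have "\<dots> = (\<Sum>i\<in>C'. measure lebesgue (ball (f (fst i)) (m * snd i)))"
      using vol by (simp add: sum_distrib_left)
    also have "\<dots> = measure lebesgue (\<Union>i\<in>C'. ball (f (fst i)) (m * snd i))"
      using C'(2) disj' by (subst measure_UNION') (auto simp: pairwise_def)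
    also have "\<dots> \<le> measure lebesgue (f ` G)"
    proof (rule measure_mono_fmeasurable)
      show "(\<Union>i\<in>C'. ball (f (fst i)) (m * snd i)) \<subseteq> f ` G"
        using sub C'(1) CK(2) unfolding b_def by blast
    qed (use fG C'(2) in \<open>auto intro!: sets.finite_UN\<close>)
    finally show "measure lebesgue (\<Union>i\<in>C'. b i) \<le> measure lebesgue (f ` G) / m ^ CARD('n)"
      using m by (simp add: field_simps)
  qed
  moreover have "measure lebesgue (\<Union>i\<in>C. b i) = measure lebesgue G"
  proof (rule measure_negligible_symdiff)
    show "G \<in> lmeasurable"
      using G(2,1) by (rule lmeasurable_open)
    have "(\<Union>i\<in>C. b i) - G = {}"
      using CK(2) unfolding b_def by blast
    then show "negligible ((G - (\<Union>i\<in>C. b i)) \<union> ((\<Union>i\<in>C. b i) - G))"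
      using C(4) unfolding b_def by simp
  qed
  ultimately show "m ^ CARD('n) * measure lebesgue G \<le> measure lebesgue (f ` G)"
    using m by (simp add: field_simps)
qed

text \<open>
  Being within bounded distance, uniformly over all admissible maps, is an equivalence relation on
  \<open>V\<close> with open classes; this makes up for \<open>X\<close> not being convex.
\<close>

lemma conformal_lipschitz_on_compact:
  fixes V X :: "(real ^ 'n) set"
  assumes V: "open V" "connected V" and X: "compact X" "X \<subseteq> V"
  obtains L where "0 < L"
    "\<And>f A x y. \<lbrakk>\<And>z. z \<in> V \<Longrightarrow> \<exists>a\<le>A. conformal_at f z a; x \<in> X; y \<in> X\<rbrakk> \<Longrightarrow> dist (f x) (f y) \<le> L * A * dist x y"
proof -
  \<comment> \<open>Admissible maps are quantified inside the relation \<open>R\<close>, so that its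
    constant \<open>M\<close> serves all \<open>f\<close> and \<open>A\<close> at once.\<close>
  define P where "P f A \<longleftrightarrow> (\<forall>z\<in>V. \<exists>a\<le>A. conformal_at f z a)" for f :: "real ^ 'n \<Rightarrow> real ^ 'n" and A
  define R where "R x y \<longleftrightarrow> (\<exists>M\<ge>0. \<forall>f A. P f A \<longrightarrow> dist (f x) (f y) \<le> M * A)" for x y
  have local: "dist (f x) (f y) \<le> A * dist x y" if "ball x e \<subseteq> V" "y \<in> ball x e" "P f A" for f A x y e
  proof (rule conformal_dist_le[of "ball x e"])
    show "\<exists>a\<le>A. conformal_at f z a" if "z \<in> ball x e" for z
      using \<open>P f A\<close> \<open>ball x e \<subseteq> V\<close> that unfolding P_def by blast
    show "x \<in> ball x e"
      using \<open>y \<in> ball x e\<close> zero_le_dist[of x y] by (simp del: zero_le_dist)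
  qed (use that in auto)
  have A_pos: "0 < A" if "P f A" "x \<in> V" for f A x
    using that conformal_at_pos unfolding P_def by force
  have R_all: "R x y" if "x \<in> V" "y \<in> V" for x y
  proof (rule connected_equivalence_relation[OF V(2) that])
    show "R u v" if "R v u" for u v
      using that unfolding R_def by (simp add: dist_commute)
    show "R u w" if "R u v" "R v w" for u v w
    proof -
      obtain M where M: "0 \<le> M" "\<And>f A. P f A \<Longrightarrow> dist (f u) (f v) \<le> M * A"
        using \<open>R u v\<close> unfolding R_def by blast
      obtain M' where M': "0 \<le> M'" "\<And>f A. P f A \<Longrightarrow> dist (f v) (f w) \<le> M' * A"
        using \<open>R v w\<close> unfolding R_def by blast
      have "dist (f u) (f w) \<le> (M + M') * A" if "P f A" for f A
        using M(2)[OF that] M'(2)[OF that] dist_triangle[of "f u" "f w" "f v"] by (simp add: distrib_right)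
      then show ?thesis
        unfolding R_def using M(1) M'(1) by (intro exI[of _ "M + M'"]) simp
    qed
    show "\<exists>T. openin (top_of_set V) T \<and> u \<in> T \<and> (\<forall>v\<in>T. R u v)" if "u \<in> V" for u
    proof -
      obtain e where e: "0 < e" "ball u e \<subseteq> V"
        using V(1) \<open>u \<in> V\<close> by (meson openE)
      have "R u v" if "v \<in> ball u e" for v
        unfolding R_def
      proof (intro exI[of _ e] conjI allI impI)
        fix f A assume PA: "P f A"
        have "dist (f u) (f v) \<le> A * dist u v"
          by (rule local[OF e(2) that PA])
        also have "\<dots> \<le> A * e"
          using that A_pos[OF PA \<open>u \<in> V\<close>] by (intro mult_left_mono) auto
        finally show "dist (f u) (f v) \<le> e * A"
          by (simp add: mult.commute)
      qed (use e in simp)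
      moreover have "openin (top_of_set V) (ball u e)"
        using e(2) by (simp add: open_subset)
      ultimately show ?thesis
        using e(1) by (intro exI[of _ "ball u e"]) simp
    qed
  qed
  show ?thesis
  proof (cases "X = {}")
    case True
    then show ?thesis
      using that[of 1] by simp
  next
    case False
    obtain \<delta> where \<delta>: "0 < \<delta>" "{x. infdist x X \<le> \<delta>} \<subseteq> V"
      using compact_in_open_separated[OF False X(1) V(1) X(2)] .
    have ball_V: "ball x \<delta> \<subseteq> V" if "x \<in> X" for x
    proof
      fix y assume "y \<in> ball x \<delta>"
      then have "infdist y X \<le> \<delta>"
        using infdist_le[OF that, of y] by (simp add: dist_commute)
      then show "y \<in> V"
        using \<delta>(2) by blast
    qed
    have "X \<subseteq> (\<Union>a\<in>X. ball a \<delta>)"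
      using \<delta>(1) by auto
    then obtain N where N: "N \<subseteq> X" "finite N" "X \<subseteq> (\<Union>a\<in>N. ball a \<delta>)"
      using compactE_image[OF X(1), of X "\<lambda>a. ball a \<delta>"] by (metis open_ball)
    have "\<exists>M. a \<in> N \<longrightarrow> b \<in> N \<longrightarrow> 0 \<le> M \<and> (\<forall>f A. P f A \<longrightarrow> dist (f a) (f b) \<le> M * A)" for a b
    proof (cases "a \<in> N \<and> b \<in> N")
      case True
      then have "R a b"
        using R_all N(1) X(2) by blast
      then show ?thesis
        unfolding R_def by blast
    qed blast
    then obtain M where M: "\<And>a b. \<lbrakk>a \<in> N; b \<in> N\<rbrakk> \<Longrightarrow> 0 \<le> M a b"
      "\<And>a b f A. \<lbrakk>a \<in> N; b \<in> N; P f A\<rbrakk> \<Longrightarrow> dist (f a) (f b) \<le> M a b * A"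
      by metis
    define M0 where "M0 = (\<Sum>(a, b)\<in>N \<times> N. M a b)"
    have M0: "M a b \<le> M0" if "a \<in> N" "b \<in> N" for a b
      unfolding M0_def using M(1) N(2) that member_le_sum[of "(a, b)" "N \<times> N" "\<lambda>(a, b). M a b"] by auto
    have M0_nonneg: "0 \<le> M0"
      unfolding M0_def using M(1) by (intro sum_nonneg) auto
    \<comment> \<open>The summand 1 serves points closer than \<open>\<delta>\<close>, which lie in
      a common ball inside \<open>V\<close>. The quotient serves the others: the route through net
      points costs at most \<open>(M0 + 2 * \<delta>) * A\<close>, and their distance is at least
      \<open>\<delta>\<close>.\<close>
    define L where "L = 1 + (M0 + 2 * \<delta>) / \<delta>"
    have L: "0 < L" "1 \<le> L"
      using M0_nonneg \<delta>(1) by (auto simp: L_def add_pos_nonneg)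
    have "dist (f x) (f y) \<le> L * A * dist x y"
      if PA: "\<And>z. z \<in> V \<Longrightarrow> \<exists>a\<le>A. conformal_at f z a" and xy: "x \<in> X" "y \<in> X" for f A x y
    proof -
      have P: "P f A"
        unfolding P_def using PA by blast
      have A: "0 < A"
        using A_pos[OF P] xy X(2) by blast
      show ?thesis
      proof (cases "dist x y < \<delta>")
        case True
        have "dist (f x) (f y) \<le> A * dist x y"
          using local[OF ball_V[OF xy(1)] _ P, of y] True by simp
        also have "\<dots> \<le> L * A * dist x y"
          using L(2) A by (intro mult_right_mono) auto
        finally show ?thesis .
      next
        case False
        obtain a where a: "a \<in> N" "dist a x < \<delta>"
          using N(3) xy(1) by auto
        obtain b where b: "b \<in> N" "dist b y < \<delta>"
          using N(3) xy(2) by auto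
        have "a \<in> X" "b \<in> X"
          using a b N(1) by auto
        then have "dist (f a) (f x) \<le> A * dist a x" "dist (f b) (f y) \<le> A * dist b y"
          using local[OF ball_V _ P] a b by auto
        moreover have "A * dist a x \<le> A * \<delta>" "A * dist b y \<le> A * \<delta>"
          using A a b by auto
        moreover have "dist (f a) (f b) \<le> M0 * A"
          using M(2)[OF a(1) b(1) P] mult_right_mono[OF M0[OF a(1) b(1)] less_imp_le[OF A]] by (rule order_trans)
        ultimately have "dist (f x) (f y) \<le> (M0 + 2 * \<delta>) * A"
          using dist_triangle[of "f x" "f y" "f a"] dist_triangle[of "f a" "f y" "f b"]
          by (simp add: dist_commute algebra_simps)
        also have "\<dots> = (M0 + 2 * \<delta>) / \<delta> * A * \<delta>"
          using \<delta>(1) by simp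
        also have "\<dots> \<le> L * A * dist x y"
          using False A M0_nonneg \<delta>(1) by (intro mult_mono) (auto simp: L_def)
        finally show ?thesis .
      qed
    qed
    then show ?thesis
      by (rule that[OF L(1)])
  qed
qed

section \<open>Systems with bounded distortion\<close>

lemma word_map_Nil [simp]: "word_map S [] = id"
  by (simp add: word_map_def)

lemma word_map_Cons [simp]: "word_map S (i # w) = S i \<circ> word_map S w"
  by (simp add: word_map_def)

lemma word_map_append: "word_map S (v @ w) = word_map S v \<circ> word_map S w"
  by (induction v) (simp_all add: o_assoc)

lemma word_map_concat: "word_map (word_map S) ws = word_map S (concat ws)"
  by (induction ws) (simp_all add: word_map_append)

section \<open>Infinite words avoiding light families of finite words\<close>

text \<open>This does the work of a Bernoulli measure: \<open>q w\<close> is the probability of the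
  cylinder of \<open>w\<close>, and by the union bound the forbidden cylinders cannot exhaust the
  space. The word is built letter by letter with the invariant \<open>mass u < q u\<close>. If every
  child violated it, summing over the children would give \<open>q u \<le> mass u\<close>.\<close>

lemma exists_sequence_avoiding:
  fixes p :: "'i \<Rightarrow> real" and A :: "nat \<Rightarrow> 'i list set"
  defines "q \<equiv> \<lambda>w. prod_list (map p w)"
  assumes I: "finite I" "\<And>i. i \<in> I \<Longrightarrow> 0 \<le> p i" "sum p I = 1"
    and A: "\<And>k. finite (A k)" "\<And>k. A k \<subseteq> lists I"
    and less: "(\<Sum>k. ennreal (sum q (A k))) < 1"
  shows "\<exists>\<gamma>. range \<gamma> \<subseteq> I \<and> (\<forall>k n. map \<gamma> [0..<n] \<notin> A k)"
proof -
  \<comment> \<open>Total weight of the forbidden words extending \<open>u\<close>, with repetition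
    over \<open>k\<close>. A forbidden \<open>u\<close> counts itself, so then
    \<open>q u \<le> mass u\<close>.\<close>
  define mass where "mass u = (\<Sum>k. ennreal (sum q {w \<in> A k. prefix u w}))" for u
  have q_nonneg: "0 \<le> q w" if "w \<in> lists I" for w
    unfolding q_def using that by (induction w) (auto simp: I(2))
  have Aq: "0 \<le> q w" if "w \<in> A k" for w k
    using q_nonneg A(2) that by blast
  have below: "u \<notin> A k" if "u \<in> lists I" "mass u < ennreal (q u)" for u k
  proof
    assume "u \<in> A k"
    then have "q u \<le> sum q {w \<in> A k. prefix u w}"
      using A(1) Aq by (intro member_le_sum) auto
    then have "ennreal (q u) \<le> ennreal (sum q {w \<in> A k. prefix u w})"
      by (rule ennreal_leI)
    also have "\<dots> \<le> mass u"
      unfolding mass_def using sum_le_suminf[of "\<lambda>k. ennreal (sum q {w \<in> A k. prefix u w})" "{k}"]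
      by simp
    finally show False
      using that by simp
  qed
  have step: "\<exists>i\<in>I. mass (u @ [i]) < ennreal (q (u @ [i]))"
    if u: "u \<in> lists I" "mass u < ennreal (q u)" for u
  proof (rule ccontr)
    assume "\<not> ?thesis"
    then have ge: "ennreal (q (u @ [i])) \<le> mass (u @ [i])" if "i \<in> I" for i
      using that by (simp add: not_less)
    have q_child: "0 \<le> q (u @ [i])" if "i \<in> I" for i
      using u that by (intro q_nonneg) auto
    have "q u = (\<Sum>i\<in>I. q (u @ [i]))"
      using I(3) by (simp add: q_def flip: sum_distrib_left)
    then have "ennreal (q u) = (\<Sum>i\<in>I. ennreal (q (u @ [i])))"
      using q_child by simp
    also have "\<dots> \<le> (\<Sum>i\<in>I. mass (u @ [i]))"
      using ge by (rule sum_mono)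
    also have "\<dots> = (\<Sum>k. \<Sum>i\<in>I. ennreal (sum q {w \<in> A k. prefix (u @ [i]) w}))"
      unfolding mass_def by (subst suminf_sum) auto
    also have "\<dots> \<le> mass u"
      unfolding mass_def
    proof (rule suminf_le)
      fix k
      have "(\<Sum>i\<in>I. ennreal (sum q {w \<in> A k. prefix (u @ [i]) w})) =
            ennreal (\<Sum>i\<in>I. sum q {w \<in> A k. prefix (u @ [i]) w})"
        using A(1) Aq by (intro sum_ennreal sum_nonneg) auto
      also have "(\<Sum>i\<in>I. sum q {w \<in> A k. prefix (u @ [i]) w}) =
            sum q (\<Union>i\<in>I. {w \<in> A k. prefix (u @ [i]) w})"
        using A I by (subst sum.UNION_disjoint) (auto simp: prefix_def)
      also have "ennreal \<dots> \<le> ennreal (sum q {w \<in> A k. prefix u w})"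
        using A(1) Aq by (intro ennreal_leI sum_mono2) (auto dest: append_prefixD)
      finally show "(\<Sum>i\<in>I. ennreal (sum q {w \<in> A k. prefix (u @ [i]) w}))
          \<le> ennreal (sum q {w \<in> A k. prefix u w})" .
    qed auto
    finally show False
      using u by simp
  qed
  define f where "f u = (SOME i. i \<in> I \<and> mass (u @ [i]) < ennreal (q (u @ [i])))" for u
  define us where "us = rec_nat [] (\<lambda>_ u. u @ [f u])"
  define \<gamma> where "\<gamma> n = f (us n)" for n
  have us: "us 0 = []" "us (Suc n) = us n @ [\<gamma> n]" for n
    by (simp_all add: us_def \<gamma>_def)
  have us_map: "us n = map \<gamma> [0..<n]" for n
    by (induction n) (simp_all add: us)
  have f: "f u \<in> I \<and> mass (u @ [f u]) < ennreal (q (u @ [f u]))"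
    if "u \<in> lists I" "mass u < ennreal (q u)" for u
    unfolding f_def by (rule someI_ex) (use step[OF that] in blast)
  have "us n \<in> lists I \<and> mass (us n) < ennreal (q (us n))" for n
  proof (induction n)
    case 0
    then show ?case
      using less by (simp add: us mass_def q_def)
  next
    case (Suc n)
    then show ?case
      using f[of "us n"] by (simp add: us \<gamma>_def)
  qed
  then have inv: "us n \<in> lists I" "mass (us n) < ennreal (q (us n))" for n
    by auto
  have "range \<gamma> \<subseteq> I"
    using f inv by (auto simp: \<gamma>_def)
  moreover have "\<forall>k n. map \<gamma> [0..<n] \<notin> A k"
    using below inv by (simp flip: us_map)
  ultimately show ?thesis
    by blast
qed

section \<open>Axioms for systems of words\<close>

text \<open>\<open>U\<close> plays the part of the interior of \<open>X\<close>. The last three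
  axioms speak of words instead of letters, so they pass to alphabets made of words with no loss in
  the constants. \<open>word_measure\<close> asks for a measurable subset \<open>E\<close> of the
  image, which leaves aside measurability of the image itself.\<close>

locale conformal_system =
  fixes I :: "'i set" and S :: "'i \<Rightarrow> 'a::euclidean_space \<Rightarrow> 'a" and X U :: "'a set"
    and size :: "'i list \<Rightarrow> real" and K L c \<kappa> :: real
  assumes I_nonempty: "I \<noteq> {}" and countable_I: "countable I"
    and compact_X: "compact X" and U_subset: "U \<subseteq> X" and U_nonempty: "U \<noteq> {}"
    and S_X: "\<And>i. i \<in> I \<Longrightarrow> S i ` X \<subseteq> X"
    and S_U: "\<And>i. i \<in> I \<Longrightarrow> S i ` U \<subseteq> U"
    and S_inj: "\<And>i. i \<in> I \<Longrightarrow> inj_on (S i) X"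
    and S_disjoint: "\<And>i j. \<lbrakk>i \<in> I; j \<in> I; i \<noteq> j\<rbrakk> \<Longrightarrow> S i ` U \<inter> S j ` U = {}"
    and S_contraction: "\<And>i x y. \<lbrakk>i \<in> I; x \<in> X; y \<in> X\<rbrakk> \<Longrightarrow> dist (S i x) (S i y) \<le> c * dist x y"
    and c: "0 < c" "c < 1" and K: "1 \<le> K" and L: "0 < L" and \<kappa>: "0 < \<kappa>"
    and size_pos: "\<And>w. w \<in> lists I \<Longrightarrow> 0 < size w"
    and size_Nil: "size [] = 1"
    and size_le: "\<And>w. w \<in> lists I \<Longrightarrow> size w \<le> c ^ length w"
    and size_append: "\<And>v w. \<lbrakk>v \<in> lists I; w \<in> lists I\<rbrakk> \<Longrightarrow> size v * size w \<le> K * size (v @ w)"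
    and word_lipschitz: "\<And>w x y. \<lbrakk>w \<in> lists I; x \<in> X; y \<in> X\<rbrakk> \<Longrightarrow>
      dist (word_map S w x) (word_map S w y) \<le> L * size w * dist x y"
    and word_measure: "\<And>w y \<rho>. \<lbrakk>w \<in> lists I; y \<in> X; 0 < \<rho>; \<rho> < 1\<rbrakk> \<Longrightarrow>
      \<exists>E\<in>lmeasurable. E \<subseteq> word_map S w ` (ball y \<rho> \<inter> U) \<and>
        \<kappa> * (size w * \<rho>) ^ DIM('a) \<le> measure lebesgue E"
begin

lemma X_nonempty: "X \<noteq> {}"
  using U_nonempty U_subset by blast

lemma word_X: "w \<in> lists I \<Longrightarrow> word_map S w ` X \<subseteq> X"
  by (induction w) (use S_X in \<open>auto simp: image_comp [symmetric]\<close>)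

lemma word_U: "w \<in> lists I \<Longrightarrow> word_map S w ` U \<subseteq> U"
  by (induction w) (use S_U in \<open>auto simp: image_comp [symmetric]\<close>)

lemma word_inj: "w \<in> lists I \<Longrightarrow> inj_on (word_map S w) X"
proof (induction w)
  case (Cons i w)
  then have "inj_on (S i) (word_map S w ` X)"
    using S_inj word_X[of w] by (auto intro: inj_on_subset)
  with Cons show ?case
    unfolding word_map_Cons by (intro comp_inj_on) auto
qed simp

lemma size_le_1: "w \<in> lists I \<Longrightarrow> size w \<le> 1"
  using size_le[of w] c power_le_one[of c "length w"] by simp

text \<open>Incomparable words part at some first letter. \<open>S_disjoint\<close> applies there,
  and injectivity carries the disjointness through the common prefix.\<close>

lemma word_disjoint:
  assumes "v \<in> lists I" "w \<in> lists I" "\<not> prefix v w" "\<not> prefix w v"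
  shows "word_map S v ` U \<inter> word_map S w ` U = {}"
  using assms
proof (induction v arbitrary: w rule: list.induct)
  case (Cons i v)
  then obtain j w' where w: "w = j # w'"
    by (cases w) auto
  have ij: "i \<in> I" "j \<in> I" "v \<in> lists I" "w' \<in> lists I"
    using Cons.prems w by auto
  have img: "word_map S v ` U \<subseteq> U" "word_map S w' ` U \<subseteq> U"
    using word_U ij by auto
  show ?case
  proof (cases "i = j")
    case True
    then have "word_map S v ` U \<inter> word_map S w' ` U = {}"
      using Cons w ij by auto
    then have "S i ` (word_map S v ` U) \<inter> S i ` (word_map S w' ` U) = {}"
      using S_inj[OF ij(1)] img U_subset
      by (subst inj_on_image_Int[symmetric, of "S i" X]) auto
    then show ?thesis
      using w True by (simp add: image_comp)
  next
    case False
    then have "S i ` (word_map S v ` U) \<inter> S j ` (word_map S w' ` U) = {}"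
      using S_disjoint[OF ij(1,2)] img by blast
    then show ?thesis
      using w by (simp add: image_comp)
  qed
qed simp

section \<open>Packing by comparison of volumes\<close>

text \<open>A pair \<open>(w, y)\<close> represents the point \<open>word_map S w y\<close>. Pairs
  are counted instead of points, because points of \<open>X\<close> outside \<open>U\<close> may
  coincide under different words. The two alternatives are the two ways in which the images of
  \<open>ball y (\<rho> / 2) \<inter> U\<close> under the word maps become disjoint.\<close>

definition separated_pairs :: "real \<Rightarrow> ('i list \<times> 'a) set \<Rightarrow> bool" where
  "separated_pairs \<rho> P \<longleftrightarrow> finite P \<and> P \<subseteq> lists I \<times> X \<and>
     (\<forall>(v, x)\<in>P. \<forall>(w, y)\<in>P. (v, x) \<noteq> (w, y) \<longrightarrow>
        (if v = w then \<rho> \<le> dist x y else word_map S v ` U \<inter> word_map S w ` U = {}))"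

text \<open>The disjoint pieces have volume at least the summands by \<open>word_measure\<close>,
  and by \<open>word_lipschitz\<close> they all lie in \<open>cball z R\<close>.\<close>

lemma separated_pairs_sum_le:
  assumes P: "separated_pairs \<rho> P" and \<rho>: "0 < \<rho>" "\<rho> \<le> 1" and "0 \<le> R"
    and R: "\<And>w y. (w, y) \<in> P \<Longrightarrow> dist z (word_map S w y) + L * size w * \<rho> \<le> R"
  shows "(\<Sum>(w, y)\<in>P. \<kappa> * (size w * (\<rho> / 2)) ^ DIM('a)) \<le> unit_ball_vol (real DIM('a)) * R ^ DIM('a)"
proof -
  define Q where "Q = (\<lambda>(w, y). word_map S w ` (ball y (\<rho> / 2) \<inter> U))"
  have fin: "finite P" and sub: "P \<subseteq> lists I \<times> X"
    using P by (auto simp: separated_pairs_def)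
  have "\<forall>x\<in>P. \<exists>E. E \<in> lmeasurable \<and> E \<subseteq> Q x \<and>
      \<kappa> * (size (fst x) * (\<rho> / 2)) ^ DIM('a) \<le> measure lebesgue E"
  proof
    fix x assume "x \<in> P"
    then obtain w y where wy: "x = (w, y)" "w \<in> lists I" "y \<in> X"
      using sub by blast
    show "\<exists>E. E \<in> lmeasurable \<and> E \<subseteq> Q x \<and> \<kappa> * (size (fst x) * (\<rho> / 2)) ^ DIM('a) \<le> measure lebesgue E"
      using word_measure[OF wy(2,3), of "\<rho> / 2"] \<rho> by (auto simp: Q_def wy(1))
  qed
  from bchoice[OF this] obtain E where E: "\<And>x. x \<in> P \<Longrightarrow> E x \<in> lmeasurable" "\<And>x. x \<in> P \<Longrightarrow> E x \<subseteq> Q x"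
    "\<And>x. x \<in> P \<Longrightarrow> \<kappa> * (size (fst x) * (\<rho> / 2)) ^ DIM('a) \<le> measure lebesgue (E x)"
    by auto
  have disj: "Q p \<inter> Q p' = {}" if pp: "p \<in> P" "p' \<in> P" "p \<noteq> p'" for p p'
  proof -
    obtain v x w y where vw: "p = (v, x)" "p' = (w, y)"
      by (metis surj_pair)
    show ?thesis
    proof (cases "v = w")
      case True
      then have "\<rho> \<le> dist x y"
        using P pp unfolding separated_pairs_def vw by fastforce
      then have "(ball x (\<rho> / 2) \<inter> U) \<inter> (ball y (\<rho> / 2) \<inter> U) = {}"
        using dist_triangle_half_r[of _ x \<rho> y] by (fastforce simp: dist_commute)
      moreover have "inj_on (word_map S v) U"
        using word_inj sub pp vw U_subset by (auto intro: inj_on_subset)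
      ultimately show ?thesis
        unfolding Q_def vw True by (simp add: inj_on_image_Int[symmetric])
    next
      case False
      then have "word_map S v ` U \<inter> word_map S w ` U = {}"
        using P pp unfolding separated_pairs_def vw by fastforce
      then show ?thesis
        unfolding Q_def vw by auto
    qed
  qed
  have "(\<Sum>(w, y)\<in>P. \<kappa> * (size w * (\<rho> / 2)) ^ DIM('a)) \<le> (\<Sum>x\<in>P. measure lebesgue (E x))"
    using E(3) by (auto intro!: sum_mono simp: case_prod_beta)
  also have "\<dots> = measure lebesgue (\<Union>x\<in>P. E x)"
  proof (rule measure_UNION'[symmetric])
    show "pairwise (\<lambda>i j. disjnt (E i) (E j)) P"
      unfolding pairwise_def disjnt_def using disj E(2) by blast
  qed (use fin E in auto)
  also have "\<dots> \<le> measure lebesgue (cball z R)"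
  proof (rule measure_mono_fmeasurable)
    show "(\<Union>x\<in>P. E x) \<subseteq> cball z R"
    proof clarify
      fix w y e assume wy: "(w, y) \<in> P" and "e \<in> E (w, y)"
      then obtain u where u: "u \<in> ball y (\<rho> / 2)" "u \<in> U" "e = word_map S w u"
        using E(2)[OF wy] by (auto simp: Q_def)
      have "w \<in> lists I" "y \<in> X"
        using wy sub by auto
      then have "dist (word_map S w y) e \<le> L * size w * dist y u"
        using u U_subset word_lipschitz by auto
      also have "\<dots> \<le> L * size w * \<rho>"
        using u \<rho> L size_pos[OF \<open>w \<in> lists I\<close>] by (intro mult_left_mono) auto
      finally show "e \<in> cball z R"
        using R[OF wy] dist_triangle[of z e "word_map S w y"] by simp
    qed
  qed (use fin E in \<open>auto intro!: sets.finite_UN\<close>)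
  also have "\<dots> = unit_ball_vol (real DIM('a)) * R ^ DIM('a)"
    using \<open>0 \<le> R\<close> by (simp add: content_cball)
  finally show ?thesis .
qed

text \<open>\<open>1 + L\<close> comes from the radius that contains the pieces, \<open>2\<close>
  from halving the separation, and \<open>\<kappa>\<close> from the lower volume bound.\<close>

definition packing_const :: real where
  "packing_const = unit_ball_vol (real DIM('a)) * (1 + L) ^ DIM('a) * 2 ^ DIM('a) / \<kappa>"

lemma packing_const_pos: "0 < packing_const"
  unfolding packing_const_def using L \<kappa> by (simp add: unit_ball_vol_def)

text \<open>With \<open>a\<close> a fixed multiple of \<open>R\<close> this bounds the number of
  pairs independently of the scale. It serves both for cylinders meeting a small set and for image
  points lying in a small ball.\<close>

lemma separated_pairs_card_le:
  assumes P: "separated_pairs \<rho> P" and pos: "0 < \<rho>" "\<rho> \<le> 1" "0 < a" "0 < R"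
    and b: "\<And>w y. (w, y) \<in> P \<Longrightarrow> a \<le> size w * \<rho> \<and> size w * \<rho> \<le> R \<and> word_map S w y \<in> cball z R"
  shows "real (card P) * a ^ DIM('a) \<le> packing_const * R ^ DIM('a)"
proof -
  let ?d = "DIM('a)"
  have "(\<Sum>(w, y)\<in>P. \<kappa> * (a / 2) ^ ?d) \<le> (\<Sum>(w, y)\<in>P. \<kappa> * (size w * (\<rho> / 2)) ^ ?d)"
  proof (rule sum_mono, clarify)
    fix w y assume "(w, y) \<in> P"
    from b[OF this] show "\<kappa> * (a / 2) ^ ?d \<le> \<kappa> * (size w * (\<rho> / 2)) ^ ?d"
      using pos \<kappa> by (intro mult_left_mono power_mono) auto
  qed
  also have "\<dots> \<le> unit_ball_vol (real ?d) * ((1 + L) * R) ^ ?d"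
  proof (rule separated_pairs_sum_le[OF P pos(1,2)])
    fix w y assume "(w, y) \<in> P"
    from b[OF this] have "dist z (word_map S w y) \<le> R" "L * (size w * \<rho>) \<le> L * R"
      using L by auto
    then show "dist z (word_map S w y) + L * size w * \<rho> \<le> (1 + L) * R"
      by (simp add: algebra_simps)
  qed (use L pos in auto)
  finally have "real (card P) * \<kappa> * a ^ ?d / 2 ^ ?d \<le> unit_ball_vol (real ?d) * (1 + L) ^ ?d * R ^ ?d"
    by (simp add: case_prod_unfold power_divide power_mult_distrib mult.assoc)
  then show ?thesis
    unfolding packing_const_def using \<kappa> by (simp add: field_simps)
qed

text \<open>Cylinders of one level have disjoint pieces inside a bounded region, so their total
  volume is bounded independently of the level.\<close>

lemma sum_size_dim_le:
  obtains C where "\<And>A n. \<lbrakk>finite A; A \<subseteq> {w \<in> lists I. length w = n}\<rbrakk> \<Longrightarrow> (\<Sum>w\<in>A. size w ^ DIM('a)) \<le> C"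
proof -
  let ?d = "DIM('a)"
  obtain x0 where x0: "x0 \<in> X"
    using X_nonempty by blast
  have bX: "bounded X"
    using compact_X compact_imp_bounded by blast
  define R where "R = diameter X + L"
  have R0: "0 \<le> R"
    using L diameter_ge_0[OF bX] by (simp add: R_def)
  have "(\<Sum>w\<in>A. size w ^ ?d) \<le> unit_ball_vol (real ?d) * R ^ ?d * 2 ^ ?d / \<kappa>"
    if A: "finite A" "A \<subseteq> {w \<in> lists I. length w = n}" for A n
  proof -
    have A': "w \<in> lists I" "length w = n" if "w \<in> A" for w
      using A(2) that by blast+
    have "v = w" if "v \<in> A" "w \<in> A" "prefix v w" for v w
      using that A'(2)[of v] A'(2)[of w] by (auto simp: prefix_def)
    then have "word_map S v ` U \<inter> word_map S w ` U = {}" if "v \<in> A" "w \<in> A" "v \<noteq> w" for v w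
      using that A'(1) by (intro word_disjoint) auto
    moreover have "A \<times> {x0} \<subseteq> lists I \<times> X"
      using A'(1) x0 by blast
    ultimately have "separated_pairs 1 (A \<times> {x0})"
      unfolding separated_pairs_def using A(1) by simp
    then have "(\<Sum>(w, y)\<in>A \<times> {x0}. \<kappa> * (size w * (1 / 2)) ^ ?d) \<le> unit_ball_vol (real ?d) * R ^ ?d"
    proof (rule separated_pairs_sum_le[where z = x0])
      fix w y assume wy: "(w, y) \<in> A \<times> {x0}"
      then have w: "w \<in> lists I"
        using A'(1) by blast
      then have "dist x0 (word_map S w y) \<le> diameter X"
        using word_X x0 wy by (intro diameter_bounded_bound[OF bX]) auto
      moreover have "L * size w \<le> L"
        using size_le_1[OF w] L by simp
      ultimately show "dist x0 (word_map S w y) + L * size w * 1 \<le> R"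
        by (simp add: R_def)
    qed (use R0 in auto)
    also have "(\<Sum>(w, y)\<in>A \<times> {x0}. \<kappa> * (size w * (1 / 2)) ^ ?d) = (\<Sum>w\<in>A. \<kappa> / 2 ^ ?d * size w ^ ?d)"
      by (subst sum.cartesian_product[symmetric]) (simp add: power_divide)
    also have "\<dots> = \<kappa> / 2 ^ ?d * (\<Sum>w\<in>A. size w ^ ?d)"
      by (simp add: sum_distrib_left)
    finally show ?thesis
      using \<kappa> by (simp add: field_simps)
  qed
  then show ?thesis
    by (rule that)
qed

section \<open>Fixed points and points of the limit set\<close>

lemma fixed_point_exists:
  assumes "i \<in> I"
  obtains p where "p \<in> X" "S i p = p"
proof -
  have "\<exists>!p\<in>X. S i p = p"
    using compact_X X_nonempty c S_X[OF assms] S_contraction[OF assms]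
    by (intro Banach_fix[of X c]) (auto simp: compact_imp_complete)
  then show ?thesis
    using that by blast
qed

text \<open>The intersection in \<open>limit_set\<close> starts at level 1; level 0 is added here
  because the images stay in \<open>X\<close>.\<close>

lemma limit_setE:
  assumes "x \<in> limit_set I S X"
  obtains \<gamma> where "range \<gamma> \<subseteq> I" "\<And>n. x \<in> word_map S (map \<gamma> [0..<n]) ` X"
proof -
  obtain \<gamma> where \<gamma>: "range \<gamma> \<subseteq> I" "\<And>n. 1 \<le> n \<Longrightarrow> x \<in> word_map S (map \<gamma> [0..<n]) ` X"
    using assms unfolding limit_set_def by auto
  have "x \<in> X"
    using \<gamma>(2)[of 1] word_X[of "map \<gamma> [0..<1]"] \<gamma>(1) by auto
  then have "x \<in> word_map S (map \<gamma> [0..<n]) ` X" for n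
    using \<gamma>(2)[of n] by (cases n) auto
  with \<gamma>(1) show ?thesis
    by (rule that)
qed

lemma limit_set_subset: "limit_set I S X \<subseteq> X"
  by (auto elim!: limit_setE dest: spec[of _ 0] meta_spec[of _ 0])

lemma map_upt_in_lists: "range \<gamma> \<subseteq> I \<Longrightarrow> map \<gamma> [0..<n] \<in> lists I"
  by (simp add: image_subset_iff in_lists_conv_set)

lemma fixed_points_subset_limit_set: "fixed_points I S X \<subseteq> limit_set I S X"
proof
  fix x assume "x \<in> fixed_points I S X"
  then obtain i where i: "i \<in> I" "x \<in> X" "S i x = x"
    by (auto simp: fixed_points_def)
  have "word_map S (map (\<lambda>_. i) [0..<n]) x = x" for n
    by (induction n) (simp_all add: word_map_append i)
  then have "x \<in> word_map S (map (\<lambda>_. i) [0..<n]) ` X" for n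
    using i(2) by (metis imageI)
  then show "x \<in> limit_set I S X"
    using i(1) unfolding limit_set_def by (intro UN_I[of "\<lambda>_. i"]) auto
qed

lemma fixed_points_nonempty: "fixed_points I S X \<noteq> {}"
proof -
  obtain i where i: "i \<in> I"
    using I_nonempty by blast
  obtain p where "p \<in> X" "S i p = p"
    using fixed_point_exists[OF i] .
  with i show ?thesis
    by (auto simp: fixed_points_def)
qed

lemma limit_set_S:
  assumes "i \<in> I" "x \<in> limit_set I S X"
  shows "S i x \<in> limit_set I S X"
proof -
  obtain \<gamma> where \<gamma>: "range \<gamma> \<subseteq> I" "\<And>n. x \<in> word_map S (map \<gamma> [0..<n]) ` X"
    using assms(2) by (rule limit_setE) (rule that)
  let ?g = "case_nat i \<gamma>"
  have "S i x \<in> word_map S (map ?g [0..<n]) ` X" if "1 \<le> n" for n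
  proof -
    obtain m where m: "n = Suc m"
      using \<open>1 \<le> n\<close> by (cases n) auto
    have "map ?g [0..<n] = i # map \<gamma> [0..<m]"
      unfolding m by (simp add: upt_conv_Cons map_Suc_upt[symmetric] del: upt_Suc)
    then show ?thesis
      using \<gamma>(2)[of m] by auto
  qed
  moreover have "range ?g \<subseteq> I"
    using \<gamma>(1) assms(1) by (simp add: image_subset_iff split: nat.split)
  ultimately show ?thesis
    unfolding limit_set_def by (intro UN_I[of ?g]) auto
qed

lemma limit_set_word:
  assumes "w \<in> lists I" "x \<in> limit_set I S X"
  shows "word_map S w x \<in> limit_set I S X"
  using assms(1) by (induction w) (auto simp: assms(2) limit_set_S)

lemma bounded_limit_set: "bounded (limit_set I S X)"
  using limit_set_subset compact_X bounded_subset compact_imp_bounded by blast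

lemma diameter_word_le:
  assumes "w \<in> lists I"
  shows "diameter (word_map S w ` X) \<le> L * size w * diameter X"
proof (rule diameter_le)
  show "word_map S w ` X \<noteq> {} \<or> 0 \<le> L * size w * diameter X"
    using X_nonempty by blast
next
  fix x y assume "x \<in> word_map S w ` X" "y \<in> word_map S w ` X"
  then obtain x' y' where xy: "x' \<in> X" "y' \<in> X" "x = word_map S w x'" "y = word_map S w y'"
    by blast
  have "dist x y \<le> L * size w * dist x' y'"
    using word_lipschitz assms xy by blast
  also have "\<dots> \<le> L * size w * diameter X"
    using L size_pos[OF assms] xy compact_X
    by (intro mult_left_mono diameter_bounded_bound) (auto simp: compact_imp_bounded)
  finally show "norm (x - y) \<le> L * size w * diameter X"
    by (simp add: dist_norm)
qed

section \<open>Null sets from covers by cylinders\<close>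

text \<open>The cylinders of one level cover the limit set. A level may be infinite, so the
  hypothesis bounds its finite partial sums; \<open>n0\<close> allows the level to be deep enough
  for the diameters to fall below \<open>\<delta>\<close>.\<close>

lemma hausdorff_measure_limit_set_eq_0:
  assumes t: "0 < t"
    and small: "\<And>\<epsilon> n0. 0 < \<epsilon> \<Longrightarrow> \<exists>n\<ge>n0. \<forall>A. finite A \<and> A \<subseteq> {w \<in> lists I. length w = n} \<longrightarrow>
                  (\<Sum>w\<in>A. size w powr t) \<le> \<epsilon>"
  shows "hausdorff_measure t (limit_set I S X) = 0"
proof -
  define D where "D = L * diameter X"
  have D0: "0 \<le> D"
    using L compact_X by (simp add: D_def compact_imp_bounded diameter_ge_0)
  have "hausdorff_premeasure t \<delta> (limit_set I S X) \<le> 0" if \<delta>: "0 < \<delta>" for \<delta>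
  proof (rule ennreal_le_epsilon)
    fix e :: real assume e: "0 < e"
    have "(\<lambda>n. D * c ^ n) \<longlonglongrightarrow> D * 0"
      using c by (intro tendsto_intros LIMSEQ_power_zero) auto
    then have "\<forall>\<^sub>F n in sequentially. D * c ^ n < \<delta>"
      using \<delta> by (intro order_tendstoD(2)) auto
    then obtain n0 where n0: "\<And>n. n \<ge> n0 \<Longrightarrow> D * c ^ n < \<delta>"
      by (auto simp: eventually_sequentially)
    \<comment> \<open>The summand 1 keeps the denominator positive when
      \<open>D = 0\<close>.\<close>
    define \<epsilon> where "\<epsilon> = e / (D powr t + 1)"
    have pos: "0 < D powr t + 1"
      by (simp add: add_nonneg_pos)
    then have "0 < \<epsilon>"
      using e by (simp add: \<epsilon>_def)
    from small[OF this, of n0] obtain n where n: "n \<ge> n0"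
      and "\<forall>A. finite A \<and> A \<subseteq> {w \<in> lists I. length w = n} \<longrightarrow> (\<Sum>w\<in>A. size w powr t) \<le> \<epsilon>"
      by (elim exE conjE)
    then have sums: "(\<Sum>w\<in>A. size w powr t) \<le> \<epsilon>"
      if "finite A" "A \<subseteq> {w \<in> lists I. length w = n}" for A
      using that by simp
    define W where "W = {w \<in> lists I. length w = n}"
    have W: "countable W"
      unfolding W_def by (rule countable_subset[of _ "lists I"]) (use countable_I in auto)
    \<comment> \<open>The level may be finite or infinite, while a cover is a sequence. Indices
      outside \<open>B\<close> receive the empty set, which contributes
      \<open>0 powr t = 0\<close>.\<close>
    define B where "B = to_nat_on W ` W"
    define C where "C k = (if k \<in> B then word_map S (from_nat_into W k) ` X else {})" for k
    have inW: "from_nat_into W k \<in> W" if "k \<in> B" for k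
      using that by (intro from_nat_into) (auto simp: B_def)
    have W_word: "from_nat_into W k \<in> lists I" "length (from_nat_into W k) = n" if "k \<in> B" for k
      using inW[OF that] unfolding W_def by blast+
    have inj: "inj_on (from_nat_into W) B"
      unfolding B_def using W by (intro inj_onI) auto
    have diam: "diameter (C k) \<le> D * size (from_nat_into W k)" if "k \<in> B" for k
      using diameter_word_le[OF W_word(1)[OF that]] that
      by (simp add: C_def D_def mult_ac)
    have "limit_set I S X \<subseteq> (\<Union>k. C k)"
    proof
      fix x assume "x \<in> limit_set I S X"
      then obtain \<gamma> where \<gamma>: "range \<gamma> \<subseteq> I" "\<And>n. x \<in> word_map S (map \<gamma> [0..<n]) ` X"
        by (rule limit_setE) (rule that)
      have mem: "map \<gamma> [0..<n] \<in> W"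
        using map_upt_in_lists[OF \<gamma>(1)] by (simp add: W_def)
      then have "x \<in> C (to_nat_on W (map \<gamma> [0..<n]))"
        using \<gamma>(2)[of n] W unfolding C_def B_def by simp
      then show "x \<in> (\<Union>k. C k)"
        by blast
    qed
    moreover have "bounded (C k) \<and> diameter (C k) \<le> \<delta>" for k
    proof (cases "k \<in> B")
      case True
      have "bounded (C k)"
        using True word_X[OF W_word(1)[OF True]] compact_X unfolding C_def
        by (auto intro: bounded_subset compact_imp_bounded)
      moreover have "D * size (from_nat_into W k) \<le> D * c ^ n"
        using W_word[OF True] size_le[OF W_word(1)[OF True]] D0 by (intro mult_left_mono) auto
      ultimately show ?thesis
        using diam[OF True] n0[OF n] by simp
    qed (use \<delta> in \<open>simp add: C_def\<close>)
    ultimately have "hausdorff_premeasure t \<delta> (limit_set I S X) \<le> (\<Sum>k. ennreal (diameter (C k) powr t))"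
      unfolding hausdorff_premeasure_def by (intro INF_lower) auto
    also have "\<dots> \<le> ennreal e"
    proof (rule suminf_le_const)
      fix N
      have "(\<Sum>k<N. ennreal (diameter (C k) powr t)) = ennreal (\<Sum>k<N. diameter (C k) powr t)"
        by simp
      also have "(\<Sum>k<N. diameter (C k) powr t) = (\<Sum>k\<in>{..<N} \<inter> B. diameter (C k) powr t)"
        by (rule sum.mono_neutral_right) (auto simp: C_def)
      also have "\<dots> \<le> (\<Sum>k\<in>{..<N} \<inter> B. D powr t * size (from_nat_into W k) powr t)"
      proof (rule sum_mono)
        fix k assume k: "k \<in> {..<N} \<inter> B"
        have "diameter (C k) powr t \<le> (D * size (from_nat_into W k)) powr t"
          using diam[of k] k t \<open>\<And>k. bounded (C k) \<and> _\<close> by (intro powr_mono2) (auto simp: diameter_ge_0)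
        then show "diameter (C k) powr t \<le> D powr t * size (from_nat_into W k) powr t"
          using D0 size_pos[OF W_word(1)] k by (simp add: powr_mult less_imp_le)
      qed
      also have "\<dots> = D powr t * (\<Sum>w\<in>from_nat_into W ` ({..<N} \<inter> B). size w powr t)"
        by (subst sum.reindex) (auto simp: sum_distrib_left intro: inj_on_subset[OF inj])
      also have "\<dots> \<le> D powr t * \<epsilon>"
        using inW unfolding W_def by (intro mult_left_mono sums) auto
      also have "\<dots> \<le> (D powr t + 1) * \<epsilon>"
        using \<open>0 < \<epsilon>\<close> by simp
      also have "\<dots> = e"
        unfolding \<epsilon>_def using pos by simp
      finally show "(\<Sum>k<N. ennreal (diameter (C k) powr t)) \<le> ennreal e"
        by (simp add: ennreal_leI)
    qed simp
    finally show "hausdorff_premeasure t \<delta> (limit_set I S X) \<le> 0 + ennreal e"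
      by simp
  qed
  then have "hausdorff_measure t (limit_set I S X) \<le> 0"
    unfolding hausdorff_measure_def by (intro SUP_least) auto
  then show ?thesis
    by simp
qed

section \<open>Mass distribution for finite systems\<close>

text \<open>Sizes are not assumed to decrease along prefixes, so the condition on all strict
  prefixes picks the first time that the size reaches \<open>\<delta>\<close>. The result is an
  antichain that every infinite word meets.\<close>

definition stopping_words :: "real \<Rightarrow> 'i list set" where
  "stopping_words \<delta> = {w \<in> lists I. size w \<le> \<delta> \<and> (\<forall>v. strict_prefix v w \<longrightarrow> \<delta> < size v)}"

lemma stopping_words_in_lists: "stopping_words \<delta> \<subseteq> lists I"
  unfolding stopping_words_def by (rule Collect_restrict)

lemma stopping_words_disjoint:
  assumes "v \<in> stopping_words \<delta>" "w \<in> stopping_words \<delta>" "v \<noteq> w"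
  shows "word_map S v ` U \<inter> word_map S w ` U = {}"
proof (rule word_disjoint)
  have "size v \<le> \<delta>" "size w \<le> \<delta>" "strict_prefix v w \<Longrightarrow> \<delta> < size v" "strict_prefix w v \<Longrightarrow> \<delta> < size w"
    using assms(1,2) unfolding stopping_words_def by auto
  then show "\<not> prefix v w" "\<not> prefix w v"
    using assms(3) by (auto simp: strict_prefix_def)
qed (use assms stopping_words_in_lists in \<open>blast+\<close>)

text \<open>Removing the last letter of a non-empty stopping word leaves a size above
  \<open>\<delta>\<close>, which bounds the length through \<open>size_le\<close>.\<close>

lemma finite_stopping_words:
  assumes "finite I" "0 < \<delta>"
  shows "finite (stopping_words \<delta>)"
proof -
  obtain n where n: "c ^ n < \<delta>"
    using c assms(2) real_arch_pow_inv by blast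
  have "length w \<le> n" if w: "w \<in> stopping_words \<delta>" for w
  proof (rule ccontr)
    assume "\<not> length w \<le> n"
    then have "w \<noteq> []" "n \<le> length (butlast w)"
      by auto
    then have "strict_prefix (butlast w) w"
      by (metis append_butlast_last_id strict_prefixI')
    then have "\<delta> < size (butlast w)"
      using w unfolding stopping_words_def by blast
    also have "\<dots> \<le> c ^ length (butlast w)"
      using w stopping_words_in_lists by (intro size_le) (auto dest!: in_set_butlastD simp: in_lists_conv_set)
    also have "\<dots> \<le> c ^ n"
      using c \<open>n \<le> length (butlast w)\<close> by (intro power_decreasing) auto
    finally show False
      using n by simp
  qed
  then have "stopping_words \<delta> \<subseteq> {w. set w \<subseteq> I \<and> length w \<le> n}"
    unfolding stopping_words_def by (auto simp: in_lists_conv_set)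
  then show ?thesis
    using finite_lists_length_le[OF assms(1)] finite_subset by blast
qed

lemma stopping_words_hit:
  assumes "range \<gamma> \<subseteq> I" "0 < \<delta>"
  obtains n where "map \<gamma> [0..<n] \<in> stopping_words \<delta>"
proof -
  let ?g = "\<lambda>n. map \<gamma> [0..<n]"
  have gI: "?g n \<in> lists I" for n
    using map_upt_in_lists assms(1) by blast
  obtain m where "c ^ m < \<delta>"
    using c assms(2) real_arch_pow_inv by blast
  then have "size (?g m) \<le> \<delta>"
    using size_le[OF gI[of m]] by simp
  then have ex: "\<exists>n. size (?g n) \<le> \<delta>"
    by blast
  define n where "n = (LEAST n. size (?g n) \<le> \<delta>)"
  have n: "size (?g n) \<le> \<delta>" "\<And>m. m < n \<Longrightarrow> \<not> size (?g m) \<le> \<delta>"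
    unfolding n_def by (rule LeastI_ex[OF ex], rule not_less_Least)
  have "\<delta> < size v" if v: "strict_prefix v (?g n)" for v
  proof -
    have len: "length v < n"
      using prefix_length_less[OF v] by simp
    obtain u where "?g n = v @ u"
      using v unfolding strict_prefix_def prefix_def by auto
    then have "v = take (length v) (?g n)"
      by simp
    with len have "v = ?g (length v)"
      by (simp add: take_map)
    then show ?thesis
      using n(2)[OF len] by (simp add: not_le)
  qed
  then have "?g n \<in> stopping_words \<delta>"
    unfolding stopping_words_def using gI n(1) by blast
  then show ?thesis
    by (rule that)
qed

text \<open>Appending one letter to a word costs at most this factor in size, by
  \<open>size_append\<close>. The inserted 1 handles the empty word.\<close>

definition stopping_const :: real where
  "stopping_const = Min (insert 1 ((\<lambda>i. size [i]) ` I)) / K"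

lemma stopping_const_pos: "finite I \<Longrightarrow> 0 < stopping_const"
  unfolding stopping_const_def using K size_pos by auto

lemma stopping_words_size_ge:
  assumes "finite I" and \<delta>: "\<delta> \<le> 1" "0 < \<delta>" and w: "w \<in> stopping_words \<delta>"
  shows "stopping_const * \<delta> \<le> size w"
proof -
  define m where "m = Min (insert 1 ((\<lambda>i. size [i]) ` I))"
  have m: "0 < m" "m \<le> 1" "\<And>i. i \<in> I \<Longrightarrow> m \<le> size [i]"
    unfolding m_def using assms size_pos by auto
  have "m / K * \<delta> \<le> size w"
  proof (cases w rule: rev_cases)
    case Nil
    have "m / K \<le> 1"
      using m K by simp
    then have "m / K * \<delta> \<le> 1 * 1"
      using \<delta> m K by (intro mult_mono) auto
    then show ?thesis
      by (simp add: Nil size_Nil)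
  next
    case (snoc u i)
    have ui: "u \<in> lists I" "i \<in> I"
      using subsetD[OF stopping_words_in_lists w] snoc by simp_all
    have "strict_prefix u w"
      using snoc by (simp add: strict_prefix_def)
    then have "\<delta> < size u"
      using w unfolding stopping_words_def by simp
    then have "\<delta> * m \<le> size u * size [i]"
      using m ui \<delta> by (intro mult_mono) (auto simp: less_imp_le)
    also have "\<dots> \<le> K * size w"
      unfolding snoc using ui by (intro size_append) auto
    finally show ?thesis
      using K by (simp add: field_simps)
  qed
  then show ?thesis
    unfolding stopping_const_def m_def .
qed

text \<open>The probability vector of a Bernoulli measure on infinite words, provided the
  denominator is at least 1.\<close>

definition weight :: "real \<Rightarrow> 'i \<Rightarrow> real" where
  "weight t i = (size [i] / K) powr t / (\<Sum>j\<in>I. (size [j] / K) powr t)"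

lemma weight_nonneg: "0 \<le> weight t i"
  unfolding weight_def by (intro divide_nonneg_nonneg sum_nonneg) auto

lemma sum_weight:
  assumes "1 \<le> (\<Sum>j\<in>I. (size [j] / K) powr t)"
  shows "sum (weight t) I = 1"
  using assms unfolding weight_def by (simp flip: sum_divide_distrib)

text \<open>Each letter brings a factor \<open>1 / K\<close>, which pays for one use of
  \<open>size_append\<close>. Normalising only lowers the weights since the denominator is at least
  1.\<close>

lemma prod_weight_le:
  assumes "1 \<le> (\<Sum>j\<in>I. (size [j] / K) powr t)" "0 \<le> t" "w \<in> lists I"
  shows "prod_list (map (weight t) w) \<le> size w powr t"
  using assms(3)
proof (induction w)
  case Nil
  then show ?case
    by (simp add: size_Nil)
next
  case (Cons i w)
  have pos: "0 < size [i]" "0 < size w" "0 < size (i # w)"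
    using Cons.hyps size_pos by auto
  have "weight t i \<le> (size [i] / K) powr t"
    unfolding weight_def using assms(1) by (auto simp: divide_le_eq mult_le_cancel_left1)
  then have "prod_list (map (weight t) (i # w)) \<le> (size [i] / K) powr t * size w powr t"
    using Cons.IH weight_nonneg by (auto intro!: mult_mono prod_list_nonneg)
  also have "\<dots> = (size [i] / K * size w) powr t"
    using pos K by (subst powr_mult) auto
  also have "\<dots> \<le> size (i # w) powr t"
  proof (rule powr_mono2)
    have "size [i] * size w \<le> K * size (i # w)"
      using size_append[of "[i]" w] Cons.hyps by simp
    then show "size [i] / K * size w \<le> size (i # w)"
      using K by (simp add: field_simps)
  qed (use assms(2) pos K in auto)
  finally show ?case .
qed

lemma sum_weight_le_card:
  assumes "1 \<le> (\<Sum>j\<in>I. (size [j] / K) powr t)" "0 \<le> t" "A \<subseteq> stopping_words \<delta>"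
  shows "(\<Sum>w\<in>A. prod_list (map (weight t) w)) \<le> real (card A) * \<delta> powr t"
proof -
  have "(\<Sum>w\<in>A. prod_list (map (weight t) w)) \<le> (\<Sum>w\<in>A. \<delta> powr t)"
  proof (rule sum_mono)
    fix w assume "w \<in> A"
    then have w: "w \<in> lists I" "size w \<le> \<delta>"
      using assms(3) unfolding stopping_words_def by blast+
    have "prod_list (map (weight t) w) \<le> size w powr t"
      using prod_weight_le assms(1,2) w(1) by blast
    also have "\<dots> \<le> \<delta> powr t"
      using w assms(2) size_pos[OF w(1)] by (intro powr_mono2) auto
    finally show "prod_list (map (weight t) w) \<le> \<delta> powr t" .
  qed
  then show ?thesis
    by simp
qed

text \<open>Every infinite word meets the stopping words, so their total weight cannot be below 1,
  while each has weight at most \<open>\<delta> powr t\<close>.\<close>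

lemma card_stopping_words_ge:
  assumes fin: "finite I" and t: "0 \<le> t" and sum: "1 \<le> (\<Sum>j\<in>I. (size [j] / K) powr t)"
    and \<delta>: "0 < \<delta>"
  shows "1 \<le> real (card (stopping_words \<delta>)) * \<delta> powr t"
proof (rule ccontr)
  let ?q = "\<lambda>w. prod_list (map (weight t) w)"
  \<comment> \<open>A single family, placed at index 0 of the sequence of families to be
    avoided.\<close>
  define A where "A = (\<lambda>k::nat. if k = 0 then stopping_words \<delta> else {})"
  assume "\<not> ?thesis"
  then have "(\<Sum>w\<in>stopping_words \<delta>. ?q w) < 1"
    using sum_weight_le_card[OF sum t order_refl] by (meson le_less_trans not_less)
  moreover have "(\<Sum>k. ennreal (sum ?q (A k))) = ennreal (sum ?q (stopping_words \<delta>))"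
    using suminf_finite[of "{0}" "\<lambda>k. ennreal (sum ?q (A k))"] by (simp add: A_def)
  ultimately have less: "(\<Sum>k. ennreal (sum ?q (A k))) < 1"
    by (simp add: ennreal_less_one_iff)
  have "\<exists>\<gamma>. range \<gamma> \<subseteq> I \<and> (\<forall>k n. map \<gamma> [0..<n] \<notin> A k)"
    using fin weight_nonneg sum_weight[OF sum] less finite_stopping_words[OF fin \<delta>] stopping_words_in_lists
    by (intro exists_sequence_avoiding[of I "weight t"]) (auto simp: A_def simp del: in_lists_conv_set)
  then obtain \<gamma> where "range \<gamma> \<subseteq> I" "\<And>n. map \<gamma> [0..<n] \<notin> A 0"
    by auto
  then show False
    using stopping_words_hit[of \<gamma> \<delta>] \<delta> by (auto simp: A_def)
qed

text \<open>
  The mass distribution principle, without a measure: if a cover had small total \<open>t\<close>-mass, the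
  stopping words meeting its members would have total weight below 1, so some infinite word
  would avoid all of them, and its point in the limit set would not be covered.
\<close>

lemma hausdorff_measure_limit_set_neq_0:
  assumes fin: "finite I" and t: "0 < t" and sum: "1 \<le> (\<Sum>j\<in>I. (size [j] / K) powr t)"
  shows "hausdorff_measure t (limit_set I S X) \<noteq> 0"
proof -
  let ?q = "\<lambda>w. prod_list (map (weight t) w)"
  note c0 = stopping_const_pos[OF fin] stopping_words_size_ge[OF fin]
  define B where "B = packing_const / stopping_const ^ DIM('a)"
  have B: "0 < B"
    using packing_const_pos c0 by (simp add: B_def)
  \<comment> \<open>One point of \<open>E\<close> is chosen in each cylinder that meets it. All the
    words have size comparable to \<open>\<delta>\<close>, so the packing bound applies with
    separation 1.\<close>
  have card_hit: "real (card {w \<in> stopping_words \<delta>. word_map S w ` X \<inter> E \<noteq> {}}) \<le> B"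
    if \<delta>: "0 < \<delta>" "\<delta> \<le> 1" and E: "bounded E" "diameter E \<le> \<delta>" for \<delta> E
  proof (cases "{w \<in> stopping_words \<delta>. word_map S w ` X \<inter> E \<noteq> {}} = {}")
    case True
    then show ?thesis
      using B by (simp only: card.empty of_nat_0)
  next
    case False
    define A where "A = {w \<in> stopping_words \<delta>. word_map S w ` X \<inter> E \<noteq> {}}"
    have "\<forall>w\<in>A. \<exists>y. y \<in> X \<and> word_map S w y \<in> E"
      unfolding A_def by blast
    from bchoice[OF this] obtain f where f: "\<And>w. w \<in> A \<Longrightarrow> f w \<in> X" "\<And>w. w \<in> A \<Longrightarrow> word_map S w (f w) \<in> E"
      by auto
    obtain z where z: "z \<in> E"
      using False by blast
    have AW: "A \<subseteq> stopping_words \<delta>"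
      unfolding A_def by blast
    have Al: "w \<in> lists I" if "w \<in> A" for w
      using AW stopping_words_in_lists that by blast
    have finA: "finite A"
      using AW finite_stopping_words[OF fin \<delta>(1)] finite_subset by blast
    have disj: "word_map S v ` U \<inter> word_map S w ` U = {}" if "v \<in> A" "w \<in> A" "v \<noteq> w" for v w
      using AW that by (intro stopping_words_disjoint[of v \<delta> w]) auto
    have sub: "(\<lambda>w. (w, f w)) ` A \<subseteq> lists I \<times> X"
      using Al f by blast
    have "separated_pairs 1 ((\<lambda>w. (w, f w)) ` A)"
      unfolding separated_pairs_def using finA sub disj by simp
    then have "real (card ((\<lambda>w. (w, f w)) ` A)) * (stopping_const * \<delta>) ^ DIM('a) \<le> packing_const * \<delta> ^ DIM('a)"
    proof (rule separated_pairs_card_le[where z = z])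
      fix w y assume "(w, y) \<in> (\<lambda>w. (w, f w)) ` A"
      then have w: "w \<in> A" "y = f w"
        by auto
      have "w \<in> stopping_words \<delta>"
        using w AW by blast
      then have "stopping_const * \<delta> \<le> size w" "size w \<le> \<delta>"
        using c0(2)[OF \<delta>(2,1)] unfolding stopping_words_def by auto
      moreover have "dist z (word_map S w y) \<le> diameter E"
        using z f(2)[OF w(1)] E(1) w(2) by (intro diameter_bounded_bound) auto
      ultimately show "stopping_const * \<delta> \<le> size w * 1 \<and> size w * 1 \<le> \<delta> \<and> word_map S w y \<in> cball z \<delta>"
        using E(2) by simp
    qed (use \<delta> c0 in auto)
    also have "card ((\<lambda>w. (w, f w)) ` A) = card A"
      by (rule card_image) (simp add: inj_on_def)
    finally show ?thesis
      using \<delta> c0 unfolding A_def B_def by (simp add: power_mult_distrib field_simps)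
  qed
  \<comment> \<open>The padded cover below has total at most \<open>2 * \<eta>\<close>. The first
    bound keeps the weight of the words hit at most \<open>2 * (B * \<eta>)\<close>, hence below 1;
    the second gives \<open>g k \<le> 1\<close> and thus scales
    \<open>\<delta> k \<le> 1\<close>.\<close>
  define \<eta> where "\<eta> = min (1 / (4 * B)) (1 / 4)"
  have \<eta>: "0 < \<eta>" "\<eta> \<le> 1 / 4" "B * \<eta> \<le> 1 / 4"
    using B by (auto simp: \<eta>_def min_def field_simps)
  have "ennreal \<eta> \<le> hausdorff_premeasure t 1 (limit_set I S X)"
    unfolding hausdorff_premeasure_def
  proof (rule INF_greatest, rule ccontr)
    fix D assume "D \<in> {D. limit_set I S X \<subseteq> (\<Union>k::nat. D k) \<and> (\<forall>k. bounded (D k) \<and> diameter (D k) \<le> 1)}"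
    then have D: "limit_set I S X \<subseteq> (\<Union>k. D k)" "\<And>k. bounded (D k)"
      by auto
    assume "\<not> ennreal \<eta> \<le> (\<Sum>k. ennreal (diameter (D k) powr t))"
    then have small: "(\<Sum>k. ennreal (diameter (D k) powr t)) < ennreal \<eta>"
      by simp
    \<comment> \<open>A member of diameter 0 would have no positive scale. The padding makes every
      \<open>\<delta> k\<close> positive and adds only \<open>\<eta>\<close> in total.\<close>
    define g where "g k = diameter (D k) powr t + \<eta> * (1 / 2) ^ Suc k" for k
    define \<delta> where "\<delta> k = g k powr (1 / t)" for k
    have g_pos: "0 < g k" for k
      using \<eta> by (simp add: g_def add_nonneg_pos)
    have half: "(\<lambda>k. \<eta> * (1 / 2) ^ Suc k) sums \<eta>"
      using sums_mult[OF power_half_series, of \<eta>] by simp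
    have "(\<Sum>k. ennreal (g k)) = (\<Sum>k. ennreal (diameter (D k) powr t)) + (\<Sum>k. ennreal (\<eta> * (1 / 2) ^ Suc k))"
      unfolding g_def using \<eta> by (subst suminf_add) (auto simp: ennreal_plus)
    also have "(\<Sum>k. ennreal (\<eta> * (1 / 2) ^ Suc k)) = ennreal \<eta>"
      using half \<eta> by (subst suminf_ennreal2) (auto simp: sums_iff)
    also have "(\<Sum>k. ennreal (diameter (D k) powr t)) + ennreal \<eta> \<le> ennreal \<eta> + ennreal \<eta>"
      using small by (intro add_right_mono) auto
    also have "\<dots> = ennreal (2 * \<eta>)"
      using \<eta> by (simp flip: ennreal_plus)
    finally have g_sum: "(\<Sum>k. ennreal (g k)) \<le> ennreal (2 * \<eta>)" .
    have g_le: "g k \<le> 1" for k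
    proof -
      have "ennreal (g k) \<le> (\<Sum>k. ennreal (g k))"
        using sum_le_suminf[of "\<lambda>k. ennreal (g k)" "{k}"] by simp
      also note g_sum
      finally show ?thesis
        using \<eta> by (simp add: ennreal_le_iff)
    qed
    have \<delta>: "0 < \<delta> k" "\<delta> k \<le> 1" "\<delta> k powr t = g k" "diameter (D k) \<le> \<delta> k" for k
    proof -
      show "0 < \<delta> k" "\<delta> k powr t = g k"
        using g_pos[of k] t by (simp_all add: \<delta>_def powr_powr)
      show "\<delta> k \<le> 1"
        using g_pos[of k] g_le[of k] t by (simp add: \<delta>_def powr_le1)
      have "diameter (D k) = (diameter (D k) powr t) powr (1 / t)"
        using t D(2) by (simp add: powr_powr diameter_ge_0)
      also have "\<dots> \<le> \<delta> k"
        unfolding \<delta>_def using t \<eta> by (intro powr_mono2) (auto simp: g_def)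
      finally show "diameter (D k) \<le> \<delta> k" .
    qed
    define A where "A k = {w \<in> stopping_words (\<delta> k). word_map S w ` X \<inter> D k \<noteq> {}}" for k
    have AW: "A k \<subseteq> stopping_words (\<delta> k)" for k
      unfolding A_def by blast
    have A1: "finite (A k)" for k
      using AW finite_stopping_words[OF fin \<delta>(1)] finite_subset by blast
    have A2: "A k \<subseteq> lists I" for k
      using AW stopping_words_in_lists by blast
    have "(\<Sum>k. ennreal (sum ?q (A k))) \<le> (\<Sum>k. ennreal B * ennreal (g k))"
    proof (rule suminf_le)
      fix k
      have "sum ?q (A k) \<le> real (card (A k)) * \<delta> k powr t"
        using sum_weight_le_card[OF sum _ AW] t by simp
      also have "\<dots> \<le> B * g k"
        unfolding \<delta>(3) A_def using card_hit[OF \<delta>(1,2) D(2) \<delta>(4)] g_pos[of k]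
        by (intro mult_right_mono) auto
      finally show "ennreal (sum ?q (A k)) \<le> ennreal B * ennreal (g k)"
        using B g_pos[of k] by (simp add: ennreal_leI flip: ennreal_mult)
    qed auto
    also have "\<dots> = ennreal B * (\<Sum>k. ennreal (g k))"
      by simp
    also have "\<dots> \<le> ennreal B * ennreal (2 * \<eta>)"
      using g_sum by (rule mult_left_mono) simp
    also have "\<dots> = ennreal (2 * (B * \<eta>))"
      using B \<eta> by (simp add: mult_ac flip: ennreal_mult)
    also have "\<dots> \<le> ennreal (1 / 2)"
      using \<eta> by (intro ennreal_leI) simp
    also have "\<dots> < 1"
      by (subst ennreal_less_one_iff) simp
    finally have "\<exists>\<gamma>. range \<gamma> \<subseteq> I \<and> (\<forall>k n. map \<gamma> [0..<n] \<notin> A k)"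
      using fin weight_nonneg sum_weight[OF sum] A1 A2 by (intro exists_sequence_avoiding[of I "weight t"])
    then obtain \<gamma> where \<gamma>: "range \<gamma> \<subseteq> I" "\<And>k n. map \<gamma> [0..<n] \<notin> A k"
      by auto
    have inX: "word_map S (map \<gamma> [0..<n]) ` X \<subseteq> X" for n
      using word_X map_upt_in_lists[OF \<gamma>(1)] by blast
    have "(\<Inter>n. word_map S (map \<gamma> [0..<n]) ` X) \<noteq> {}"
    proof (rule compact_nest)
      show "compact (word_map S (map \<gamma> [0..<n]) ` X)" for n
      proof (rule compact_continuous_image[OF _ compact_X])
        have w: "map \<gamma> [0..<n] \<in> lists I"
          using map_upt_in_lists[OF \<gamma>(1)] .
        have "(L * size (map \<gamma> [0..<n]))-lipschitz_on X (word_map S (map \<gamma> [0..<n]))"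
          using word_lipschitz[OF w] L size_pos[OF w] by (intro lipschitz_onI) auto
        then show "continuous_on X (word_map S (map \<gamma> [0..<n]))"
          by (rule lipschitz_on_continuous_on)
      qed
      show "word_map S (map \<gamma> [0..<n]) ` X \<noteq> {}" for n
        using X_nonempty by simp
      show "word_map S (map \<gamma> [0..<n]) ` X \<subseteq> word_map S (map \<gamma> [0..<m]) ` X" if "m \<le> n" for m n
      proof -
        have "map \<gamma> [0..<n] = map \<gamma> [0..<m] @ map \<gamma> [m..<n]"
          using upt_add_eq_append[of 0 m "n - m"] that by (simp flip: map_append)
        moreover have "word_map S (map \<gamma> [m..<n]) ` X \<subseteq> X"
          using \<gamma>(1) by (intro word_X) (simp add: image_subset_iff in_lists_conv_set)
        ultimately show ?thesis
          by (auto simp: word_map_append image_comp[symmetric])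
      qed
    qed
    then obtain x where x: "\<And>n. x \<in> word_map S (map \<gamma> [0..<n]) ` X"
      by auto
    then have "x \<in> limit_set I S X"
      unfolding limit_set_def using \<gamma>(1) by (intro UN_I[of \<gamma>]) auto
    then obtain k where k: "x \<in> D k"
      using D(1) by auto
    obtain n where "map \<gamma> [0..<n] \<in> stopping_words (\<delta> k)"
      using stopping_words_hit[OF \<gamma>(1) \<delta>(1)] by auto
    then have "map \<gamma> [0..<n] \<in> A k"
      unfolding A_def using x[of n] k by blast
    then show False
      using \<gamma>(2) by simp
  qed
  also have "\<dots> \<le> hausdorff_measure t (limit_set I S X)"
    unfolding hausdorff_measure_def by (intro SUP_upper) auto
  finally show ?thesis
    using \<eta> by auto
qed

section \<open>Iterated systems and the critical exponent\<close>

lemma concat_in_lists: "ws \<in> lists W \<Longrightarrow> W \<subseteq> lists I \<Longrightarrow> concat ws \<in> lists I"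
  by (induction ws rule: lists.induct) auto

text \<open>Words over \<open>W\<close> concatenate to words over \<open>I\<close>, so the axioms
  about words carry over literally. Equal lengths make distinct letters incomparable, and
  \<open>1 \<le> n\<close> gives \<open>c ^ n \<le> c\<close>.\<close>

lemma words_conformal_system:
  assumes W: "W \<subseteq> {w \<in> lists I. length w = n}" "W \<noteq> {}" and n: "1 \<le> n"
  shows "conformal_system W (word_map S) X U (size \<circ> concat) K L c \<kappa>"
proof -
  have W': "w \<in> lists I" "length w = n" if "w \<in> W" for w
    using W(1) that by blast+
  have WI: "W \<subseteq> lists I"
    using W'(1) by blast
  note conc = concat_in_lists[OF _ WI]
  show ?thesis
  proof (unfold_locales, goal_cases)
    \<comment> \<open>Goals are numbered in the order of the locale axioms. Those treated separately
      are countability, disjointness, contraction and \<open>size_le\<close>.\<close>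
    case 2
    show ?case
      by (rule countable_subset[OF WI]) (use countable_I in auto)
  next
    case (9 v w)
    have "\<not> prefix v w" "\<not> prefix w v"
      using 9 W'(2)[of v] W'(2)[of w] by (auto simp: prefix_def)
    then show ?case
      using W'(1) 9 by (intro word_disjoint) auto
  next
    case (10 w x y)
    have w: "w \<in> lists I" "length w = n"
      using W' 10 by auto
    have "dist (word_map S w x) (word_map S w y) \<le> c ^ length w * dist x y" if "w \<in> lists I" for w
      using that
    proof (induction w)
      case (Cons i w)
      have "word_map S w x \<in> X" "word_map S w y \<in> X"
        using word_X[OF Cons.hyps(2)] 10 by auto
      then have "dist (S i (word_map S w x)) (S i (word_map S w y)) \<le> c * dist (word_map S w x) (word_map S w y)"
        using S_contraction Cons.hyps by blast
      also have "\<dots> \<le> c * (c ^ length w * dist x y)"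
        using Cons.IH c by simp
      finally show ?case
        by simp
    qed simp
    then have "dist (word_map S w x) (word_map S w y) \<le> c ^ n * dist x y"
      using w by auto
    also have "\<dots> \<le> c * dist x y"
      using c n power_decreasing[of 1 n c] by (intro mult_right_mono) auto
    finally show ?case .
  next
    case (18 ws)
    have "length ws \<le> length (concat ws)"
      using 18
    proof (induction ws)
      case (Cons w ws)
      then show ?case
        using W'(2)[of w] n by simp
    qed simp
    then have "c ^ length (concat ws) \<le> c ^ length ws"
      using c by (intro power_decreasing) auto
    then show ?case
      using size_le[OF conc[OF 18]] by simp
  qed (use W(2) compact_X U_subset U_nonempty word_X word_U word_inj W' c K L \<kappa> size_pos size_Nil
        size_append word_lipschitz word_measure conc
      in \<open>auto simp: word_map_concat simp del: in_lists_conv_set\<close>)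
qed

lemma limit_set_words_subset:
  assumes W: "W \<subseteq> {w \<in> lists I. length w = n}" and n: "1 \<le> n"
  shows "limit_set W (word_map S) X \<subseteq> limit_set I S X"
proof
  fix x assume "x \<in> limit_set W (word_map S) X"
  then obtain \<gamma> where \<gamma>: "range \<gamma> \<subseteq> W"
    and x: "\<And>k. 1 \<le> k \<Longrightarrow> x \<in> word_map S (concat (map \<gamma> [0..<k])) ` X"
    unfolding limit_set_def word_map_concat by auto
  have \<gamma>W: "\<gamma> k \<in> lists I" "length (\<gamma> k) = n" for k
    using \<gamma> W by blast+
  \<comment> \<open>The sequence of blocks of length \<open>n\<close>, read letter by letter. A
    prefix of length \<open>m\<close> is then compared with the prefix made of \<open>m\<close>
    whole blocks, which extends it because \<open>m \<le> n * m\<close>.\<close>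
  define \<beta> where "\<beta> j = \<gamma> (j div n) ! (j mod n)" for j
  have \<beta>I: "range \<beta> \<subseteq> I"
  proof clarify
    fix j
    have "j mod n < length (\<gamma> (j div n))"
      using n \<gamma>W(2) by simp
    then show "\<beta> j \<in> I"
      unfolding \<beta>_def using \<gamma>W(1)[of "j div n"] by (meson in_lists_conv_set nth_mem)
  qed
  have block: "map \<beta> [n * k..<n * k + n] = \<gamma> k" for k
    using n \<gamma>W(2)[of k] by (intro nth_equalityI) (auto simp: \<beta>_def)
  have conc: "concat (map \<gamma> [0..<k]) = map \<beta> [0..<n * k]" for k
  proof (induction k)
    case (Suc k)
    have "[0..<n * Suc k] = [0..<n * k] @ [n * k..<n * k + n]"
      using upt_add_eq_append[of 0 "n * k" n] by (simp add: add.commute)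
    then show ?case
      using Suc block[of k] by simp
  qed simp
  have "x \<in> word_map S (map \<beta> [0..<m]) ` X" if "1 \<le> m" for m
  proof -
    have "m \<le> n * m"
      using n by simp
    then have split: "map \<beta> [0..<n * m] = map \<beta> [0..<m] @ map \<beta> [m..<n * m]"
      using upt_add_eq_append[of 0 m "n * m - m"] by (simp flip: map_append)
    have "map \<beta> [m..<n * m] \<in> lists I"
      using \<beta>I by (simp add: image_subset_iff in_lists_conv_set)
    then have sub: "word_map S (map \<beta> [m..<n * m]) ` X \<subseteq> X"
      by (rule word_X)
    obtain y where y: "y \<in> X" "x = word_map S (map \<beta> [0..<m]) (word_map S (map \<beta> [m..<n * m]) y)"
      using x[OF \<open>1 \<le> m\<close>] unfolding conc split word_map_append by auto
    then have "word_map S (map \<beta> [m..<n * m]) y \<in> X"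
      using sub by blast
    with y(2) show ?thesis
      by blast
  qed
  then show "x \<in> limit_set I S X"
    unfolding limit_set_def using \<beta>I by (intro UN_I[of \<beta>]) auto
qed

section \<open>The Hausdorff dimension as a critical exponent\<close>

abbreviation h :: real where "h \<equiv> hausdorff_dim (limit_set I S X)"

text \<open>Needed because \<open>h\<close> is an infimum of reals. At exponent
  \<open>DIM('a) + 1\<close> one factor \<open>size w \<le> c ^ n\<close> decays with the level,
  while the sums of the remaining powers stay bounded.\<close>

lemma dim_set_nonempty: "{s. 0 < s \<and> hausdorff_measure s (limit_set I S X) = 0} \<noteq> {}"
proof -
  let ?d = "DIM('a)"
  obtain C where C: "\<And>A n. \<lbrakk>finite A; A \<subseteq> {w \<in> lists I. length w = n}\<rbrakk> \<Longrightarrow> (\<Sum>w\<in>A. size w ^ ?d) \<le> C"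
    using sum_size_dim_le by auto
  have "0 \<le> C"
    using C[of "{}" 0] by simp
  have "hausdorff_measure (real ?d + 1) (limit_set I S X) = 0"
  proof (rule hausdorff_measure_limit_set_eq_0)
    fix \<epsilon> :: real and n0 :: nat assume "0 < \<epsilon>"
    have "(\<lambda>n. C * c ^ n) \<longlonglongrightarrow> C * 0"
      using c by (intro tendsto_intros LIMSEQ_power_zero) auto
    then have "\<forall>\<^sub>F n in sequentially. C * c ^ n < \<epsilon> \<and> n0 \<le> n"
      using \<open>0 < \<epsilon>\<close> by (intro eventually_conj order_tendstoD(2) eventually_ge_at_top) auto
    then obtain n where n: "C * c ^ n < \<epsilon>" "n0 \<le> n"
      using eventually_happens by force
    have "(\<Sum>w\<in>A. size w powr (real ?d + 1)) \<le> \<epsilon>"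
      if A: "finite A" "A \<subseteq> {w \<in> lists I. length w = n}" for A
    proof -
      have "(\<Sum>w\<in>A. size w powr (real ?d + 1)) \<le> (\<Sum>w\<in>A. c ^ n * size w ^ ?d)"
      proof (rule sum_mono)
        fix w assume "w \<in> A"
        then have w: "w \<in> lists I" "length w = n"
          using A(2) by blast+
        have "size w powr (real ?d + 1) = size w * size w ^ ?d"
          using size_pos[OF w(1)] by (simp add: powr_add powr_realpow)
        also have "\<dots> \<le> c ^ n * size w ^ ?d"
          using size_le[OF w(1)] w(2) size_pos[OF w(1)] by (intro mult_right_mono) auto
        finally show "size w powr (real ?d + 1) \<le> c ^ n * size w ^ ?d" .
      qed
      also have "\<dots> = c ^ n * (\<Sum>w\<in>A. size w ^ ?d)"
        by (simp add: sum_distrib_left)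
      also have "\<dots> \<le> c ^ n * C"
        using C[OF A] c by (intro mult_left_mono) auto
      finally show ?thesis
        using n(1) by (simp add: mult.commute)
    qed
    then show "\<exists>n\<ge>n0. \<forall>A. finite A \<and> A \<subseteq> {w \<in> lists I. length w = n} \<longrightarrow>
        (\<Sum>w\<in>A. size w powr (real ?d + 1)) \<le> \<epsilon>"
      using n(2) by (intro exI[of _ n]) simp
  qed simp
  then show ?thesis
    by (intro ex_in_conv[THEN iffD1] exI[of _ "real ?d + 1"]) simp
qed

lemma h_nonneg: "0 \<le> h"
  unfolding hausdorff_dim_def using dim_set_nonempty by (intro cInf_greatest) auto

lemma hausdorff_measure_neq_0_below_h:
  assumes "0 < t" "t < h"
  shows "hausdorff_measure t (limit_set I S X) \<noteq> 0"
proof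
  assume "hausdorff_measure t (limit_set I S X) = 0"
  then have "h \<le> t"
    unfolding hausdorff_dim_def using assms(1) by (intro cInf_lower bdd_belowI[of _ 0]) auto
  with assms(2) show False
    by simp
qed

text \<open>Otherwise the words of \<open>A\<close>, taken as an alphabet, satisfy the mass
  distribution hypothesis at \<open>t\<close>, and also at every smaller positive exponent since
  \<open>size w / K \<le> 1\<close>. Their limit set lies in the full one, so no exponent below
  \<open>t\<close> gives measure zero, forcing \<open>t \<le> h\<close>.\<close>

lemma sum_size_powr_le_above_h:
  assumes t: "h < t" and A: "finite A" "A \<subseteq> {w \<in> lists I. length w = n}"
  shows "(\<Sum>w\<in>A. size w powr t) \<le> K powr t"
proof (rule ccontr)
  assume not: "\<not> ?thesis"
  have t0: "0 < t"
    using h_nonneg t by simp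
  have A': "w \<in> lists I" "length w = n" if "w \<in> A" for w
    using A(2) that by blast+
  have pos: "0 < size w" if "w \<in> A" for w
    using size_pos[OF A'(1)] that by simp
  have le1: "size w / K \<le> 1" if "w \<in> A" for w
    using size_le_1[OF A'(1)[OF that]] K by (simp add: divide_le_eq)
  have "(\<Sum>w\<in>A. (size w / K) powr t) = (\<Sum>w\<in>A. size w powr t) / K powr t"
    using pos K by (simp add: sum_divide_distrib powr_divide less_imp_le)
  then have gt: "1 < (\<Sum>w\<in>A. (size w / K) powr t)"
    using not K by (simp add: less_divide_eq)
  have "A \<noteq> {}"
    using gt by auto
  \<comment> \<open>At level 0 there is only the empty word, whose contribution cannot exceed
    1.\<close>
  have n: "1 \<le> n"
  proof (rule ccontr)
    assume "\<not> 1 \<le> n"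
    then have "length w = 0" if "w \<in> A" for w
      using A'(2)[OF that] by simp
    then have "A \<subseteq> {[]}"
      by auto
    then have "A = {[]}"
      using \<open>A \<noteq> {}\<close> by blast
    then have "(1 / K) powr t > 1"
      using gt by (simp add: size_Nil)
    moreover have "(1 / K) powr t \<le> 1"
      using K t0 by (intro powr_le1) auto
    ultimately show False
      by simp
  qed
  interpret W: conformal_system A "word_map S" X U "size \<circ> concat" K L c \<kappa>
    using words_conformal_system[OF A(2) \<open>A \<noteq> {}\<close> n] .
  have "t \<le> s" if s: "0 < s" "hausdorff_measure s (limit_set I S X) = 0" for s
  proof (rule ccontr)
    assume "\<not> t \<le> s"
    have "(\<Sum>w\<in>A. (size w / K) powr t) \<le> (\<Sum>w\<in>A. (size w / K) powr s)"
      using pos le1 K \<open>\<not> t \<le> s\<close> by (intro sum_mono powr_mono') (auto simp: less_imp_le)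
    with gt have "1 \<le> (\<Sum>w\<in>A. ((size \<circ> concat) [w] / K) powr s)"
      by simp
    then have "hausdorff_measure s (limit_set A (word_map S) X) \<noteq> 0"
      by (rule W.hausdorff_measure_limit_set_neq_0[OF A(1) s(1)])
    moreover have "hausdorff_measure s (limit_set A (word_map S) X) \<le> hausdorff_measure s (limit_set I S X)"
      by (rule hausdorff_measure_mono[OF limit_set_words_subset[OF A(2) n]])
    ultimately show False
      using s(2) by simp
  qed
  then have "t \<le> h"
    unfolding hausdorff_dim_def using dim_set_nonempty by (intro cInf_greatest) auto
  with t show False
    by simp
qed

text \<open>For \<open>s\<close> strictly between \<open>h\<close> and \<open>t\<close>, exponent
  \<open>s\<close> keeps each level sum below \<open>K powr s\<close>, and the surplus
  \<open>t - s\<close> yields geometric decay in the level.\<close>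

lemma sum_size_powr_bounded_above_h:
  assumes t: "h < t"
  obtains M where "0 < M" "\<And>A. \<lbrakk>finite A; A \<subseteq> lists I\<rbrakk> \<Longrightarrow> (\<Sum>w\<in>A. size w powr t) \<le> M"
proof -
  obtain s where s: "h < s" "s < t"
    using t dense by blast
  define q where "q = c powr (t - s)"
  have q: "0 < q" "q < 1"
    using c s powr_less_mono2[of "t - s" c 1] by (auto simp: q_def)
  have "(\<Sum>w\<in>A. size w powr t) \<le> K powr s * (1 / (1 - q))" if A: "finite A" "A \<subseteq> lists I" for A
  proof -
    have A': "w \<in> lists I" if "w \<in> A" for w
      using A(2) that by blast
    obtain N where N: "\<And>w. w \<in> A \<Longrightarrow> length w < N"
      using finite_nat_set_iff_bounded[of "length ` A"] A(1) by auto
    have "(\<Sum>w\<in>A. size w powr t) \<le> (\<Sum>w\<in>A. q ^ length w * size w powr s)"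
    proof (rule sum_mono)
      fix w assume w: "w \<in> A"
      have "size w powr t = size w powr (t - s) * size w powr s"
        by (simp flip: powr_add)
      also have "\<dots> \<le> (c ^ length w) powr (t - s) * size w powr s"
        using size_le[OF A'[OF w]] size_pos[OF A'[OF w]] s by (intro mult_right_mono powr_mono2) auto
      also have "(c ^ length w) powr (t - s) = q ^ length w"
        using c by (simp add: q_def powr_powr mult.commute flip: powr_realpow)
      finally show "size w powr t \<le> q ^ length w * size w powr s" .
    qed
    also have "\<dots> = (\<Sum>n<N. \<Sum>w\<in>{w\<in>A. length w = n}. q ^ length w * size w powr s)"
      using A(1) N by (intro sum.group[symmetric]) auto
    also have "\<dots> = (\<Sum>n<N. q ^ n * (\<Sum>w\<in>{w\<in>A. length w = n}. size w powr s))"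
      by (simp add: sum_distrib_left)
    also have "\<dots> \<le> (\<Sum>n<N. q ^ n * K powr s)"
    proof (intro sum_mono mult_left_mono)
      fix n
      have "{w\<in>A. length w = n} \<subseteq> {w \<in> lists I. length w = n}"
        using A(2) by blast
      then show "(\<Sum>w\<in>{w\<in>A. length w = n}. size w powr s) \<le> K powr s"
        using A(1) by (intro sum_size_powr_le_above_h[OF s(1)]) auto
    qed (use q in auto)
    also have "\<dots> = K powr s * (\<Sum>n<N. q ^ n)"
      by (simp add: sum_distrib_left mult.commute)
    also have "\<dots> \<le> K powr s * (1 / (1 - q))"
      using q sum_le_suminf[of "\<lambda>n. q ^ n" "{..<N}"] suminf_geometric[of q] summable_geometric[of q]
      by (intro mult_left_mono) auto
    finally show ?thesis .
  qed
  moreover have "0 < K powr s * (1 / (1 - q))"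
    using K q by simp
  ultimately show ?thesis
    using that by auto
qed

lemma words_sum_ge_below_h:
  assumes t: "0 \<le> t" "t < h \<or> t = 0"
  obtains A n where "1 \<le> n" "finite A" "A \<subseteq> {w \<in> lists I. length w = n}"
    "1 \<le> (\<Sum>w\<in>A. (size w / K) powr t)"
proof (cases "t = 0")
  case True
  obtain i where "i \<in> I"
    using I_nonempty by blast
  then show ?thesis
    using that[of 1 "{[i]}"] True size_pos[of "[i]"] K by simp
next
  case False
  then obtain s where s: "t < s" "s < h"
    using t dense by blast
  have "hausdorff_measure s (limit_set I S X) \<noteq> 0"
    using s t by (intro hausdorff_measure_neq_0_below_h) auto
  define small where "small \<epsilon> n0 \<longleftrightarrow> (\<exists>n\<ge>n0. \<forall>A. finite A \<and> A \<subseteq> {w \<in> lists I. length w = n} \<longrightarrow>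
                  (\<Sum>w\<in>A. size w powr s) \<le> \<epsilon>)" for \<epsilon> n0
  have "\<not> (\<forall>\<epsilon>>0. \<forall>n0. small \<epsilon> n0)"
  proof
    assume all: "\<forall>\<epsilon>>0. \<forall>n0. small \<epsilon> n0"
    have "hausdorff_measure s (limit_set I S X) = 0"
    proof (rule hausdorff_measure_limit_set_eq_0)
      fix \<epsilon> :: real and n0 assume "0 < \<epsilon>"
      then have "small \<epsilon> n0"
        using all by simp
      then show "\<exists>n\<ge>n0. \<forall>A. finite A \<and> A \<subseteq> {w \<in> lists I. length w = n} \<longrightarrow>
                  (\<Sum>w\<in>A. size w powr s) \<le> \<epsilon>"
        unfolding small_def .
    qed (use s t in simp)
    with \<open>hausdorff_measure s _ \<noteq> 0\<close> show False
      by simp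
  qed
  then obtain \<epsilon> n0 where \<epsilon>: "0 < \<epsilon>" and "\<not> small \<epsilon> n0"
    by auto
  then have big: "\<exists>A. (finite A \<and> A \<subseteq> {w \<in> lists I. length w = n}) \<and> \<not> (\<Sum>w\<in>A. size w powr s) \<le> \<epsilon>"
    if "n \<ge> n0" for n
    unfolding small_def using that by simp
  define q where "q = c powr (s - t)"
  have q: "0 < q" "q < 1"
    using c s powr_less_mono2[of "s - t" c 1] by (auto simp: q_def)
  have "(\<lambda>n. K powr t * q ^ n) \<longlonglongrightarrow> K powr t * 0"
    using q by (intro tendsto_intros LIMSEQ_power_zero) auto
  then have "\<forall>\<^sub>F n in sequentially. K powr t * q ^ n < \<epsilon> \<and> max 1 n0 \<le> n"
    using \<epsilon> by (intro eventually_conj order_tendstoD(2) eventually_ge_at_top) auto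
  then obtain n where n: "K powr t * q ^ n < \<epsilon>" "1 \<le> n" "n0 \<le> n"
    using eventually_happens by force
  from big[OF n(3)] obtain A where A: "finite A" "A \<subseteq> {w \<in> lists I. length w = n}"
    "\<not> (\<Sum>w\<in>A. size w powr s) \<le> \<epsilon>"
    by (elim exE conjE)
  have A': "w \<in> lists I" "length w = n" if "w \<in> A" for w
    using A(2) that by blast+
  have pos: "0 < size w" if "w \<in> A" for w
    using size_pos[OF A'(1)] that by simp
  have "(\<Sum>w\<in>A. size w powr s) \<le> (\<Sum>w\<in>A. q ^ n * size w powr t)"
  proof (rule sum_mono)
    fix w assume w: "w \<in> A"
    have "size w powr s = size w powr (s - t) * size w powr t"
      by (simp flip: powr_add)
    also have "\<dots> \<le> (c ^ n) powr (s - t) * size w powr t"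
      using size_le[OF A'(1)[OF w]] pos[OF w] A'(2)[OF w] s by (intro mult_right_mono powr_mono2) auto
    also have "(c ^ n) powr (s - t) = q ^ n"
      using c by (simp add: q_def powr_powr mult.commute flip: powr_realpow)
    finally show "size w powr s \<le> q ^ n * size w powr t" .
  qed
  also have "\<dots> = q ^ n * (\<Sum>w\<in>A. size w powr t)"
    by (simp add: sum_distrib_left)
  finally have "q ^ n * K powr t < q ^ n * (\<Sum>w\<in>A. size w powr t)"
    using n(1) A(3) by (simp add: mult.commute)
  then have "K powr t < (\<Sum>w\<in>A. size w powr t)"
    using q by simp
  moreover have "(\<Sum>w\<in>A. (size w / K) powr t) = (\<Sum>w\<in>A. size w powr t) / K powr t"
    using pos K by (simp add: sum_divide_distrib powr_divide less_imp_le)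
  ultimately have "1 \<le> (\<Sum>w\<in>A. (size w / K) powr t)"
    using K by (simp add: le_divide_eq)
  then show ?thesis
    using that[OF n(2) A(1,2)] by simp
qed

section \<open>Covering the limit set\<close>

text \<open>These are the stopping words of a finite subsystem with large sum at \<open>t\<close>.
  The constant \<open>c0\<close> depends on that subsystem, hence on \<open>t\<close>, but not on
  \<open>\<delta>\<close>.\<close>

lemma disjoint_words_below_h:
  assumes t: "0 \<le> t" "t < h \<or> t = 0"
  obtains c0 where "0 < c0"
    "\<And>\<delta>. \<lbrakk>0 < \<delta>; \<delta> \<le> 1\<rbrakk> \<Longrightarrow> \<exists>A. finite A \<and> A \<subseteq> lists I \<and>
       (\<forall>v\<in>A. \<forall>w\<in>A. v \<noteq> w \<longrightarrow> word_map S v ` U \<inter> word_map S w ` U = {}) \<and>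
       (\<forall>w\<in>A. c0 * \<delta> \<le> size w \<and> size w \<le> \<delta>) \<and> 1 \<le> real (card A) * \<delta> powr t"
proof -
  obtain W n where n: "1 \<le> n" and W: "finite W" "W \<subseteq> {w \<in> lists I. length w = n}"
    and sum: "1 \<le> (\<Sum>w\<in>W. (size w / K) powr t)"
    by (rule words_sum_ge_below_h[OF t])
  have "W \<noteq> {}"
    using sum by auto
  have WI: "W \<subseteq> lists I"
    using W(2) by blast
  interpret W: conformal_system W "word_map S" X U "size \<circ> concat" K L c \<kappa>
    using words_conformal_system[OF W(2) \<open>W \<noteq> {}\<close> n] .
  have Wsum: "1 \<le> (\<Sum>w\<in>W. ((size \<circ> concat) [w] / K) powr t)"
    using sum by simp
  have "\<exists>A. finite A \<and> A \<subseteq> lists I \<and>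
       (\<forall>v\<in>A. \<forall>w\<in>A. v \<noteq> w \<longrightarrow> word_map S v ` U \<inter> word_map S w ` U = {}) \<and>
       (\<forall>w\<in>A. W.stopping_const * \<delta> \<le> size w \<and> size w \<le> \<delta>) \<and> 1 \<le> real (card A) * \<delta> powr t"
    if \<delta>: "0 < \<delta>" "\<delta> \<le> 1" for \<delta>
  proof (intro exI[of _ "concat ` W.stopping_words \<delta>"] conjI)
    have in_W: "v \<in> lists W" if "v \<in> W.stopping_words \<delta>" for v
      using W.stopping_words_in_lists that by blast
    have disj: "word_map S (concat v) ` U \<inter> word_map S (concat w) ` U = {}"
      if "v \<in> W.stopping_words \<delta>" "w \<in> W.stopping_words \<delta>" "v \<noteq> w" for v w
      using W.stopping_words_disjoint[OF that] by (simp add: word_map_concat)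
    \<comment> \<open>Two stopping words with the same concatenation would have a non-empty image of
      \<open>U\<close> disjoint from itself, so \<open>concat\<close> is injective on them.\<close>
    have ne: "word_map S (concat v) ` U \<inter> word_map S (concat v) ` U \<noteq> {}" for v
      using U_nonempty by simp
    have inj: "inj_on concat (W.stopping_words \<delta>)"
    proof (rule inj_onI, rule ccontr)
      fix v w assume vw: "v \<in> W.stopping_words \<delta>" "w \<in> W.stopping_words \<delta>" "concat v = concat w" "v \<noteq> w"
      show False
        using disj[OF vw(1,2,4)] ne[of w] unfolding vw(3) by simp
    qed
    show "finite (concat ` W.stopping_words \<delta>)"
      using W.finite_stopping_words[OF W(1) \<delta>(1)] by simp
    show "concat ` W.stopping_words \<delta> \<subseteq> lists I"
      using concat_in_lists[OF in_W WI] by blast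
    show "\<forall>v\<in>concat ` W.stopping_words \<delta>. \<forall>w\<in>concat ` W.stopping_words \<delta>.
        v \<noteq> w \<longrightarrow> word_map S v ` U \<inter> word_map S w ` U = {}"
    proof (intro ballI impI)
      fix v w assume "v \<in> concat ` W.stopping_words \<delta>" "w \<in> concat ` W.stopping_words \<delta>" and "v \<noteq> w"
      then obtain v' w' where vw: "v' \<in> W.stopping_words \<delta>" "w' \<in> W.stopping_words \<delta>" "v = concat v'" "w = concat w'"
        by (elim imageE)
      then have "v' \<noteq> w'"
        using \<open>v \<noteq> w\<close> by auto
      then show "word_map S v ` U \<inter> word_map S w ` U = {}"
        using disj vw by simp
    qed
    show "\<forall>w\<in>concat ` W.stopping_words \<delta>. W.stopping_const * \<delta> \<le> size w \<and> size w \<le> \<delta>"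
    proof
      fix w assume "w \<in> concat ` W.stopping_words \<delta>"
      then obtain w' where w': "w' \<in> W.stopping_words \<delta>" "w = concat w'"
        by (elim imageE)
      then have "size w \<le> \<delta>"
        unfolding W.stopping_words_def by simp
      then show "W.stopping_const * \<delta> \<le> size w \<and> size w \<le> \<delta>"
        using W.stopping_words_size_ge[OF W(1) \<delta>(2,1) w'(1)] w'(2) by simp
    qed
    show "1 \<le> real (card (concat ` W.stopping_words \<delta>)) * \<delta> powr t"
      using W.card_stopping_words_ge[OF W(1) t(1) Wsum \<delta>(1)] by (simp add: card_image[OF inj])
  qed
  then show ?thesis
    by (rule that[OF W.stopping_const_pos[OF W(1)]])
qed

text \<open>\<open>C\<close> is independent of \<open>\<rho>\<close> so that
  \<open>\<rho> = r powr \<theta>\<close> can later be used for all \<open>\<theta>\<close>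
  simultaneously.\<close>

lemma covering_number_limit_set_ge:
  assumes t: "0 \<le> t" "t < h \<or> t = 0"
  obtains C where "0 < C"
    "\<And>r \<rho> F. \<lbrakk>0 < r; r \<le> \<rho>; \<rho> \<le> 1; F \<subseteq> limit_set I S X\<rbrakk> \<Longrightarrow>
       (\<rho> / r) powr t * real (covering_number \<rho> F) \<le> C * real (covering_number r (limit_set I S X))"
proof -
  let ?\<Lambda> = "limit_set I S X" and ?d = "DIM('a)"
  obtain c0 where c0: "0 < c0" and
    ex: "\<And>\<delta>. \<lbrakk>0 < \<delta>; \<delta> \<le> 1\<rbrakk> \<Longrightarrow> \<exists>A. finite A \<and> A \<subseteq> lists I \<and>
       (\<forall>v\<in>A. \<forall>w\<in>A. v \<noteq> w \<longrightarrow> word_map S v ` U \<inter> word_map S w ` U = {}) \<and>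
       (\<forall>w\<in>A. c0 * \<delta> \<le> size w \<and> size w \<le> \<delta>) \<and> 1 \<le> real (card A) * \<delta> powr t"
    using disjoint_words_below_h[OF t] by metis
  define C where "C = packing_const / c0 ^ ?d"
  have C: "0 < C"
    using packing_const_pos c0 by (simp add: C_def)
  have "(\<rho> / r) powr t * real (covering_number \<rho> F) \<le> C * real (covering_number r ?\<Lambda>)"
    if r: "0 < r" "r \<le> \<rho>" "\<rho> \<le> 1" and F: "F \<subseteq> ?\<Lambda>" for r \<rho> F
  proof -
    \<comment> \<open>With words of size about \<open>\<delta>\<close>, points separated by
      \<open>\<rho>\<close> yield pieces at scale \<open>\<delta> * \<rho> = r\<close>.\<close>
    define \<delta> where "\<delta> = r / \<rho>"
    have \<delta>: "0 < \<delta>" "\<delta> \<le> 1" "\<delta> * \<rho> = r"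
      using r by (auto simp: \<delta>_def)
    from ex[OF \<delta>(1,2)] obtain A where A: "finite A" "A \<subseteq> lists I"
      "\<forall>v\<in>A. \<forall>w\<in>A. v \<noteq> w \<longrightarrow> word_map S v ` U \<inter> word_map S w ` U = {}"
      "\<forall>w\<in>A. c0 * \<delta> \<le> size w \<and> size w \<le> \<delta>" "1 \<le> real (card A) * \<delta> powr t"
      by (elim exE conjE)
    have "bounded F"
      using bounded_limit_set F bounded_subset by blast
    moreover have "0 < \<rho>"
      using r by simp
    ultimately obtain Y where Y: "finite Y" "Y \<subseteq> F" "\<And>x y. \<lbrakk>x \<in> Y; y \<in> Y; x \<noteq> y\<rbrakk> \<Longrightarrow> \<rho> \<le> dist x y"
      "covering_number \<rho> F \<le> card Y"
      using separated_subset_covering_number[of F \<rho>] by auto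
    have YX: "Y \<subseteq> X"
      using Y(2) F limit_set_subset by auto
    define P where "P = A \<times> Y"
    have P: "separated_pairs \<rho> P'" if "P' \<subseteq> P" for P'
      unfolding separated_pairs_def
    proof (intro conjI)
      show "finite P'"
        using that A(1) Y(1) unfolding P_def by (metis finite_SigmaI finite_subset)
      show "P' \<subseteq> lists I \<times> X"
        using that A(2) YX unfolding P_def by blast
      show "\<forall>(v, x)\<in>P'. \<forall>(w, y)\<in>P'. (v, x) \<noteq> (w, y) \<longrightarrow>
        (if v = w then \<rho> \<le> dist x y else word_map S v ` U \<inter> word_map S w ` U = {})"
      proof (intro ballI case_prodI2 impI)
        fix p v x q w y assume "p \<in> P'" "p = (v, x)" "q \<in> P'" "q = (w, y)" and vw: "(v, x) \<noteq> (w, y)"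
        then have "v \<in> A" "w \<in> A" "x \<in> Y" "y \<in> Y"
          using that unfolding P_def by blast+
        then show "if v = w then \<rho> \<le> dist x y else word_map S v ` U \<inter> word_map S w ` U = {}"
          using A(3) Y(3)[of x y] vw by simp
      qed
    qed
    obtain B where B: "finite B" "card B = covering_number r ?\<Lambda>" "?\<Lambda> \<subseteq> (\<Union>b\<in>B. ball b r)"
      using covering_number_cover[OF bounded_limit_set r(1)] by auto
    define Q where "Q b = {(w, y) \<in> P. word_map S w y \<in> ball b r}" for b
    have card_Q: "real (card (Q b)) \<le> C" for b
    proof -
      have "separated_pairs \<rho> (Q b)"
        by (rule P) (auto simp: Q_def)
      then have "real (card (Q b)) * (c0 * r) ^ ?d \<le> packing_const * r ^ ?d"
      proof (rule separated_pairs_card_le[where z = b])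
        fix w y assume "(w, y) \<in> Q b"
        then have w: "w \<in> A" "word_map S w y \<in> ball b r"
          unfolding Q_def P_def by auto
        then have "c0 * \<delta> * \<rho> \<le> size w * \<rho>" "size w * \<rho> \<le> \<delta> * \<rho>"
          using A(4) r by (auto intro!: mult_right_mono)
        then show "c0 * r \<le> size w * \<rho> \<and> size w * \<rho> \<le> r \<and> word_map S w y \<in> cball b r"
          using w(2) \<delta>(3) by (simp add: mult.assoc)
      qed (use r c0 in auto)
      then show ?thesis
        using r c0 unfolding C_def by (simp add: power_mult_distrib field_simps)
    qed
    have "P \<subseteq> (\<Union>b\<in>B. Q b)"
    proof clarify
      fix w y assume wy: "(w, y) \<in> P"
      then have "w \<in> lists I" "y \<in> ?\<Lambda>"
        using A(2) Y(2) F unfolding P_def by blast+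
      then have "word_map S w y \<in> ?\<Lambda>"
        by (rule limit_set_word)
      then obtain b where "b \<in> B" "word_map S w y \<in> ball b r"
        using B(3) by auto
      then show "(w, y) \<in> (\<Union>b\<in>B. Q b)"
        using wy unfolding Q_def by auto
    qed
    moreover have "finite (\<Union>b\<in>B. Q b)"
      using B(1) A(1) Y(1) unfolding Q_def P_def by (intro finite_UN_I) (auto intro: finite_subset[of _ "A \<times> Y"])
    ultimately have "card P \<le> card (\<Union>b\<in>B. Q b)"
      by (intro card_mono)
    also have "\<dots> \<le> (\<Sum>b\<in>B. card (Q b))"
      using B(1) by (rule card_UN_le)
    finally have "real (card P) \<le> (\<Sum>b\<in>B. real (card (Q b)))"
      by (metis of_nat_le_iff of_nat_sum)
    also have "\<dots> \<le> (\<Sum>b\<in>B. C)"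
      using card_Q by (intro sum_mono)
    also have "\<dots> = C * real (covering_number r ?\<Lambda>)"
      by (simp add: B(2))
    finally have card_P: "real (card A) * real (card Y) \<le> C * real (covering_number r ?\<Lambda>)"
      unfolding P_def card_cartesian_product of_nat_mult .
    have "(\<rho> / r) powr t * \<delta> powr t = 1"
      using r by (simp add: \<delta>_def powr_divide)
    then have "(\<rho> / r) powr t \<le> (\<rho> / r) powr t * \<delta> powr t * real (card A)"
      using A(5) mult_left_mono[OF A(5), of "(\<rho> / r) powr t"] by (simp add: mult_ac)
    then have "(\<rho> / r) powr t \<le> real (card A)"
      using \<open>(\<rho> / r) powr t * \<delta> powr t = 1\<close> by simp
    then have "(\<rho> / r) powr t * real (covering_number \<rho> F) \<le> real (card A) * real (card Y)"
      using Y(4) by (intro mult_mono) auto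
    with card_P show ?thesis
      by simp
  qed
  then show ?thesis
    by (rule that[OF C])
qed

section \<open>Upper bound for the covering number\<close>

text \<open>Markov's inequality for counting measure. The bound on all finite subsets also gives
  finiteness, whatever the size of the alphabet.\<close>

lemma finite_words_size_gt:
  assumes M: "\<And>A. \<lbrakk>finite A; A \<subseteq> lists I\<rbrakk> \<Longrightarrow> (\<Sum>w\<in>A. size w powr t) \<le> M" and pos: "0 < a" "0 < t"
  shows "finite {w \<in> lists I. a < size w}" "real (card {w \<in> lists I. a < size w}) \<le> M / a powr t"
proof -
  let ?W = "{w \<in> lists I. a < size w}"
  have bound: "real (card A) \<le> M / a powr t" if A: "finite A" "A \<subseteq> ?W" for A
  proof -
    have "real (card A) * a powr t = (\<Sum>w\<in>A. a powr t)"
      by simp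
    also have "\<dots> \<le> (\<Sum>w\<in>A. size w powr t)"
    proof (rule sum_mono)
      fix w assume "w \<in> A"
      then have "a < size w"
        using A(2) by blast
      then show "a powr t \<le> size w powr t"
        using pos by (intro powr_mono2) auto
    qed
    also have "\<dots> \<le> M"
      using A by (intro M) auto
    finally show ?thesis
      using pos(1) by (simp add: field_simps)
  qed
  show fin: "finite ?W"
  proof (rule ccontr)
    assume inf: "infinite ?W"
    obtain n :: nat where "M / a powr t < real n"
      using reals_Archimedean2 by blast
    moreover from infinite_arbitrarily_large[OF inf, of n] obtain A
      where "finite A" "card A = n" "A \<subseteq> ?W"
      by (elim exE conjE)
    ultimately show False
      using bound[of A] by simp
  qed
  show "real (card ?W) \<le> M / a powr t"
    by (rule bound[OF fin order_refl])
qed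

text \<open>The word \<open>w\<close> is the stopping prefix of \<open>x\<close> without its last
  letter \<open>i\<close>. The point \<open>y\<close> and the fixed point \<open>p\<close> both lie
  in the image of \<open>X\<close> under \<open>S i\<close>, whose diameter is controlled by
  \<open>size [i] \<le> K * (r / size w)\<close>.\<close>

lemma limit_set_point_near_fixed_point:
  assumes x: "x \<in> limit_set I S X" and r: "0 < r" "r < 1"
  obtains w y p where "w \<in> lists I" "r < size w" "y \<in> X" "x = word_map S w y" "p \<in> fixed_points I S X"
    "dist p y \<le> L * K * diameter X * (r / size w)"
proof -
  obtain \<gamma> where \<gamma>: "range \<gamma> \<subseteq> I" "\<And>n. x \<in> word_map S (map \<gamma> [0..<n]) ` X"
    using x by (rule limit_setE) (rule that)
  obtain n where n: "map \<gamma> [0..<n] \<in> stopping_words r"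
    using stopping_words_hit[OF \<gamma>(1) r(1)] by auto
  then have "size (map \<gamma> [0..<n]) \<le> r"
    unfolding stopping_words_def by simp
  \<comment> \<open>The empty word has size 1, above \<open>r\<close>, so the stopping prefix has a
    last letter.\<close>
  then have "n \<noteq> 0"
    using r size_Nil by (intro notI) simp
  then obtain m where m: "n = Suc m"
    by (cases n) auto
  define w i where "w = map \<gamma> [0..<m]" and "i = \<gamma> m"
  have wi: "map \<gamma> [0..<n] = w @ [i]"
    by (simp add: m w_def i_def)
  have w: "w \<in> lists I" and i: "i \<in> I"
    using map_upt_in_lists[OF \<gamma>(1)] \<gamma>(1) by (auto simp: w_def i_def simp del: in_lists_conv_set)
  have "strict_prefix w (w @ [i])"
    by (simp add: strict_prefix_def)
  then have size_w: "r < size w"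
    using n unfolding stopping_words_def wi by simp
  have "size w * size [i] \<le> K * size (w @ [i])"
    using w i by (intro size_append) auto
  also have "\<dots> \<le> K * r"
    using \<open>size (map \<gamma> [0..<n]) \<le> r\<close> K unfolding wi by simp
  finally have size_i: "size [i] \<le> K * (r / size w)"
    using size_w r by (simp add: field_simps)
  obtain y' where y': "y' \<in> X" "x = word_map S w (S i y')"
    using \<gamma>(2)[of n] unfolding wi word_map_append by auto
  obtain p where p: "p \<in> X" "S i p = p"
    using fixed_point_exists[OF i] by auto
  have "dist p (S i y') = dist (word_map S [i] p) (word_map S [i] y')"
    by (simp add: p)
  also have "\<dots> \<le> L * size [i] * dist p y'"
    using i p y' by (intro word_lipschitz) auto
  also have "\<dots> \<le> L * (K * (r / size w)) * diameter X"
    using L K r size_w size_i p y' compact_X size_pos[of "[i]"] i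
    by (intro mult_mono diameter_bounded_bound) (auto simp: compact_imp_bounded)
  finally have "dist p (S i y') \<le> L * K * diameter X * (r / size w)"
    by (simp add: mult_ac)
  moreover have "S i y' \<in> X"
    using S_X[OF i] y'(1) by auto
  moreover have "p \<in> fixed_points I S X"
    using p i unfolding fixed_points_def by auto
  ultimately show ?thesis
    using that w size_w y'(2) by blast
qed

text \<open>\<open>B\<close> bounds the contribution of each dyadic scale
  \<open>\<rho> = r * 2 ^ k\<close>: the power of \<open>\<rho> / r\<close> counts words and the
  covering number counts balls for \<open>F\<close>. The logarithmic factor is the number of
  scales.\<close>

lemma covering_number_limit_set_le:
  assumes t: "h < t"
  obtains C where "0 < C"
    "\<And>r B. \<lbrakk>0 < r; r < 1; \<And>\<rho>. \<lbrakk>r \<le> \<rho>; \<rho> < 1\<rbrakk> \<Longrightarrow> (\<rho> / r) powr t * real (covering_number \<rho> (fixed_points I S X)) \<le> B\<rbrakk> \<Longrightarrow>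
       real (covering_number r (limit_set I S X)) \<le> C * (1 + ln (1 / r) / ln 2) * B"
proof -
  let ?\<Lambda> = "limit_set I S X" and ?F = "fixed_points I S X"
  have t0: "0 < t"
    using h_nonneg t by simp
  obtain M where M: "0 < M" "\<And>A. \<lbrakk>finite A; A \<subseteq> lists I\<rbrakk> \<Longrightarrow> (\<Sum>w\<in>A. size w powr t) \<le> M"
    using sum_size_powr_bounded_above_h[OF t] by auto
  \<comment> \<open>In units of \<open>r * 2 ^ k\<close>: 1 is the radius of the balls covering
    \<open>F\<close>, the rest is the distance to the fixed point, using
    \<open>r / size w \<le> 2 * (r * 2 ^ k)\<close>.\<close>
  define D where "D = 1 + 2 * (L * K * diameter X)"
  have D: "0 < D"
    using L K compact_X by (auto simp: D_def compact_imp_bounded diameter_ge_0 intro!: add_pos_nonneg)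
  from cball_covered_by_small_balls[of "2 * L * D"] obtain M' where M': "\<forall>r>0. \<forall>z::'a. \<exists>A. finite A \<and> card A \<le> M' \<and> cball z (2 * L * D * r) \<subseteq> (\<Union>a\<in>A. ball a r)"
    by (elim exE)
  \<comment> \<open>The first two factors bound the number of words at one scale up to
    \<open>(2 ^ k) powr t\<close>; the summand 1 keeps \<open>C\<close> positive even for
    \<open>M' = 0\<close>.\<close>
  define C where "C = M * 2 powr t * (real M' + 1)"
  have "0 < C"
    using M by (simp add: C_def)
  moreover have "real (covering_number r ?\<Lambda>) \<le> C * (1 + ln (1 / r) / ln 2) * B"
    if r: "0 < r" "r < 1" and B: "\<And>\<rho>. \<lbrakk>r \<le> \<rho>; \<rho> < 1\<rbrakk> \<Longrightarrow> (\<rho> / r) powr t * real (covering_number \<rho> ?F) \<le> B" for r B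
  proof -
    \<comment> \<open>Only these scales occur, since \<open>r < size w\<close> and
      \<open>size w \<le> (1 / 2) ^ k\<close> imply \<open>r * 2 ^ k < 1\<close>.\<close>
    define kk where "kk = {k::nat. r * 2 ^ k < 1}"
    have kk_le: "real k \<le> ln (1 / r) / ln 2" if "k \<in> kk" for k
    proof -
      have "r * 2 ^ k < 1"
        using that by (simp add: kk_def)
      then have "2 ^ k \<le> 1 / r"
        using r by (simp add: field_simps)
      then have "ln (2 ^ k) \<le> ln (1 / r)"
        using r by (subst ln_le_cancel_iff) auto
      then show ?thesis
        by (simp add: ln_realpow field_simps)
    qed
    have ln_r: "0 \<le> ln (1 / r) / ln 2"
      using r by simp
    have kk_sub: "kk \<subseteq> {..nat \<lfloor>ln (1 / r) / ln 2\<rfloor>}"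
      using kk_le by (auto simp: le_nat_floor)
    have fin_kk: "finite kk"
      using kk_sub finite_subset by blast
    have card_kk: "real (card kk) \<le> 1 + ln (1 / r) / ln 2"
    proof -
      have "card kk \<le> Suc (nat \<lfloor>ln (1 / r) / ln 2\<rfloor>)"
        using card_mono[OF _ kk_sub] by simp
      then show ?thesis
        using ln_r by linarith
    qed
    define W where "W k = {w \<in> lists I. (1 / 2) ^ Suc k < size w}" for k :: nat
    define W' where "W' k = {w \<in> W k. size w \<le> (1 / 2) ^ k}" for k :: nat
    have fin_W: "finite (W k)" and card_W: "real (card (W k)) \<le> M / ((1 / 2) ^ Suc k) powr t" for k
      unfolding W_def using finite_words_size_gt[OF M(2) _ t0, of "(1 / 2) ^ Suc k"] by auto
    have fin_W': "finite (W' k)" for k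
      unfolding W'_def using fin_W by simp
    have "card (W' k) \<le> card (W k)" for k
      unfolding W'_def by (intro card_mono fin_W) auto
    have card_W': "real (card (W' k)) \<le> M * 2 powr t * (2 ^ k) powr t" for k
    proof -
      have "((1 / 2) ^ Suc k) powr t * (2 powr t * (2 ^ k) powr t) = (1::real)"
        by (simp add: power_one_over powr_divide powr_mult)
      then have "M / ((1 / 2) ^ Suc k) powr t = M * (2 powr t * (2 ^ k) powr t)"
        by (simp add: divide_eq_eq mult_ac)
      then show ?thesis
        using card_W[of k] \<open>card (W' k) \<le> card (W k)\<close> by (simp add: mult_ac)
    qed
    have bF: "bounded ?F"
      using fixed_points_subset_limit_set bounded_limit_set bounded_subset by blast
    define A where "A k = (SOME A. finite A \<and> card A = covering_number (r * 2 ^ k) ?F \<and>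
        ?F \<subseteq> (\<Union>a\<in>A. ball a (r * 2 ^ k)))" for k :: nat
    have "finite (A k) \<and> card (A k) = covering_number (r * 2 ^ k) ?F \<and> ?F \<subseteq> (\<Union>a\<in>A k. ball a (r * 2 ^ k))" for k
      unfolding A_def
    proof (rule someI_ex)
      have "0 < r * 2 ^ k"
        using r by simp
      obtain A where "finite A" "card A = covering_number (r * 2 ^ k) ?F" "?F \<subseteq> (\<Union>a\<in>A. ball a (r * 2 ^ k))"
        by (rule covering_number_cover[OF bF \<open>0 < r * 2 ^ k\<close>])
      then show "\<exists>A. finite A \<and> card A = covering_number (r * 2 ^ k) ?F \<and> ?F \<subseteq> (\<Union>a\<in>A. ball a (r * 2 ^ k))"
        by (intro exI[of _ A] conjI)
    qed
    then have A: "\<And>k. finite (A k)" "\<And>k. card (A k) = covering_number (r * 2 ^ k) ?F"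
      "\<And>k. ?F \<subseteq> (\<Union>a\<in>A k. ball a (r * 2 ^ k))"
      by simp_all
    have ex_G: "\<exists>G. finite G \<and> card G \<le> M' \<and> word_map S w ` (cball a (D * (r * 2 ^ k)) \<inter> X) \<subseteq> (\<Union>g\<in>G. ball g r)"
      if w: "w \<in> W' k" for k w a
    proof (cases "cball a (D * (r * 2 ^ k)) \<inter> X = {}")
      case True
      then show ?thesis
        by (intro exI[of _ "{}"]) simp
    next
      case False
      \<comment> \<open>The centre \<open>a\<close> may lie outside \<open>X\<close>, where the word
        map is not controlled. Recentring at a point \<open>z\<close> of \<open>X\<close> doubles
        the radius, which explains the 2 in \<open>2 * L * D\<close>.\<close>
      then obtain z where z: "z \<in> cball a (D * (r * 2 ^ k))" "z \<in> X"
        by auto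
      have wI: "w \<in> lists I" "size w \<le> (1 / 2) ^ k"
        using w unfolding W'_def W_def by auto
      from M'[rule_format, OF r(1), of "word_map S w z"]
      obtain G where G: "finite G" "card G \<le> M'" "cball (word_map S w z) (2 * L * D * r) \<subseteq> (\<Union>g\<in>G. ball g r)"
        by (elim exE conjE)
      have "word_map S w ` (cball a (D * (r * 2 ^ k)) \<inter> X) \<subseteq> cball (word_map S w z) (2 * L * D * r)"
      proof clarify
        fix y assume y: "y \<in> cball a (D * (r * 2 ^ k))" "y \<in> X"
        have "dist z y \<le> 2 * (D * (r * 2 ^ k))"
          using z(1) y(1) dist_triangle[of z y a] by (simp add: dist_commute)
        then have "L * size w * dist z y \<le> L * (1 / 2) ^ k * (2 * (D * (r * 2 ^ k)))"
          using L wI(2) size_pos[OF wI(1)] by (intro mult_mono) auto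
        also have "\<dots> = 2 * L * D * r"
          by (simp add: power_one_over)
        finally show "word_map S w y \<in> cball (word_map S w z) (2 * L * D * r)"
          using word_lipschitz[OF wI(1) z(2) y(2)] by simp
      qed
      with G show ?thesis
        by (intro exI[of _ G]) simp
    qed
    define G where "G k w a = (SOME G. finite G \<and> card G \<le> M' \<and>
        word_map S w ` (cball a (D * (r * 2 ^ k)) \<inter> X) \<subseteq> (\<Union>g\<in>G. ball g r))" for k w a
    have G: "finite (G k w a)" "card (G k w a) \<le> M'"
      "word_map S w ` (cball a (D * (r * 2 ^ k)) \<inter> X) \<subseteq> (\<Union>g\<in>G k w a. ball g r)" if "w \<in> W' k" for k w a
      using someI_ex[OF ex_G[OF that, of a]] unfolding G_def by simp_all
    define H where "H k = (\<Union>(w, a)\<in>W' k \<times> A k. G k w a)" for k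
    have card_H: "real (card (H k)) \<le> C * B" if "k \<in> kk" for k
    proof -
      have "card (H k) \<le> (\<Sum>(w, a)\<in>W' k \<times> A k. card (G k w a))"
        unfolding H_def using fin_W' A(1) card_UN_le[of "W' k \<times> A k" "\<lambda>(w, a). G k w a"]
        by (simp add: case_prod_unfold)
      also have "\<dots> \<le> (\<Sum>(w, a)\<in>W' k \<times> A k. M')"
        using G(2) by (intro sum_mono) auto
      also have "\<dots> = card (W' k) * card (A k) * M'"
        by (simp add: card_cartesian_product case_prod_unfold)
      finally have "real (card (H k)) \<le> real (card (W' k)) * real (card (A k)) * real M'"
        by (metis of_nat_le_iff of_nat_mult)
      also have "\<dots> \<le> (M * 2 powr t * (2 ^ k) powr t) * real (card (A k)) * (real M' + 1)"
        using card_W'[of k] M(1) by (intro mult_mono) auto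
      also have "\<dots> = C * ((r * 2 ^ k / r) powr t * real (covering_number (r * 2 ^ k) ?F))"
        using r by (simp add: A(2) C_def mult_ac)
      also have "\<dots> \<le> C * B"
        using that r \<open>0 < C\<close> unfolding kk_def by (intro mult_left_mono B) auto
      finally show ?thesis .
    qed
    have "?\<Lambda> \<subseteq> (\<Union>g\<in>(\<Union>k\<in>kk. H k). ball g r)"
    proof
      fix x assume "x \<in> ?\<Lambda>"
      then obtain w y p where w: "w \<in> lists I" "r < size w" and y: "y \<in> X" "x = word_map S w y"
        and p: "p \<in> ?F" "dist p y \<le> L * K * diameter X * (r / size w)"
        by (rule limit_set_point_near_fixed_point[OF _ r])
      obtain n where "(1 / 2) ^ n < size w"
        using real_arch_pow_inv[of "size w" "1 / 2"] size_pos[OF w(1)] by auto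
      moreover have "(1 / 2) ^ Suc n \<le> (1 / 2 :: real) ^ n"
        by (intro power_decreasing) auto
      ultimately have "(1 / 2) ^ Suc n < size w"
        by (rule le_less_trans[rotated])
      then have "\<exists>k. (1 / 2) ^ Suc k < size w"
        by (rule exI)
      define k where "k = (LEAST k. (1 / 2) ^ Suc k < size w)"
      have k1: "(1 / 2) ^ Suc k < size w"
        unfolding k_def by (rule LeastI_ex) fact
      have k2: "size w \<le> (1 / 2) ^ k"
      proof (cases k)
        case 0
        then show ?thesis
          using size_le_1[OF w(1)] by simp
      next
        case (Suc j)
        then have "\<not> (1 / 2) ^ Suc j < size w"
          unfolding k_def by (intro not_less_Least) simp
        then show ?thesis
          by (simp add: Suc)
      qed
      have "r * 2 ^ k < (1 / 2) ^ k * 2 ^ k"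
        using w(2) k2 by (intro mult_strict_right_mono) auto
      then have "k \<in> kk"
        by (simp add: kk_def power_one_over)
      have wW: "w \<in> W' k"
        unfolding W'_def W_def using w(1) k1 k2 by simp
      obtain a where a: "a \<in> A k" "p \<in> ball a (r * 2 ^ k)"
        using A(3)[of k] p(1) by auto
      have "r / size w \<le> r / (1 / 2) ^ Suc k"
        using k1 r size_pos[OF w(1)] by (intro divide_left_mono mult_pos_pos) auto
      also have "\<dots> = 2 * (r * 2 ^ k)"
        by (simp add: power_one_over)
      finally have "L * K * diameter X * (r / size w) \<le> L * K * diameter X * (2 * (r * 2 ^ k))"
        using L K compact_X by (intro mult_left_mono) (auto simp: compact_imp_bounded diameter_ge_0)
      then have "dist a y \<le> D * (r * 2 ^ k)"
        using a(2) p(2) dist_triangle[of a y p] unfolding D_def by (simp add: algebra_simps)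
      then have "x \<in> word_map S w ` (cball a (D * (r * 2 ^ k)) \<inter> X)"
        using y by auto
      then obtain g where "g \<in> G k w a" "x \<in> ball g r"
        using G(3)[OF wW, of a] by auto
      then show "x \<in> (\<Union>g\<in>(\<Union>k\<in>kk. H k). ball g r)"
        unfolding H_def using \<open>k \<in> kk\<close> wW a(1) by auto
    qed
    moreover have fin_H: "finite (\<Union>k\<in>kk. H k)"
      unfolding H_def using fin_kk fin_W' A(1) G(1) by auto
    ultimately have "covering_number r ?\<Lambda> \<le> card (\<Union>k\<in>kk. H k)"
      by (intro covering_number_le)
    also have "\<dots> \<le> (\<Sum>k\<in>kk. card (H k))"
      using fin_kk by (rule card_UN_le)
    finally have "real (covering_number r ?\<Lambda>) \<le> (\<Sum>k\<in>kk. real (card (H k)))"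
      by (metis of_nat_le_iff of_nat_sum)
    also have "\<dots> \<le> (\<Sum>k\<in>kk. C * B)"
      using card_H by (rule sum_mono)
    also have "\<dots> = real (card kk) * (C * B)"
      by simp
    also have "\<dots> \<le> (1 + ln (1 / r) / ln 2) * (C * B)"
    proof (rule mult_right_mono[OF card_kk])
      \<comment> \<open>Non-negativity of \<open>B\<close> comes from its hypothesis at
        \<open>\<rho> = r\<close>.\<close>
      have "0 \<le> (r / r) powr t * real (covering_number r ?F)"
        by simp
      also have "\<dots> \<le> B"
        using r by (intro B) auto
      finally show "0 \<le> C * B"
        using \<open>0 < C\<close> by simp
    qed
    finally show ?thesis
      by (simp add: mult_ac)
  qed
  ultimately show ?thesis
    by (rule that)
qed

lemma limit_set_nonempty: "limit_set I S X \<noteq> {}"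
  using fixed_points_nonempty fixed_points_subset_limit_set by auto

section \<open>Comparison of the box quotient with the supremum\<close>

lemma psi_le_box_quotient_eventually:
  assumes "0 < e"
  shows "\<forall>\<^sub>F r in at_right 0. psi h (fixed_points I S X) r \<le> box_quotient (limit_set I S X) r + e"
proof -
  let ?\<Lambda> = "limit_set I S X" and ?F = "fixed_points I S X"
  \<comment> \<open>Truncation at 0 keeps \<open>t\<close> admissible; when it takes effect,
    \<open>h\<close> itself is at most \<open>e / 2\<close>. Half of \<open>e\<close> is spent on
    \<open>h - t\<close> and half on \<open>ln C / ln (1 / r)\<close>.\<close>
  define t where "t = max 0 (h - e / 2)"
  have t: "0 \<le> t" "t < h \<or> t = 0" "h - t \<le> e / 2" "t \<le> h"
    using h_nonneg assms by (auto simp: t_def max_def)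
  obtain C where C: "0 < C"
    "\<And>r \<rho> F. \<lbrakk>0 < r; r \<le> \<rho>; \<rho> \<le> 1; F \<subseteq> ?\<Lambda>\<rbrakk> \<Longrightarrow>
       (\<rho> / r) powr t * real (covering_number \<rho> F) \<le> C * real (covering_number r ?\<Lambda>)"
    by (rule covering_number_limit_set_ge[OF t(1,2)]) blast
  have bF: "bounded ?F"
    using fixed_points_subset_limit_set bounded_limit_set bounded_subset by blast
  have "filterlim (\<lambda>r::real. ln (1 / r)) at_top (at_right 0)"
    using filterlim_compose[OF ln_at_top filterlim_inverse_at_top_right] by (simp add: inverse_eq_divide)
  then have "((\<lambda>r::real. ln C / ln (1 / r)) \<longlongrightarrow> 0) (at_right 0)"
    by (intro tendsto_divide_0[OF tendsto_const] filterlim_at_top_imp_at_infinity)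
  then have "\<forall>\<^sub>F r in at_right 0. ln C / ln (1 / r) < e / 2"
    using assms by (intro order_tendstoD(2)) auto
  moreover have "\<forall>\<^sub>F r in at_right 0. (0::real) < r \<and> r < 1"
    by (rule eventually_at_rightI[of 0 1]) auto
  ultimately show ?thesis
  proof eventually_elim
    case (elim r)
    then have r: "0 < r" "r < 1"
      by auto
    define l where "l = ln (1 / r)"
    have l: "0 < l" "ln r = - l"
      using r by (simp_all add: l_def ln_div)
    have lnC: "ln C / l < e / 2"
      using elim unfolding l_def by blast
    show ?case
    proof (rule psi_le[OF r bF])
      fix \<theta> :: real assume \<theta>: "0 < \<theta>" "\<theta> \<le> 1"
      define \<rho> where "\<rho> = r powr \<theta>"
      have \<rho>: "r \<le> \<rho>" "\<rho> \<le> 1" "0 < \<rho>" "ln \<rho> = - \<theta> * l"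
        using r \<theta> powr_mono'[of \<theta> 1 r] powr_le1[of \<theta> r] by (auto simp: \<rho>_def ln_powr l)
      have pos: "0 < covering_number \<rho> ?F" "0 < covering_number r ?\<Lambda>"
        using bF fixed_points_nonempty limit_set_nonempty bounded_limit_set r \<rho>(3)
        by - (rule covering_number_pos; assumption)+
      have "ln ((\<rho> / r) powr t * real (covering_number \<rho> ?F)) \<le> ln (C * real (covering_number r ?\<Lambda>))"
        using C(2)[OF r(1) \<rho>(1,2) fixed_points_subset_limit_set] pos r \<rho> C(1)
        by (subst ln_le_cancel_iff) auto
      then have "t * (ln \<rho> - ln r) + ln (real (covering_number \<rho> ?F)) \<le> ln C + ln (real (covering_number r ?\<Lambda>))"
        using pos r \<rho> C(1) by (simp add: ln_mult ln_powr ln_div)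
      then have "(1 - \<theta>) * t * l + ln (real (covering_number \<rho> ?F)) \<le> ln C + ln (real (covering_number r ?\<Lambda>))"
        by (simp add: \<rho>(4) l(2) algebra_simps)
      then have "((1 - \<theta>) * t * l + ln (real (covering_number \<rho> ?F))) / l \<le> (ln C + ln (real (covering_number r ?\<Lambda>))) / l"
        using l by (intro divide_right_mono) auto
      then have "(1 - \<theta>) * t + ln (real (covering_number \<rho> ?F)) / l \<le> ln C / l + box_quotient ?\<Lambda> r"
        using l by (simp add: box_quotient_def l_def[symmetric] add_divide_distrib)
      moreover have "(1 - \<theta>) * (h - t) \<le> 1 * (e / 2)"
        using \<theta> t assms by (intro mult_mono) auto
      moreover have "Psi_pos h ?F r \<theta> = (1 - \<theta>) * t + (1 - \<theta>) * (h - t) + ln (real (covering_number \<rho> ?F)) / l"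
        using Psi_pos_eq[OF r \<theta>(1), of h ?F] by (simp add: \<rho>_def l_def algebra_simps)
      ultimately show "Psi_pos h ?F r \<theta> \<le> box_quotient ?\<Lambda> r + e"
        using lnC by linarith
    qed
  qed
qed

lemma box_quotient_le_psi_eventually:
  assumes "0 < e"
  shows "\<forall>\<^sub>F r in at_right 0. box_quotient (limit_set I S X) r \<le> psi h (fixed_points I S X) r + e"
proof -
  let ?\<Lambda> = "limit_set I S X" and ?F = "fixed_points I S X"
  define t where "t = h + e / 2"
  have t: "h < t"
    using assms by (simp add: t_def)
  obtain C where C: "0 < C"
    "\<And>r B. \<lbrakk>0 < r; r < 1; \<And>\<rho>. \<lbrakk>r \<le> \<rho>; \<rho> < 1\<rbrakk> \<Longrightarrow> (\<rho> / r) powr t * real (covering_number \<rho> ?F) \<le> B\<rbrakk> \<Longrightarrow>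
       real (covering_number r ?\<Lambda>) \<le> C * (1 + ln (1 / r) / ln 2) * B"
    by (rule covering_number_limit_set_le[OF t]) blast
  have bF: "bounded ?F"
    using fixed_points_subset_limit_set bounded_limit_set bounded_subset by blast
  \<comment> \<open>At \<open>x = ln (1 / r)\<close> this is the error from the constant and the
    number of scales. It vanishes in the limit because \<open>1 + x / ln 2 \<le> 4 * x\<close> for
    \<open>1 \<le> x\<close>.\<close>
  define g where "g x = (ln C + ln (1 + x / ln 2)) / x" for x :: real
  have lim: "filterlim (\<lambda>r::real. ln (1 / r)) at_top (at_right 0)"
    using filterlim_compose[OF ln_at_top filterlim_inverse_at_top_right] by (simp add: inverse_eq_divide)
  have "((\<lambda>x. (ln C + ln 4) / x + ln x / x) \<longlongrightarrow> 0 + 0) at_top"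
    by (intro tendsto_add tendsto_divide_0[OF tendsto_const] filterlim_at_top_imp_at_infinity
        filterlim_ident ln_x_over_x_tendsto_0)
  then have "\<forall>\<^sub>F x in at_top. (ln C + ln 4) / x + ln x / x < e / 2"
    using assms by (intro order_tendstoD(2)) auto
  then have "\<forall>\<^sub>F x in at_top. g x < e / 2"
    using eventually_ge_at_top[of 1]
  proof eventually_elim
    case (elim x)
    have "1 / 2 \<le> ln (2::real)"
      using ln2_ge_two_thirds by simp
    then have "x / ln 2 \<le> x / (1 / 2)"
      using elim by (intro divide_left_mono) auto
    then have "1 + x / ln 2 \<le> 4 * x"
      using elim by simp
    then have "ln (1 + x / ln 2) \<le> ln (4 * x)"
      using elim by (subst ln_le_cancel_iff) (auto intro: add_pos_nonneg)
    also have "\<dots> = ln 4 + ln x"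
      using elim by (simp add: ln_mult)
    finally have "g x \<le> (ln C + (ln 4 + ln x)) / x"
      unfolding g_def using elim by (intro divide_right_mono) auto
    also have "\<dots> = (ln C + ln 4) / x + ln x / x"
      by (simp add: add_divide_distrib)
    finally show ?case
      using elim(1) by (rule le_less_trans)
  qed
  then have "\<forall>\<^sub>F r in at_right 0. g (ln (1 / r)) < e / 2"
    using lim unfolding filterlim_iff by blast
  moreover have "\<forall>\<^sub>F r in at_right 0. (0::real) < r \<and> r < 1"
    by (rule eventually_at_rightI[of 0 1]) auto
  ultimately show ?thesis
  proof eventually_elim
    case (elim r)
    then have r: "0 < r" "r < 1"
      by auto
    define l where "l = ln (1 / r)"
    have l: "0 < l" "ln r = - l"
      using r by (simp_all add: l_def ln_div)
    let ?p = "psi h ?F r + e / 2"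
    \<comment> \<open>The bound supplied for \<open>B\<close> is \<open>r\<close> to the power
      \<open>- ?p\<close>.\<close>
    have "real (covering_number r ?\<Lambda>) \<le> C * (1 + ln (1 / r) / ln 2) * exp (l * ?p)"
    proof (rule C(2)[OF r])
      fix \<rho> assume \<rho>: "r \<le> \<rho>" "\<rho> < 1"
      \<comment> \<open>Chosen so that \<open>\<rho> = r powr \<theta>\<close>: every scale from
        \<open>r\<close> up to 1 (excluded) has this form with \<open>0 < \<theta>\<close> and
        \<open>\<theta> \<le> 1\<close>, so the supremum controls it.\<close>
      define \<theta> where "\<theta> = ln \<rho> / ln r"
      have "0 < \<rho>" "ln \<rho> < 0" "ln r \<le> ln \<rho>"
        using \<rho> r by auto
      then have \<theta>: "0 < \<theta>" "\<theta> \<le> 1"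
        using r by (auto simp: \<theta>_def field_simps zero_less_divide_iff)
      have ln_\<rho>: "ln \<rho> = - \<theta> * l"
        using l by (simp add: \<theta>_def)
      have "\<rho> = exp (ln \<rho>)"
        using \<open>0 < \<rho>\<close> by simp
      also have "\<dots> = r powr \<theta>"
        using r by (simp add: powr_def ln_\<rho> l)
      finally have \<rho>_eq: "\<rho> = r powr \<theta>" .
      have pos: "0 < covering_number \<rho> ?F"
        using bF fixed_points_nonempty \<open>0 < \<rho>\<close> by (intro covering_number_pos)
      have "(1 - \<theta>) * t + ln (real (covering_number \<rho> ?F)) / l = Psi_pos h ?F r \<theta> + (1 - \<theta>) * (e / 2)"
        using Psi_pos_eq[OF r \<theta>(1), of h ?F] by (simp add: \<rho>_eq l_def t_def algebra_simps)
      also have "\<dots> \<le> ?p"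
        using \<theta> assms Psi_pos_le_psi[OF r bF fixed_points_nonempty h_nonneg \<theta>]
        by (intro add_mono) (auto intro: mult_left_le_one_le)
      finally have "l * ((1 - \<theta>) * t + ln (real (covering_number \<rho> ?F)) / l) \<le> l * ?p"
        using l by (intro mult_left_mono) auto
      then have "t * (ln \<rho> - ln r) + ln (real (covering_number \<rho> ?F)) \<le> l * ?p"
        using l ln_\<rho> by (simp add: algebra_simps)
      then have "exp (t * (ln \<rho> - ln r) + ln (real (covering_number \<rho> ?F))) \<le> exp (l * ?p)"
        by simp
      moreover have "(\<rho> / r) powr t = exp (t * (ln \<rho> - ln r))"
        using r \<open>0 < \<rho>\<close> by (simp add: powr_def ln_div)
      ultimately show "(\<rho> / r) powr t * real (covering_number \<rho> ?F) \<le> exp (l * ?p)"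
        using pos by (simp add: exp_add)
    qed
    moreover have "0 < covering_number r ?\<Lambda>"
      using limit_set_nonempty bounded_limit_set r by (intro covering_number_pos)
    moreover have l2: "0 < 1 + l / ln 2"
      using l by (simp add: add_pos_nonneg)
    ultimately have "ln (real (covering_number r ?\<Lambda>)) \<le> ln (C * (1 + l / ln 2) * exp (l * ?p))"
      using C(1) unfolding l_def[symmetric] by (subst ln_le_cancel_iff) auto
    also have "\<dots> = ln C + ln (1 + l / ln 2) + l * ?p"
      using C(1) l2 by (subst ln_mult; simp add: ln_mult)
    finally have "ln (real (covering_number r ?\<Lambda>)) / l \<le> (ln C + ln (1 + l / ln 2) + l * ?p) / l"
      using l by (intro divide_right_mono) auto
    also have "\<dots> = g l + ?p"
      using l by (simp add: g_def add_divide_distrib)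
    finally show ?case
      using elim unfolding box_quotient_def l_def by simp
  qed
qed

theorem box_quotient_limit_set_asymptotics:
  "((\<lambda>r. box_quotient (limit_set I S X) r - psi h (fixed_points I S X) r) \<longlongrightarrow> 0) (at_right 0)"
proof (rule tendstoI)
  fix e :: real assume "0 < e"
  then have e: "0 < e / 2"
    by simp
  show "\<forall>\<^sub>F r in at_right 0. dist (box_quotient (limit_set I S X) r - psi h (fixed_points I S X) r) 0 < e"
    using psi_le_box_quotient_eventually[OF e] box_quotient_le_psi_eventually[OF e]
    by eventually_elim (use \<open>0 < e\<close> in \<open>simp add: dist_real_def abs_less_iff\<close>)
qed

end

section \<open>Conformal iterated function systems\<close>

text \<open>\<open>size w\<close> is the conformal factor at one interior point \<open>x0\<close>.
  Bounded distortion makes it comparable with the factor at every point of \<open>V\<close>, and the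
  chain rule then gives \<open>size_append\<close>.\<close>

theorem CIFS_imp_conformal_system:
  fixes S :: "'i \<Rightarrow> real ^ 'n \<Rightarrow> real ^ 'n"
  assumes CIFS: "CIFS I S X"
  obtains U size K L c \<kappa> where "conformal_system I S X U size K L c \<kappa>"
proof -
  note cifs = CIFS[unfolded CIFS_def]
  let ?d = "CARD('n)"
  have I_ne: "I \<noteq> {}"
    using cifs by (elim conjE)
  have countable_I: "countable I"
    using cifs by (elim conjE)
  have X: "compact X"
    using cifs by (elim conjE)
  have SX: "S i ` X \<subseteq> X" if "i \<in> I" for i
    using cifs that by (elim conjE) simp
  have int_ne: "interior X \<noteq> {}"
    using cifs by (elim conjE)
  have S_int: "S i ` interior X \<subseteq> interior X" if "i \<in> I" for i
    using cifs that by (elim conjE) simp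
  have S_disj: "S i ` interior X \<inter> S j ` interior X = {}" if "i \<in> I" "j \<in> I" "i \<noteq> j" for i j
    using cifs that by (elim conjE) simp
  have cone: "0 < (INF x\<in>X. INF r\<in>{0<..<1::real}. measure lebesgue (ball x r \<inter> interior X) / r ^ ?d)"
    using cifs by (elim conjE)
  obtain c where c: "0 < c" "c < 1" and "\<forall>i\<in>I. \<forall>x\<in>X. \<forall>y\<in>X. x \<noteq> y \<longrightarrow>
           0 < norm (S i x - S i y) \<and> norm (S i x - S i y) \<le> c * norm (x - y)"
    using cifs by (elim conjE exE) (rule that; assumption)
  then have S_contr: "0 < norm (S i x - S i y)" "norm (S i x - S i y) \<le> c * norm (x - y)"
    if "i \<in> I" "x \<in> X" "y \<in> X" "x \<noteq> y" for i x y
    using that by simp_all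
  obtain V T \<epsilon> K where V: "open V" "bounded V" "connected V" "X \<subseteq> V"
    and T: "\<forall>i\<in>I. (\<forall>x\<in>X. T i x = S i x) \<and> T i ` V \<subseteq> V \<and>
            C1_holder_diffeo_on \<epsilon> (T i) V \<and> conformal_on (T i) V"
    and K: "1 \<le> K" and dist: "\<forall>w\<in>lists I. \<forall>x\<in>V. \<forall>y\<in>V.
            spectral_norm (jacobian (word_map T w) (at x)) \<le>
              K * spectral_norm (jacobian (word_map T w) (at y))"
    using cifs by (elim conjE exE) (rule that; assumption)
  define U where "U = interior X"
  have UX: "U \<subseteq> X"
    unfolding U_def by (rule interior_subset)
  have T_S: "T i x = S i x" if "i \<in> I" "x \<in> X" for i x
    using T that by simp
  have T_V: "T i ` V \<subseteq> V" if "i \<in> I" for i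
    using T that by simp
  have T_inj: "inj_on (T i) V" if "i \<in> I" for i
    using T that by (simp add: C1_holder_diffeo_on_def)
  have T_conf: "conformal_on (T i) V" if "i \<in> I" for i
    using T that by simp
  have wV: "word_map T w x \<in> V" if "w \<in> lists I" "x \<in> V" for w x
    using that by (induction w) (use T_V in auto)
  have wX: "word_map S w x \<in> X" "word_map T w x = word_map S w x" if "w \<in> lists I" "x \<in> X" for w x
  proof -
    have "word_map S w x \<in> X \<and> word_map T w x = word_map S w x"
      using that(1)
    proof (induction w)
      case (Cons i w)
      then show ?case
        using SX[of i] T_S[of i "word_map S w x"] by auto
    qed (use that in simp)
    then show "word_map S w x \<in> X" "word_map T w x = word_map S w x"
      by auto
  qed
  have w_inj: "inj_on (word_map T w) V" if "w \<in> lists I" for w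
    using that
  proof (induction w)
    case (Cons i w)
    have "word_map T w ` V \<subseteq> V"
      using wV Cons.hyps(2) by auto
    then have "inj_on (T i) (word_map T w ` V)"
      using T_inj[OF Cons.hyps(1)] by (rule inj_on_subset[rotated])
    with Cons.IH show ?case
      unfolding word_map_Cons by (rule comp_inj_on)
  qed simp
  \<comment> \<open>Jacobians are taken of the extensions \<open>T\<close>, because the values of
    \<open>S\<close> off \<open>X\<close> are arbitrary.\<close>
  define factor where "factor w x = spectral_norm (jacobian (word_map T w) (at x))" for w x
  have conf: "conformal_at (word_map T w) x (factor w x)" if w: "w \<in> lists I" and x: "x \<in> V" for w x
  proof -
    have "\<exists>a. conformal_at (word_map T w) x a"
      using w
    proof (induction w)
      case Nil
      show ?case
        unfolding word_map_Nil using conformal_at_id by (rule exI)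
    next
      case (Cons i w)
      then obtain a where a: "conformal_at (word_map T w) x a"
        by blast
      obtain b where "conformal_at (T i) (word_map T w x) b"
        by (rule conformal_on_conformal_at[OF T_conf[OF Cons.hyps(1)] wV[OF Cons.hyps(2) x]])
      then have "conformal_at (T i \<circ> word_map T w) x (b * a)"
        using a by (rule conformal_at_comp[rotated])
      then show ?case
        unfolding word_map_Cons by (rule exI)
    qed
    then obtain a where a: "conformal_at (word_map T w) x a" ..
    then show ?thesis
      unfolding factor_def using conformal_at_spectral_norm by metis
  qed
  have factor_append: "factor (v @ w) x = factor v (word_map T w x) * factor w x"
    if "v \<in> lists I" "w \<in> lists I" "x \<in> V" for v w x
  proof -
    have "conformal_at (word_map T v \<circ> word_map T w) x (factor v (word_map T w x) * factor w x)"
      using that by (intro conformal_at_comp conf wV)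
    then show ?thesis
      unfolding factor_def[of "v @ w"] word_map_append by (rule conformal_at_spectral_norm)
  qed
  have factor_le: "factor w x \<le> K * factor w y" if "w \<in> lists I" "x \<in> V" "y \<in> V" for w x y
    using dist that unfolding factor_def by simp
  obtain x0 where x0: "x0 \<in> U"
    using int_ne unfolding U_def by blast
  then have x0V: "x0 \<in> V" and x0X: "x0 \<in> X"
    using UX V(4) by auto
  define size where "size w = factor w x0" for w
  have size_pos: "0 < size w" if "w \<in> lists I" for w
    unfolding size_def using conformal_at_pos[OF conf[OF that x0V]] .
  have word_contr: "dist (word_map S w x) (word_map S w y) \<le> c ^ length w * dist x y"
    if "w \<in> lists I" "x \<in> X" "y \<in> X" for w x y
    using that(1)
  proof (induction w)
    case (Cons i w)
    have "dist (S i (word_map S w x)) (S i (word_map S w y)) \<le> c * dist (word_map S w x) (word_map S w y)"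
      using S_contr(2)[OF Cons.hyps(1) wX(1)[OF Cons.hyps(2) that(2)] wX(1)[OF Cons.hyps(2) that(3)]]
      by (cases "word_map S w x = word_map S w y") (simp_all add: dist_norm)
    also have "\<dots> \<le> c * (c ^ length w * dist x y)"
      using Cons.IH c by simp
    finally show ?case
      by simp
  qed simp
  obtain L where L: "0 < L"
    "\<And>f A x y. \<lbrakk>\<And>z. z \<in> V \<Longrightarrow> \<exists>a\<le>A. conformal_at f z a; x \<in> X; y \<in> X\<rbrakk> \<Longrightarrow> dist (f x) (f y) \<le> L * A * dist x y"
    by (rule conformal_lipschitz_on_compact[OF V(1,3) X V(4)]) blast
  define \<kappa> where "\<kappa> = (INF x\<in>X. INF r\<in>{0<..<1::real}. measure lebesgue (ball x r \<inter> U) / r ^ ?d)"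
  have \<kappa>: "0 < \<kappa>"
    using cone unfolding \<kappa>_def U_def .
  have \<kappa>_le: "\<kappa> * r ^ ?d \<le> measure lebesgue (ball x r \<inter> U)" if "x \<in> X" "0 < r" "r < 1" for x r
  proof -
    let ?q = "\<lambda>x r. measure lebesgue (ball x r \<inter> U) / r ^ ?d"
    have inner: "bdd_below (?q x ` {0<..<1})" for x
      by (intro bdd_belowI2[of _ 0]) auto
    have "\<kappa> \<le> (INF r\<in>{0<..<1::real}. ?q x r)"
      unfolding \<kappa>_def
    proof (rule cINF_lower[OF _ that(1)], rule bdd_belowI2)
      show "0 \<le> (INF r\<in>{0<..<1::real}. ?q x r)" for x
        by (rule cINF_greatest) auto
    qed
    also have "\<dots> \<le> ?q x r"
      using that by (intro cINF_lower[OF inner]) auto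
    finally show ?thesis
      using that by (simp add: field_simps)
  qed
  \<comment> \<open>Factors on \<open>V\<close> lie between \<open>size w / K\<close> and
    \<open>K * size w\<close>. The upper bound gives the Lipschitz constant \<open>L * K\<close>,
    the lower one the volume constant \<open>\<kappa> / K ^ ?d\<close>.\<close>
  have "conformal_system I S X U size K (L * K) c (\<kappa> / K ^ ?d)"
  proof (unfold_locales, goal_cases)
    case 5
    show ?case
      using x0 by blast
  next
    case (7 i)
    then show ?case
      using S_int unfolding U_def by simp
  next
    case (8 i)
    show ?case
    proof (rule inj_onI, rule ccontr)
      fix x y assume "x \<in> X" "y \<in> X" "S i x = S i y" "x \<noteq> y"
      then show False
        using S_contr(1)[OF 8] by fastforce
    qed
  next
    case (9 i j)
    then show ?case
      using S_disj unfolding U_def by simp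
  next
    case (10 i x y)
    then show ?case
      using S_contr(2)[of i x y] by (cases "x = y") (simp_all add: dist_norm)
  next
    case (17)
    show ?case
      unfolding size_def factor_def word_map_Nil by (rule conformal_at_spectral_norm[OF conformal_at_id])
  next
    case (18 w)
    \<comment> \<open>Contraction is known on \<open>X\<close> only; since \<open>x0\<close> is
      interior, it holds on a whole ball around \<open>x0\<close> and so bounds the conformal factor
      there.\<close>
    obtain e where e: "0 < e" "ball x0 e \<subseteq> U"
      using x0 open_interior unfolding U_def by (meson openE)
    show ?case
      unfolding size_def
    proof (rule conformal_factor_le[OF conf[OF 18 x0V] e(1)])
      fix y assume "y \<in> ball x0 e"
      then have "y \<in> X"
        using e(2) UX by blast
      then show "dist (word_map T w y) (word_map T w x0) \<le> c ^ length w * dist y x0"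
        using word_contr[OF 18 _ x0X] wX(2)[OF 18] x0X by simp
    qed
  next
    case (19 v w)
    have "size v * size w \<le> K * factor v (word_map T w x0) * size w"
      using factor_le[OF 19(1) x0V wV[OF 19(2) x0V]] size_pos[OF 19(2)]
      by (intro mult_right_mono) (auto simp: size_def)
    then show ?case
      using factor_append[OF 19 x0V] by (simp add: size_def mult.assoc)
  next
    case (20 w x y)
    have "dist (word_map T w x) (word_map T w y) \<le> L * (K * size w) * dist x y"
    proof (rule L(2))
      show "\<exists>a\<le>K * size w. conformal_at (word_map T w) z a" if "z \<in> V" for z
        using conf[OF 20(1) that] factor_le[OF 20(1) that x0V] unfolding size_def by blast
    qed (use 20 in auto)
    then show ?case
      using wX(2)[OF 20(1)] 20(2,3) by (simp add: mult.assoc)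
  next
    case (21 w y \<rho>)
    let ?G = "ball y \<rho> \<inter> U"
    let ?f = "word_map T w"
    have GX: "?G \<subseteq> X" and GV: "?G \<subseteq> V"
      using UX V(4) by blast+
    have G: "open ?G" "bounded ?G"
      unfolding U_def by (auto intro: bounded_subset[OF bounded_ball])
    have fG: "bounded (?f ` ?G)"
      using V(2) by (rule bounded_subset) (use wV[OF 21(1)] GV in blast)
    have m: "0 < size w / K"
      using size_pos[OF 21(1)] K by simp
    have inj: "inj_on ?f ?G"
      using w_inj[OF 21(1)] GV by (rule inj_on_subset)
    have cf: "\<exists>a\<ge>size w / K. conformal_at ?f z a" if "z \<in> ?G" for z
    proof -
      have "z \<in> V"
        using that GV by blast
      then have "size w \<le> K * factor w z"
        unfolding size_def using factor_le[OF 21(1) x0V] by blast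
      then have "size w / K \<le> factor w z"
        using K by (simp add: field_simps)
      then show ?thesis
        using conf[OF 21(1) \<open>z \<in> V\<close>] by blast
    qed
    note image = conformal_image_measure_ge[OF G fG m inj cf]
    have "\<kappa> / K ^ ?d * (size w * \<rho>) ^ ?d = (size w / K) ^ ?d * (\<kappa> * \<rho> ^ ?d)"
      by (simp add: power_mult_distrib power_divide)
    also have "\<dots> \<le> (size w / K) ^ ?d * measure lebesgue ?G"
      using \<kappa>_le[OF 21(2,3,4)] m by (intro mult_left_mono) auto
    also have "\<dots> \<le> measure lebesgue (?f ` ?G)"
      by (rule image(2))
    finally have "\<kappa> / K ^ ?d * (size w * \<rho>) ^ DIM(real ^ 'n) \<le> measure lebesgue (?f ` ?G)"
      by simp
    moreover have "?f ` ?G = word_map S w ` ?G"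
      using wX(2)[OF 21(1)] GX by (intro image_cong) auto
    ultimately show ?case
      using image(1) by (intro bexI[of _ "?f ` ?G"]) auto
  qed (use I_ne countable_I X UX SX c K L(1) \<kappa> size_pos in auto)
  then show ?thesis
    by (rule that)
qed

theorem theoremC:
  fixes I :: "'i set"
    and S :: "'i \<Rightarrow> real ^ 'n \<Rightarrow> real ^ 'n"
    and X \<Lambda> F :: "(real ^ 'n) set"
    and \<psi> :: "real \<Rightarrow> real"
  assumes "CIFS I S X"
  defines "\<Lambda> \<equiv> limit_set I S X"
    and "F \<equiv> fixed_points I S X"
    and "\<psi> \<equiv> psi (hausdorff_dim \<Lambda>) F"
  shows "((\<lambda>r. ln (real (covering_number r \<Lambda>)) / ln (1 / r) - \<psi> r) \<longlongrightarrow> 0) (at_right 0) \<and>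
         lower_box_dim \<Lambda> = Liminf (at_right 0) (\<lambda>r. ereal (\<psi> r))"
proof -
  obtain U size K L c \<kappa> where "conformal_system I S X U size K L c \<kappa>"
    by (rule CIFS_imp_conformal_system[OF assms(1)])
  then interpret conformal_system I S X U size K L c \<kappa> .
  have lim: "((\<lambda>r. box_quotient \<Lambda> r - \<psi> r) \<longlongrightarrow> 0) (at_right 0)"
    unfolding \<Lambda>_def F_def \<psi>_def by (rule box_quotient_limit_set_asymptotics)
  then have "lower_box_dim \<Lambda> = Liminf (at_right 0) (\<lambda>r. ereal (\<psi> r))"
    unfolding lower_box_dim_def by (rule Liminf_ereal_eq_of_tendsto_diff) simp
  with lim show ?thesis
    unfolding box_quotient_def by blast
qed

end
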